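(* Let $d=2$, $(\mathbb{M},\mathbb{L},T)\in\mathcal{T}^d$, and $S\subseteq\mathbb{L}$. Then the following statements are equivalent: (i) $S\oplus T$ and $S\oplus(-T)$ form a pair of nontrivially homometric $\mathbb{M}$-convex sets. (ii) There exist $k\in\mathbb{N}$, a basis $a_1,a_2$ of $\mathbb{M}$, and a basis $b_1,b_2$ of $\mathbb{L}$ such that the following conditions hold: (a) $b_1=(k+1)a_1-a_2$ and $b_2=ka_1+a_2$. (b) There exists $v\in\mathbb{M}$ such that $T+v=\{0,\ldots,k\}a_1\cup\bigl(\{0,\ldots,k-1\}a_1+a_2\bigr)$. (c) The set $S$ is not centrally symmetric, finite, two-dimensional, $\mathbb{L}$-convex, and every edge of the polygon $\mathrm{conv}(S)$ is parallel to $b_1$ or $b_2$ or $b_2-b_1$.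
   Context: $\mathbb{N}=\{1,2,3,\ldots\}$; $X+Y=\{x+y: x\in X,\ y\in Y\}$, $-X=\{-x:x\in X\}$, and $Aa=\{ta:t\in A\}$ for $A\subseteq\mathbb{R}$, $a\in\mathbb{R}^d$. The dimension of $X\subseteq\mathbb{R}^d$ is the maximal number of affinely independent points in $X$ minus $1$. The sum $X+Y$ is called direct, and is then written $X\oplus Y$, if each $z\in X+Y$ has a unique representation $z=x+y$ with $x\in X$, $y\in Y$. A lattice of rank $i$ in $\mathbb{R}^d$ is a set $\mathbb{Z}b_1+\cdots+\mathbb{Z}b_i$ with $b_1,\ldots,b_i$ linearly independent (a basis of the lattice). For a lattice $\mathbb{M}$ of rank $d$ in $\mathbb{R}^d$, a subset $K\subseteq\mathbb{M}$ is $\mathbb{M}$-convex if $K=C\cap\mathbb{M}$ for some convex $C\subseteq\mathbb{R}^d$. $\mathcal{T}^d$ is the set of all triples $(\mathbb{M},\mathbb{L},T)$ such that $\mathbb{M}$ and $\mathbb{L}$ are lattices of rank $d$ in $\mathbb{R}^d$ with $\mathbb{L}\subseteq\mathbb{M}$, $T$ is a nonempty finite $\mathbb{M}$-convex set, and $\mathbb{M}=\mathbb{L}\oplus T$. A set $K\subseteq\mathbb{R}^d$ is centrally symmetric if $K=2c-K$ for some $c\in\mathbb{R}^d$. For a finite $K\subseteq\mathbb{R}^d$ the covariogram is $g_K(u)=|K\cap(K+u)|$, $u\in\mathbb{R}^d$. Homometry is a notion for finite sets only: two finite sets $K,L$ are homometric if $g_K=g_L$; trivially homometric if they coincide up to translations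 and point reflections (i.e. $L=K+t$ for some $t\in\mathbb{R}^d$ or $L=2c-K$ for some $c\in\mathbb{R}^d$); nontrivially homometric if they are homometric but not trivially homometric. *)

theory Defs
  imports "HOL-Analysis.Analysis"
begin

text \<open>
  Minkowski sums are written with the sum of sets from \<open>Set_Algebras\<close>. The reflection
  \<open>-X = {-x. x \<in> X}\<close> must be written \<open>uminus ` X\<close>, because unary minus on sets is complement.
\<close>

definition direct :: "'a::plus set \<Rightarrow> 'a set \<Rightarrow> bool" where
  "direct X Y \<longleftrightarrow> (\<forall>z \<in> X + Y. \<exists>!p. p \<in> X \<times> Y \<and> z = fst p + snd p)"

definition multiples :: "real set \<Rightarrow> 'a::real_vector \<Rightarrow> 'a set" where
  "multiples A a = (\<lambda>t. t *\<^sub>R a) ` A"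

text \<open>
  A basis is a list, so that its length is the rank; \<open>distinct\<close> is needed to make linear
  independence of the set of its entries the linear independence of the family.
\<close>

definition lattice_basis :: "'a::real_vector list \<Rightarrow> 'a set \<Rightarrow> bool" where
  "lattice_basis bs L \<longleftrightarrow>
     distinct bs \<and> independent (set bs) \<and>
     L = {(\<Sum>i<length bs. of_int (z i) *\<^sub>R bs ! i) | z :: nat \<Rightarrow> int. True}"

definition lattice_of_rank :: "nat \<Rightarrow> 'a::real_vector set \<Rightarrow> bool" where
  "lattice_of_rank r L \<longleftrightarrow> (\<exists>bs. length bs = r \<and> lattice_basis bs L)"

definition lattice_convex :: "'a::real_vector set \<Rightarrow> 'a set \<Rightarrow> bool" where
  "lattice_convex M K \<longleftrightarrow> (\<exists>C. convex C \<and> K = C \<inter> M)"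

text \<open>The class \<open>\<T>\<^sup>d\<close>, where \<open>d\<close> is the dimension of the ambient Euclidean space.\<close>

definition tiling_triples :: "('a::euclidean_space set \<times> 'a set \<times> 'a set) set" where
  "tiling_triples =
     {(M, L, T). lattice_of_rank DIM('a) M \<and> lattice_of_rank DIM('a) L \<and> L \<subseteq> M \<and>
        T \<noteq> {} \<and> finite T \<and> lattice_convex M T \<and> M = L + T \<and> direct L T}"

definition centrally_symmetric :: "'a::real_vector set \<Rightarrow> bool" where
  "centrally_symmetric K \<longleftrightarrow> (\<exists>c. K = (\<lambda>x. 2 *\<^sub>R c - x) ` K)"

definition covariogram :: "'a::plus set \<Rightarrow> 'a \<Rightarrow> nat" where
  "covariogram K u = card (K \<inter> (\<lambda>x. x + u) ` K)"

definition homometric :: "'a::plus set \<Rightarrow> 'a set \<Rightarrow> bool" where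
  "homometric K L \<longleftrightarrow> finite K \<and> finite L \<and> covariogram K = covariogram L"

definition trivially_homometric :: "'a::real_vector set \<Rightarrow> 'a set \<Rightarrow> bool" where
  "trivially_homometric K L \<longleftrightarrow>
     finite K \<and> finite L \<and>
     ((\<exists>t. L = (\<lambda>x. x + t) ` K) \<or> (\<exists>c. L = (\<lambda>x. 2 *\<^sub>R c - x) ` K))"

definition nontrivially_homometric :: "'a::real_vector set \<Rightarrow> 'a set \<Rightarrow> bool" where
  "nontrivially_homometric K L \<longleftrightarrow> homometric K L \<and> \<not> trivially_homometric K L"

text \<open>Intended for one-dimensional \<open>E\<close> and \<open>u \<noteq> 0\<close>: the line through \<open>E\<close> is a translate of \<open>\<real>u\<close>.\<close>

definition parallel_to :: "'a::real_vector set \<Rightarrow> 'a \<Rightarrow> bool" where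
  "parallel_to E u \<longleftrightarrow> affine_parallel (affine hull E) (span {u})"

end

theory Submission
  imports Defs
begin

text \<open>
Everything rests on linear functionals \<open>u\<close> that are integral on \<open>L\<close> and whose values on \<open>T\<close>
spread over less than 1; they are called narrow. As \<open>T\<close> represents the classes of \<open>M\<close> modulo
\<open>L\<close>, a narrow functional confines \<open>T\<close> to a strip in which it meets each class once.

From (i) to (ii): if \<open>S\<close> or \<open>T\<close> is centrally symmetric, the two sums agree up to a translation or
a point reflection, so both are asymmetric. Let \<open>u\<close> be the normal of an edge of \<open>conv S\<close>, scaled to
map \<open>L\<close> onto the integers. Convexity of \<open>S + T\<close> makes \<open>u\<close> narrow: the endpoints of the edge
together with two points of \<open>T\<close> that differ by at least 1 in direction \<open>u\<close> span a parallelogram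
whose chords parallel to the edge are so long that one of them contains a point of \<open>M\<close> outside
\<open>S + T\<close> (\<open>edge_normal_narrow\<close>). A polygon with only two directions of edges is a parallelogram,
hence there are three pairwise nonparallel narrow functionals. A pair that maps \<open>L\<close> onto a sublattice
of \<open>\<int>\<^sup>2\<close> of index at least 2 would make \<open>T\<close> symmetric (\<open>narrow_pair_reflection\<close>), so
each two of them are coordinates of \<open>L\<close>, and up to signs the three sum to 0.

If one of the three is integral on some element of \<open>M\<close> outside \<open>L\<close>, then \<open>T\<close> is a stack of
translates of a symmetric set and thus symmetric (\<open>coincidence_symmetric\<close>). Otherwise, multiplied by
\<open>N = |T|\<close> and shifted, each of them is a bijection from \<open>T\<close> onto \<open>{0..<N}\<close>. These three coordinates
have a constant sum, so adding a class of \<open>M\<close> modulo \<open>L\<close> whose residues \<open>a, b, c\<close> sum to \<open>N\<close> makes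
exactly one of them wrap around (\<open>exactly_one_wraps\<close>). The sequence of wraps for \<open>a = 1\<close> is a
balanced word in three letters, and these are so rare that, up to the order of the coordinates and up to
multiples, only \<open>(1, 1, -2)\<close> and, for \<open>N = 7\<close>, the word of Fraenkel with \<open>(1, 2, 4)\<close> remain. In the
second case \<open>T\<close> is a hexagon with its centre, which is symmetric; in the first case it is the trapezoid of
(b), and (a) gives the basis of \<open>L\<close> that is dual to two of the functionals.

From (ii) to (i): the suitably scaled normals of \<open>b1\<close>, \<open>b2\<close> and \<open>b2 - b1\<close> are narrow, and \<open>conv S\<close> is an
intersection of strips in these directions. The sum \<open>S + T\<close> consists of all points of \<open>M\<close> in the
correspondingly widened strips, because the values at points of \<open>L\<close> are integers
(\<open>sum_lattice_convex\<close>); the same holds for \<open>-T\<close>. Homometry is an exchange of the \<open>T\<close>-components in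
pairs of representations. Comparing the extreme values of the functionals on both sums excludes trivial
homometry: a translation conflicts with the shape of \<open>T\<close>, a reflection with the asymmetry of \<open>S\<close>.
\<close>

section \<open>Additive subgroups, reflections and extreme values\<close>

definition additive_subgroup :: "'a::ab_group_add set \<Rightarrow> bool" where
  "additive_subgroup G \<longleftrightarrow> 0 \<in> G \<and> (\<forall>x\<in>G. \<forall>y\<in>G. x - y \<in> G)"

lemma additive_subgroup_closed:
  assumes "additive_subgroup G"
  shows "0 \<in> G" "x \<in> G \<Longrightarrow> y \<in> G \<Longrightarrow> x - y \<in> G" "x \<in> G \<Longrightarrow> - x \<in> G"
    "x \<in> G \<Longrightarrow> y \<in> G \<Longrightarrow> x + y \<in> G"
proof -
  show zero: "0 \<in> G" and diff: "x \<in> G \<Longrightarrow> y \<in> G \<Longrightarrow> x - y \<in> G" for x y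
    using assms by (auto simp: additive_subgroup_def)
  show neg: "x \<in> G \<Longrightarrow> - x \<in> G" for x using diff[OF zero] by simp
  show "x \<in> G \<Longrightarrow> y \<in> G \<Longrightarrow> x + y \<in> G" using diff[of x "- y"] neg by simp
qed

lemma additive_subgroup_scale_int:
  fixes G :: "'a::real_vector set"
  assumes "additive_subgroup G" "x \<in> G" "r \<in> \<int>"
  shows "r *\<^sub>R x \<in> G"
proof -
  have nat: "real n *\<^sub>R x \<in> G" for n
    by (induction n) (use assms additive_subgroup_closed in \<open>auto simp: scaleR_add_left\<close>)
  obtain k where k: "r = of_int k" using assms(3) by (auto elim: Ints_cases)
  show ?thesis
  proof (cases "k \<ge> 0")
    case True
    then show ?thesis using nat[of "nat k"] k by simp
  next
    case False
    then have "r *\<^sub>R x = - (real (nat (- k)) *\<^sub>R x)" using k by simp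
    then show ?thesis using nat additive_subgroup_closed(3)[OF assms(1)] by simp
  qed
qed

lemma additive_subgroup_sum:
  assumes "additive_subgroup G" "\<And>i. i \<in> I \<Longrightarrow> f i \<in> G"
  shows "sum f I \<in> G"
  using assms(2) by (induction I rule: infinite_finite_induct)
    (use additive_subgroup_closed[OF assms(1)] in auto)

lemma Ints_eq_0_of_abs_less_1:
  fixes r :: real
  assumes "r \<in> \<int>" "r < 1" "- 1 < r"
  shows "r = 0"
  using assms by (auto elim!: Ints_cases)

lemma centrally_symmetricI:
  assumes "\<And>t. t \<in> K \<Longrightarrow> c - t \<in> K"
  shows "centrally_symmetric K"
proof -
  have "t \<in> (\<lambda>x. 2 *\<^sub>R ((1/2) *\<^sub>R c) - x) ` K" if "t \<in> K" for t
    using assms[OF that] by (intro image_eqI[of _ _ "c - t"]) auto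
  moreover have "(\<lambda>x. 2 *\<^sub>R ((1/2) *\<^sub>R c) - x) ` K \<subseteq> K" using assms by auto
  ultimately show ?thesis unfolding centrally_symmetric_def by blast
qed

lemma centrally_symmetricD:
  assumes "centrally_symmetric K"
  obtains c where "\<And>t. t \<in> K \<Longrightarrow> c - t \<in> K"
proof -
  obtain c where "K = (\<lambda>x. 2 *\<^sub>R c - x) ` K" using assms by (auto simp: centrally_symmetric_def)
  then show thesis by (intro that[of "2 *\<^sub>R c"]) blast
qed

lemma inner_extremes:
  fixes w :: "'a::real_inner"
  assumes "finite S" "S \<noteq> {}"
  shows "\<exists>p\<in>S. \<exists>q\<in>S. \<forall>s\<in>S. w \<bullet> p \<le> w \<bullet> s \<and> w \<bullet> s \<le> w \<bullet> q"
proof -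
  obtain p where "p \<in> S" "\<And>s. s \<in> S \<Longrightarrow> w \<bullet> p \<le> w \<bullet> s"
    using ex_is_arg_min_if_finite[OF assms, of "\<lambda>s. w \<bullet> s"] by (auto simp: is_arg_min_linorder)
  moreover obtain q where "q \<in> S" "\<And>s. s \<in> S \<Longrightarrow> w \<bullet> s \<le> w \<bullet> q"
    using ex_is_arg_min_if_finite[OF assms, of "\<lambda>s. - (w \<bullet> s)"] by (auto simp: is_arg_min_linorder)
  ultimately show ?thesis by blast
qed

section \<open>Coordinates on a cyclic quotient that wrap around in turn\<close>

text \<open>
The three coordinates stand for residues modulo \<open>N\<close>: a step \<open>(a, b, c)\<close> is admissible if adding it
to the residues of any point of \<open>T\<close> gives the residues of another point of \<open>T\<close>.
\<close>

definition residue_shift :: "int \<Rightarrow> 'a set \<Rightarrow> ('a \<Rightarrow> int) \<Rightarrow> ('a \<Rightarrow> int) \<Rightarrow> ('a \<Rightarrow> int) \<Rightarrow> int \<Rightarrow> int \<Rightarrow> int \<Rightarrow> bool"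
  where "residue_shift N T x y z a b c \<longleftrightarrow>
    (\<forall>t\<in>T. \<exists>t'\<in>T. N dvd x t' - x t - a \<and> N dvd y t' - y t - b \<and> N dvd z t' - z t - c)"

text \<open>
\<open>T\<close> is cut out of a group by three strips of \<open>N\<close> levels each, the constant sum making the picture
a hexagon; the last assumption says that \<open>T\<close> is closed under adding differences of its points modulo \<open>N\<close>.
\<close>

locale cyclic_hexagon =
  fixes N :: int and T :: "'a set" and x y z :: "'a \<Rightarrow> int" and \<sigma> :: int
  assumes N_ge: "N \<ge> 2"
    and bij_x: "bij_betw x T {0..<N}"
    and bij_y: "bij_betw y T {0..<N}"
    and bij_z: "bij_betw z T {0..<N}"
    and sum_xyz: "\<And>t. t \<in> T \<Longrightarrow> x t + y t + z t = \<sigma>"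
    and shift_diff: "\<And>s t. s \<in> T \<Longrightarrow> t \<in> T \<Longrightarrow>
      residue_shift N T x y z (x t - x s) (y t - y s) (z t - z s)"
begin

abbreviation shift :: "int \<Rightarrow> int \<Rightarrow> int \<Rightarrow> bool" where "shift \<equiv> residue_shift N T x y z"

lemma coords_range:
  assumes "t \<in> T"
  shows "0 \<le> x t" "x t < N" "0 \<le> y t" "y t < N" "0 \<le> z t" "z t < N"
  using bij_betwE[OF bij_x] bij_betwE[OF bij_y] bij_betwE[OF bij_z] assms by auto

lemma coord_x_obtain:
  assumes "0 \<le> i" "i < N" obtains t where "t \<in> T" "x t = i"
  using bij_x assms unfolding bij_betw_def by (metis atLeastLessThan_iff imageE)

lemma rotate: "cyclic_hexagon N T y z x \<sigma>"
proof
  show "residue_shift N T y z x (y t - y s) (z t - z s) (x t - x s)" if "s \<in> T" "t \<in> T" for s t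
    using shift_diff[OF that] unfolding residue_shift_def by blast
qed (use N_ge bij_x bij_y bij_z sum_xyz in \<open>auto simp: algebra_simps\<close>)

lemma swap: "cyclic_hexagon N T x z y \<sigma>"
proof
  show "residue_shift N T x z y (x t - x s) (z t - z s) (y t - y s)" if "s \<in> T" "t \<in> T" for s t
    using shift_diff[OF that] unfolding residue_shift_def by blast
qed (use N_ge bij_x bij_y bij_z sum_xyz in \<open>auto simp: algebra_simps\<close>)

lemma shift_rotate: "shift a b c \<Longrightarrow> residue_shift N T y z x b c a"
  unfolding residue_shift_def by blast

lemma shift_swap: "shift a b c \<Longrightarrow> residue_shift N T x z y a c b"
  unfolding residue_shift_def by blast

lemma shift_cong:
  assumes "shift a b c" "N dvd a - a'" "N dvd b - b'" "N dvd c - c'"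
  shows "shift a' b' c'"
  unfolding residue_shift_def
proof
  fix t assume "t \<in> T"
  then obtain t' where t': "t' \<in> T" "N dvd x t' - x t - a" "N dvd y t' - y t - b" "N dvd z t' - z t - c"
    using assms(1) unfolding residue_shift_def by blast
  have "N dvd x t' - x t - a'" "N dvd y t' - y t - b'" "N dvd z t' - z t - c'"
    using dvd_add[OF t'(2) assms(2)] dvd_add[OF t'(3) assms(3)] dvd_add[OF t'(4) assms(4)]
    by (simp_all add: algebra_simps)
  then show "\<exists>t'\<in>T. N dvd x t' - x t - a' \<and> N dvd y t' - y t - b' \<and> N dvd z t' - z t - c'"
    using t'(1) by blast
qed

lemma shift_add:
  assumes "shift a b c" "shift a' b' c'"
  shows "shift (a + a') (b + b') (c + c')"
  unfolding residue_shift_def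
proof
  fix t assume "t \<in> T"
  then obtain t1 where t1: "t1 \<in> T" "N dvd x t1 - x t - a" "N dvd y t1 - y t - b" "N dvd z t1 - z t - c"
    using assms(1) unfolding residue_shift_def by blast
  then obtain t2 where t2: "t2 \<in> T" "N dvd x t2 - x t1 - a'" "N dvd y t2 - y t1 - b'" "N dvd z t2 - z t1 - c'"
    using assms(2) unfolding residue_shift_def by blast
  have "N dvd x t2 - x t - (a + a')" "N dvd y t2 - y t - (b + b')" "N dvd z t2 - z t - (c + c')"
    using dvd_add[OF t1(2) t2(2)] dvd_add[OF t1(3) t2(3)] dvd_add[OF t1(4) t2(4)]
    by (simp_all add: algebra_simps)
  then show "\<exists>t'\<in>T. N dvd x t' - x t - (a + a') \<and> N dvd y t' - y t - (b + b') \<and> N dvd z t' - z t - (c + c')"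
    using t2(1) by blast
qed

lemma shift_mult:
  assumes "shift a b c"
  shows "shift (k * a) (k * b) (k * c)"
proof -
  have nat: "shift (int n * a) (int n * b) (int n * c)" for n
  proof (induction n)
    case 0
    show ?case unfolding residue_shift_def by (intro ballI bexI) auto
  next
    case (Suc n)
    show ?case using shift_add[OF assms Suc.IH] by (simp add: algebra_simps)
  qed
  have "N dvd (k mod N) * d - k * d" for d
    by (metis left_diff_distrib mod_eq_dvd_iff mod_mod_trivial dvd_mult2)
  moreover have "k mod N = int (nat (k mod N))"
    using N_ge by simp
  ultimately show ?thesis
    using shift_cong[OF nat[of "nat (k mod N)"]] by metis
qed

lemma residue_eq:
  assumes "0 \<le> p" "p < N" "0 \<le> q" "q < N" "N dvd p - q"
  shows "p = q"
  using assms by (metis mod_eq_dvd_iff mod_pos_pos_trivial)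

lemma shift_fixing_z:
  assumes "shift a b c" "N dvd c"
  shows "N dvd a"
proof -
  obtain t where t: "t \<in> T" using coord_x_obtain[of 0] N_ge by auto
  then obtain t' where t': "t' \<in> T" "N dvd x t' - x t - a" "N dvd z t' - z t - c"
    using assms(1) unfolding residue_shift_def by blast
  have "N dvd z t' - z t" using dvd_add[OF t'(3) assms(2)] by simp
  then have "z t' = z t"
    by (rule residue_eq[OF coords_range(5,6)[OF t'(1)] coords_range(5,6)[OF t]])
  then have "t' = t" using bij_z t t' unfolding bij_betw_def inj_on_def by blast
  then show ?thesis using t'(2) by simp
qed

lemma wrap_cases:
  assumes "0 \<le> p" "p < N" "0 \<le> q" "q < N" "0 \<le> a" "a \<le> N" "N dvd q - p - a"
  shows "q = p + a \<or> q = p + a - N"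
proof -
  obtain k where k: "q - p - a = N * k" using assms(7) by blast
  have "N * k < N * 1" "N * (-2) < N * k" using k assms by linarith+
  then have "k < 1" "-2 < k" using N_ge by (simp_all only: mult_less_cancel_left_pos)
  then have "k = 0 \<or> k = -1" by linarith
  then show ?thesis using k by auto
qed

text \<open>
Each coordinate grows by its increment or by its increment minus \<open>N\<close>. The sum of the coordinates is
constant while the increments sum to \<open>N\<close>, so \<open>N\<close> is subtracted once.
\<close>

lemma exactly_one_wraps:
  assumes "shift a b c" "0 \<le> a" "0 \<le> b" "0 \<le> c" "a + b + c = N" "t \<in> T"
  obtains t' where "t' \<in> T"
    "x t' = x t + a - N \<and> y t' = y t + b \<and> z t' = z t + c \<or>
     x t' = x t + a \<and> y t' = y t + b - N \<and> z t' = z t + c \<or>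
     x t' = x t + a \<and> y t' = y t + b \<and> z t' = z t + c - N"
proof -
  obtain t' where t': "t' \<in> T" "N dvd x t' - x t - a" "N dvd y t' - y t - b" "N dvd z t' - z t - c"
    using assms unfolding residue_shift_def by blast
  have "x t' = x t + a \<or> x t' = x t + a - N" "y t' = y t + b \<or> y t' = y t + b - N"
    "z t' = z t + c \<or> z t' = z t + c - N"
    by (rule wrap_cases; use coords_range[OF t'(1)] coords_range[OF assms(6)] assms t' in linarith)+
  then show thesis using that[OF t'(1)] sum_xyz[OF t'(1)] sum_xyz[OF assms(6)] assms(5) N_ge
    by (smt (verit))
qed

text \<open>
The last \<open>j\<close> levels of the first coordinate are those where the step \<open>(j, j B, N - j - j B)\<close>
wraps in the first coordinate, so the second does not wrap there. Walking through these levels by unit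
steps, the second coordinate therefore grows steadily, and even one further step of \<open>j B\<close> stays below \<open>N\<close>.
\<close>

lemma late_point_bound:
  assumes s: "shift 1 B C" and pos: "0 < B" "0 < C" "1 + B + C = N" and j: "1 \<le> j" "j * (B + 1) < N"
  obtains t where "t \<in> T" "x t = N - j" "y t + (2 * j - 1) * B < N"
proof -
  have multiple: "shift i (i * B) (N - i - i * B)" for i
  proof (rule shift_cong[OF shift_mult[OF s, of i]])
    have "i * C - (N - i - i * B) = N * (i - 1)"
      using pos(3) by (simp add: algebra_simps flip: pos(3))
    then show "N dvd i * C - (N - i - i * B)" by simp
  qed auto
  have nonneg: "0 \<le> N - i - i * B" "0 \<le> i * B" if "0 \<le> i" "i \<le> j" for i
  proof -
    have "i * (B + 1) \<le> j * (B + 1)" using that pos by (intro mult_right_mono) auto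
    then show "0 \<le> N - i - i * B" using j by (simp add: algebra_simps)
    show "0 \<le> i * B" using that pos by simp
  qed
  have "j < N" using j pos by (smt (verit) mult_le_cancel_left1)
  then obtain t where t: "t \<in> T" "x t = N - j" using coord_x_obtain[of "N - j"] j by auto
  \<comment> \<open>This is applied at both ends of the walk, the levels \<open>N - j\<close> and \<open>N - 1\<close>.\<close>
  have late: "y t' + j * B < N" if "t' \<in> T" "N - j \<le> x t'" for t'
  proof (rule exactly_one_wraps[OF multiple[of j] _ _ _ _ that(1)])
    fix t'' assume "t'' \<in> T" and *: "x t'' = x t' + j - N \<and> y t'' = y t' + j * B \<and> z t'' = z t' + (N - j - j * B) \<or>
     x t'' = x t' + j \<and> y t'' = y t' + j * B - N \<and> z t'' = z t' + (N - j - j * B) \<or>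
     x t'' = x t' + j \<and> y t'' = y t' + j * B \<and> z t'' = z t' + (N - j - j * B) - N"
    then show "y t' + j * B < N" using coords_range[OF \<open>t'' \<in> T\<close>] that by linarith
  qed (use j nonneg[of j] in auto)
  obtain t' where t': "t' \<in> T" "x t' = x t + (j - 1)" "y t' = y t + (j - 1) * B"
  proof (rule exactly_one_wraps[OF multiple[of "j - 1"] _ _ _ _ t(1)])
    fix t' assume "t' \<in> T" and *: "x t' = x t + (j - 1) - N \<and> y t' = y t + (j - 1) * B \<and> z t' = z t + (N - (j - 1) - (j - 1) * B) \<or>
     x t' = x t + (j - 1) \<and> y t' = y t + (j - 1) * B - N \<and> z t' = z t + (N - (j - 1) - (j - 1) * B) \<or>
     x t' = x t + (j - 1) \<and> y t' = y t + (j - 1) * B \<and> z t' = z t + (N - (j - 1) - (j - 1) * B) - N"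
    have "y t + (j - 1) * B < N" using late[OF t(1)] t(2) pos by (simp add: algebra_simps)
    then have "x t' = x t + (j - 1)" "y t' = y t + (j - 1) * B"
      using * coords_range[OF \<open>t' \<in> T\<close>] t(2) by linarith+
    then show thesis using that \<open>t' \<in> T\<close> by blast
  qed (use j nonneg[of "j - 1"] in auto)
  have "y t' + j * B < N" using late[OF t'(1)] t'(2) t(2) j by linarith
  then have "y t + (2 * j - 1) * B < N" using t'(3) by (simp add: algebra_simps)
  then show thesis using that t by blast
qed

lemma step_bound:
  assumes "shift 1 B C" "0 < B" "0 < C" "1 + B + C = N" "1 \<le> j" "j * (B + 1) < N"
  shows "(2 * j - 1) * B < N"
proof -
  obtain t where "t \<in> T" "y t + (2 * j - 1) * B < N" using late_point_bound[OF assms] by blast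
  then show ?thesis using coords_range(3)[of t] by linarith
qed

text \<open>
The step leads from level 0 to level 1; the residues \<open>1, B, C\<close> have a sum that is divisible by \<open>N\<close>
and lies strictly between 0 and \<open>2 N\<close>.
\<close>

lemma unit_step_exists:
  obtains B C where "0 < B" "0 < C" "1 + B + C = N" "shift 1 B C"
proof -
  obtain s where s: "s \<in> T" "x s = 0" using coord_x_obtain[of 0] N_ge by auto
  obtain t where t: "t \<in> T" "x t = 1" using coord_x_obtain[of 1] N_ge by auto
  have diff: "shift 1 (y t - y s) (z t - z s)" using shift_diff[OF s(1) t(1)] s t by simp
  define B where "B = (y t - y s) mod N"
  define C where "C = (z t - z s) mod N"
  have shift: "shift 1 B C"
    by (rule shift_cong[OF diff]) (simp_all add: B_def C_def dvd_minus_mod)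
  have "\<not> N dvd 1" using N_ge by (auto dest!: zdvd_imp_le)
  then have "\<not> N dvd C" using shift_fixing_z[OF shift] by (rule contrapos_nn)
  have "\<not> N dvd B" using cyclic_hexagon.shift_fixing_z[OF swap shift_swap[OF shift]] \<open>\<not> N dvd 1\<close>
    by (rule contrapos_nn[rotated])
  then have "B \<noteq> 0" by auto
  moreover have "C \<noteq> 0" using \<open>\<not> N dvd C\<close> by auto
  moreover have "0 \<le> B" "0 \<le> C" "B < N" "C < N" using N_ge by (simp_all add: B_def C_def)
  ultimately have pos: "0 < B" "0 < C" "B < N" "C < N" by linarith+
  have "1 + (y t - y s) + (z t - z s) = 0"
    using sum_xyz[OF s(1)] sum_xyz[OF t(1)] s t by simp
  have "N dvd 0 - ((y t - y s) - B + ((z t - z s) - C))"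
    unfolding B_def C_def by (rule dvd_diff[OF dvd_0_right dvd_add[OF dvd_minus_mod dvd_minus_mod]])
  also have "0 - ((y t - y s) - B + ((z t - z s) - C)) = 1 + B + C"
    using \<open>1 + (y t - y s) + (z t - z s) = 0\<close> by linarith
  finally have "N dvd 1 + B + C" .
  then obtain k where k: "1 + B + C = N * k" by blast
  have "N * 0 < N * k" "N * k < N * 2" using k pos by linarith+
  then have "0 < k" "k < 2" using N_ge by (simp_all only: mult_less_cancel_left_pos)
  then have "k = 1" by linarith
  then have "1 + B + C = N" using k by simp
  then show thesis using that[OF pos(1,2) _ shift] by blast
qed

text \<open>
Each coordinate takes every value in \<open>{0..<N}\<close> once, so its average is \<open>(N - 1) / 2\<close>; the constant
sum is three times that, and it is an integer.
\<close>

lemma odd_order: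
  obtains m where "N = 2 * m + 1" "\<sigma> = 3 * m"
proof -
  have gauss: "2 * (\<Sum>i\<in>{0..<N}. i) = N * (N - 1)"
  proof -
    have "2 * (\<Sum>i\<in>{0..<int n}. i) = int n * (int n - 1)" for n
    proof (induction n)
      case (Suc n)
      have "{0..<int (Suc n)} = insert (int n) {0..<int n}" by auto
      then show ?case using Suc.IH by (simp add: algebra_simps)
    qed simp
    from this[of "nat N"] show ?thesis using N_ge by simp
  qed
  have sums: "2 * (\<Sum>t\<in>T. f t) = N * (N - 1)" if "bij_betw f T {0..<N}" for f
    using sum.reindex_bij_betw[OF that, of "\<lambda>i. i"] gauss by simp
  have "int (card T) = N" using bij_betw_same_card[OF bij_x] N_ge by simp
  then have "2 * (N * \<sigma>) = 2 * (\<Sum>t\<in>T. x t + y t + z t)" using sum_xyz by simp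
  also have "\<dots> = 3 * (N * (N - 1))"
    using sums[OF bij_x] sums[OF bij_y] sums[OF bij_z] by (simp add: sum.distrib)
  finally have "N * (2 * \<sigma>) = N * (3 * (N - 1))" by algebra
  then have "2 * \<sigma> = 3 * (N - 1)" using N_ge by simp
  then have "N = 2 * (\<sigma> - (N - 1)) + 1 \<and> \<sigma> = 3 * (\<sigma> - (N - 1))" by algebra
  then show thesis using that[of "\<sigma> - (N - 1)"] by (elim conjE)
qed

text \<open>
For \<open>J\<close> maximal with \<open>J (B + 1) < N\<close> the bound \<open>(2 J - 1) B < N\<close> is almost violated: it leaves
\<open>(J - 2) (B - 1) \<le> 1\<close>. The few remaining cases die by applying the same bound to a multiple of
the step in which another coordinate increases by 1.
\<close>

lemma few_unit_steps:
  assumes s: "shift 1 B C" and pos: "0 < B" "B < C" and N: "1 + B + C = N"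
  shows "B = 1 \<or> B = 2 \<and> N = 7"
proof (rule ccontr)
  assume contra: "\<not> (B = 1 \<or> B = 2 \<and> N = 7)"
  then have B2: "2 \<le> B" using pos by linarith
  obtain m where m: "N = 2 * m + 1" using odd_order by blast
  have bound: "(2 * j - 1) * B < N" if "1 \<le> j" "j * (B + 1) < N" for j
    using step_bound[OF s pos(1) _ N that] pos by linarith
  \<comment> \<open>The largest multiple of the step for which the third residue \<open>N - J - J B\<close> is positive.\<close>
  define J where "J = (N - 1) div (B + 1)"
  have J_lower: "J * (B + 1) < N"
    using div_mult_mod_eq[of "N - 1" "B + 1"] pos_mod_sign[of "B + 1" "N - 1"] pos
    unfolding J_def by linarith
  have J_upper: "N < (J + 1) * (B + 1) + 1"
    using div_mult_mod_eq[of "N - 1" "B + 1"] pos_mod_bound[of "B + 1" "N - 1"] pos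
    unfolding J_def by (simp add: algebra_simps)
  have "2 * (B + 1) < N" using pos N m by presburger
  then have J2: "2 \<le> J"
    using J_upper pos mult_right_mono[of "J + 1" 2 "B + 1"] by linarith
  \<comment> \<open>Equality would make the third residue of a multiple vanish but not the first one.\<close>
  have "N \<noteq> (J + 1) * (B + 1)"
  proof
    assume eq: "N = (J + 1) * (B + 1)"
    have "(J + 1) * C = N * J" using eq N by algebra
    then have "N dvd (J + 1) * 1"
      using shift_fixing_z[OF shift_mult[OF s, of "J + 1"]] by simp
    then have "N \<le> J + 1" using J2 by (simp add: zdvd_imp_le)
    moreover have "(J + 1) * 2 < N" unfolding eq using B2 J2 by (intro mult_strict_left_mono) auto
    ultimately show False using J2 by simp
  qed
  then have N_upper: "N \<le> (J + 1) * (B + 1) - 1" using J_upper by simp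
  have "(2 * J - 1) * B < N" using bound[OF _ J_lower] J2 by simp
  then have "(2 * J - 1) * B < (J + 1) * (B + 1) - 1" using N_upper by (rule less_le_trans)
  then have "(J - 2) * (B - 1) \<le> 1" by (simp add: algebra_simps)
  moreover have "2 \<le> (J - 2) * (B - 1)" if "4 \<le> J"
    using mult_mono[of 2 "J - 2" 1 "B - 1"] that B2 by simp
  moreover have "2 \<le> (J - 2) * (B - 1)" if "3 \<le> J" "3 \<le> B"
    using mult_mono[of 1 "J - 2" 2 "B - 1"] that by simp
  ultimately have "J = 2 \<or> J = 3 \<and> B = 2" using J2 B2 by linarith
  moreover have "3 * B < N" using bound[of 2] \<open>2 * (B + 1) < N\<close> by simp
  moreover have "5 * B < N" if "J = 3" using bound[of 3] J_lower that by simp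
  ultimately consider "N = 3 * B + 1" | "N = 3 * B + 2" | "N = 11" "B = 2"
    using N_upper by fastforce
  then show False
  proof cases
    case 1
    \<comment> \<open>Minus three times the step is again a step of the same kind, led by the second coordinate.\<close>
    have "shift (N - 3) 1 2"
    proof (rule shift_cong[OF shift_mult[OF s, of "-3"]])
      show "N dvd - 3 * 1 - (N - 3)" by (rule dvdI[of _ _ "-1"]) simp
      show "N dvd - 3 * B - 1" by (rule dvdI[of _ _ "-1"]) (use 1 in simp)
      show "N dvd - 3 * C - 2" by (rule dvdI[of _ _ "-2"]) (use 1 N in simp)
    qed
    from cyclic_hexagon.step_bound[OF rotate shift_rotate[OF this], of B]
    have "(2 * B - 1) * 2 < N" using 1 B2 by simp
    then show False using 1 contra B2 by simp
  next
    case 2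
    have "shift (N - 3) 2 1"
    proof (rule shift_cong[OF shift_mult[OF s, of "-3"]])
      show "N dvd - 3 * 1 - (N - 3)" by (rule dvdI[of _ _ "-1"]) simp
      show "N dvd - 3 * B - 2" by (rule dvdI[of _ _ "-1"]) (use 2 in simp)
      show "N dvd - 3 * C - 1" by (rule dvdI[of _ _ "-2"]) (use 2 N in simp)
    qed
    then have zyx: "residue_shift N T z y x 1 2 (N - 3)" unfolding residue_shift_def by blast
    have "cyclic_hexagon N T z y x \<sigma>"
      by (rule cyclic_hexagon.swap[OF cyclic_hexagon.rotate[OF rotate]])
    from cyclic_hexagon.step_bound[OF this zyx, of B] have "(2 * B - 1) * 2 < N" using 2 B2 by simp
    then have "B = 2 \<or> B = 3" using 2 B2 by presburger
    moreover have "B \<noteq> 2" using 2 m by presburger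
    ultimately have 3: "B = 3" "N = 11" using 2 by simp_all
    \<comment> \<open>Steps with \<open>B = 4\<close> and \<open>N = 11\<close> violate the bound for \<open>j = 2\<close>.\<close>
    have "shift 4 1 6"
    proof (rule shift_cong[OF shift_mult[OF s, of 4]])
      show "N dvd 4 * B - 1" by (rule dvdI[of _ _ 1]) (use 3 in simp)
      show "N dvd 4 * C - 6" by (rule dvdI[of _ _ 2]) (use 3 N in simp)
    qed simp
    then have yxz: "residue_shift N T y x z 1 4 6" unfolding residue_shift_def by blast
    have "cyclic_hexagon N T y x z \<sigma>" by (rule cyclic_hexagon.swap[OF rotate])
    from cyclic_hexagon.step_bound[OF this yxz, of 2] show False using 3 by simp
  next
    case 3
    have "shift 6 1 4"
    proof (rule shift_cong[OF shift_mult[OF s, of 6]])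
      show "N dvd 6 * B - 1" by (rule dvdI[of _ _ 1]) (use 3 in simp)
      show "N dvd 6 * C - 4" by (rule dvdI[of _ _ 4]) (use 3 N in simp)
    qed simp
    from cyclic_hexagon.step_bound[OF rotate shift_rotate[OF this], of 2] show False using 3 by simp
  qed
qed

text \<open>
A point at the middle level of all three strips is the centre of a point reflection of \<open>T\<close>.
\<close>

definition central_point :: "'a \<Rightarrow> bool" where
  "central_point c \<longleftrightarrow> c \<in> T \<and> 2 * x c = N - 1 \<and> 2 * y c = N - 1 \<and> 2 * z c = N - 1"

text \<open>
The bound on late points is sharp here and determines a point of \<open>T\<close>; five steps from it lies the centre.
\<close>

lemma central_point_order_7:
  assumes s: "shift 1 2 4" and N: "N = 7"
  shows "\<exists>c. central_point c"
proof -
  obtain m where "N = 2 * m + 1" "\<sigma> = 3 * m" using odd_order by blast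
  then have \<sigma>: "\<sigma> = 9" using N by simp
  obtain t where t: "t \<in> T" "x t = 5" "y t = 0"
  proof (rule late_point_bound[OF s, of 2])
    fix t assume "t \<in> T" "x t = N - 2" "y t + (2 * 2 - 1) * 2 < N"
    then show thesis using that[of t] coords_range[of t] N by simp
  qed (use N in auto)
  have "z t = 4" using sum_xyz t \<sigma> by fastforce
  have "shift 5 3 6"
  proof (rule shift_cong[OF shift_mult[OF s, of 5]])
    show "N dvd 5 * 2 - 3" by (rule dvdI[of _ _ 1]) (use N in simp)
    show "N dvd 5 * 4 - 6" by (rule dvdI[of _ _ 2]) (use N in simp)
  qed simp
  then obtain c where c: "c \<in> T" "N dvd x c - x t - 5" "N dvd y c - y t - 3" "N dvd z c - z t - 6"
    using t(1) unfolding residue_shift_def by blast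
  have "x c = x t + 5 \<or> x c = x t + 5 - N" "y c = y t + 3 \<or> y c = y t + 3 - N"
    by (rule wrap_cases; use coords_range[OF c(1)] coords_range[OF t(1)] c N in linarith)+
  then have "x c = 3" "y c = 3" using t coords_range[OF c(1)] N by auto
  moreover have "z c = 3" using sum_xyz[OF c(1)] \<sigma> calculation by simp
  ultimately show ?thesis using c(1) N unfolding central_point_def by auto
qed

lemma step_classification_ordered:
  assumes s: "shift 1 B C" and pos: "0 < B" "B < C" and N: "1 + B + C = N"
  shows "(\<exists>c. central_point c) \<or> shift 1 1 (-2)"
proof -
  consider "B = 1" | "B = 2" "N = 7" using few_unit_steps[OF assms] by blast
  then show ?thesis
  proof cases
    case 1
    have "shift 1 1 (-2)"
    proof (rule shift_cong[OF s])
      show "N dvd C - (-2)" by (rule dvdI[of _ _ 1]) (use 1 N in simp)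
    qed (use 1 in simp_all)
    then show ?thesis by blast
  next
    case 2
    then have "C = 4" using N by simp
    then show ?thesis using central_point_order_7 s 2 by simp
  qed
qed

text \<open>
Exchanging the last two coordinates reduces the case \<open>C < B\<close> to \<open>B < C\<close>. If \<open>B = C\<close> then
\<open>N = 2 B + 1\<close>, and minus twice the step is \<open>(-2, 1, 1)\<close>.
\<close>

lemma step_classification:
  "(\<exists>c. central_point c) \<or> shift 1 1 (-2) \<or> shift 1 (-2) 1 \<or> shift (-2) 1 1"
proof -
  obtain B C where BC: "0 < B" "0 < C" "1 + B + C = N" "shift 1 B C"
    by (rule unit_step_exists)
  consider "B < C" | "B = C" | "C < B" by linarith
  then show ?thesis
  proof cases
    case 1
    then show ?thesis using step_classification_ordered BC by blast
  next
    case 2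
    have "shift (-2) 1 1"
    proof (rule shift_cong[OF shift_mult[OF BC(4), of "-2"]])
      show "N dvd - 2 * B - 1" by (rule dvdI[of _ _ "-1"]) (use 2 BC in simp)
      show "N dvd - 2 * C - 1" by (rule dvdI[of _ _ "-1"]) (use 2 BC in simp)
    qed simp
    then show ?thesis by blast
  next
    case 3
    have "(\<exists>c. cyclic_hexagon.central_point N T x z y c) \<or> residue_shift N T x z y 1 1 (-2)"
      by (rule cyclic_hexagon.step_classification_ordered[OF swap shift_swap[OF BC(4)]])
        (use 3 BC in auto)
    then show ?thesis
      using cyclic_hexagon.shift_swap[OF swap]
      unfolding central_point_def cyclic_hexagon.central_point_def[OF swap] by blast
  qed
qed

lemma central_point_reflection:
  assumes "central_point c" "t \<in> T"
  obtains t' where "t' \<in> T" "x t' = N - 1 - x t" "y t' = N - 1 - y t"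
proof -
  have c: "c \<in> T" "2 * x c = N - 1" "2 * y c = N - 1"
    using assms unfolding central_point_def by auto
  obtain t' where t': "t' \<in> T" "N dvd x t' - x c - (x c - x t)" "N dvd y t' - y c - (y c - y t)"
    using shift_diff[OF assms(2) c(1)] c(1) unfolding residue_shift_def by blast
  have "x t' - (N - 1 - x t) = x t' - x c - (x c - x t)" "y t' - (N - 1 - y t) = y t' - y c - (y c - y t)"
    using c by linarith+
  then have "N dvd x t' - (N - 1 - x t)" "N dvd y t' - (N - 1 - y t)" using t' by (simp_all only:)
  then have "x t' = N - 1 - x t" "y t' = N - 1 - y t"
    using coords_range[OF t'(1)] coords_range[OF assms(2)] by (auto intro!: residue_eq)
  then show thesis using that t'(1) by blast
qed

text \<open>
Along the step \<open>(1, 1, -2)\<close> the third coordinate drops by 2 until the second one wraps, so both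
runs between wraps have at most \<open>k + 1\<close> points; there are \<open>2 k + 1\<close> points in total.
\<close>

lemma trapezoid_offset:
  assumes s: "shift 1 1 (-2)" and t: "t \<in> T" "x t = 0" and k: "N = 2 * k + 1"
  shows "y t = k \<or> y t = k + 1"
proof -
  have \<sigma>: "\<sigma> = 3 * k" using odd_order k by (metis add_right_cancel mult_cancel_left zero_neq_numeral)
  have k1: "k \<ge> 1" using k N_ge by linarith
  have lower: "k \<le> y t" using sum_xyz[OF t(1)] coords_range[OF t(1)] t k \<sigma> by linarith
  define j where "j = N - y t"
  have "shift j j (- 2 * j)" using shift_mult[OF s, of j] by (simp add: algebra_simps)
  then obtain t' where t': "t' \<in> T" "N dvd x t' - x t - j" "N dvd y t' - y t - j"
    using t(1) unfolding residue_shift_def by blast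
  have j: "0 < j" "j < N" using coords_range[OF t(1)] lower k1 by (auto simp: j_def)
  have "x t' = j"
    by (rule residue_eq) (use coords_range[OF t'(1)] j t' t in auto)
  moreover have "y t' = y t + j \<or> y t' = y t + j - N"
    by (rule wrap_cases; use coords_range[OF t'(1)] coords_range[OF t(1)] t' j in linarith)
  then have "y t' = 0" using coords_range[OF t'(1)] by (auto simp: j_def)
  ultimately have "y t \<le> k + 1"
    using sum_xyz[OF t'(1)] coords_range[OF t'(1)] k \<sigma> by (simp add: j_def)
  then show ?thesis using lower by linarith
qed

lemma trapezoid_rows:
  assumes s: "shift 1 1 (-2)" and k: "N = 2 * k + 1" and t0: "t0 \<in> T" "x t0 = 0" "y t0 = k"
    and t: "t \<in> T"
  shows "y t = (if x t \<le> k then x t + k else x t + k - N)"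
proof -
  have "shift (x t) (x t) (- 2 * x t)" using shift_mult[OF s, of "x t"] by (simp add: algebra_simps)
  then obtain t' where t': "t' \<in> T" "N dvd x t' - x t0 - x t" "N dvd y t' - y t0 - x t"
    using t0(1) unfolding residue_shift_def by blast
  have "x t' = x t"
    by (rule residue_eq) (use coords_range[OF t'(1)] coords_range[OF t] t' t0 in auto)
  then have "t' = t" using bij_x t t' unfolding bij_betw_def inj_on_def by blast
  then have "y t = y t0 + x t \<or> y t = y t0 + x t - N"
    using wrap_cases[of "y t0" "y t" "x t"] coords_range[OF t0(1)] coords_range[OF t] t' by simp
  then show ?thesis using coords_range[OF t] t0 k by auto
qed

text \<open>
In the case of offset \<open>k + 1\<close> the point at which the second coordinate vanishes is at level \<open>k\<close> of
the first, so that exchanging these two coordinates leads to offset \<open>k\<close>.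
\<close>

lemma trapezoid_normalised:
  assumes s: "shift 1 1 (-2)" and k: "N = 2 * k + 1"
  obtains t0 where "t0 \<in> T" "x t0 = 0 \<and> y t0 = k \<or> y t0 = 0 \<and> x t0 = k"
proof -
  obtain t where t: "t \<in> T" "x t = 0" using coord_x_obtain[of 0] N_ge by auto
  consider "y t = k" | "y t = k + 1" using trapezoid_offset[OF s t k] by blast
  then show thesis
  proof cases
    case 2
    have "shift k k (- 2 * k)" using shift_mult[OF s, of k] by (simp add: algebra_simps)
    then obtain t' where t': "t' \<in> T" "N dvd x t' - x t - k" "N dvd y t' - y t - k"
      using t(1) unfolding residue_shift_def by blast
    have "x t' = k"
      by (rule residue_eq) (use coords_range[OF t'(1)] t' t k N_ge in auto)
    moreover have "y t' = y t + k \<or> y t' = y t + k - N"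
      by (rule wrap_cases; use coords_range[OF t'(1)] coords_range[OF t(1)] t' k N_ge in linarith)
    then have "y t' = 0" using coords_range[OF t'(1)] 2 k by auto
    ultimately show thesis using that t'(1) by blast
  qed (use t that in blast)
qed

end

section \<open>Tiles of small width\<close>

text \<open>
Let \<open>a\<close> and \<open>b\<close> be points of \<open>T\<close> with least and greatest value of \<open>u\<close>. For \<open>t \<in> T\<close> the point
\<open>a + b - t\<close> stays in the strip of \<open>u\<close>, so the element of \<open>L\<close> separating it from its
representative in \<open>T\<close> lies in the kernel of \<open>u\<close>. Its value of \<open>v\<close> is a sum of two differences
of absolute value less than 1, and the kernel has no nonzero element with so small a value. Hence \<open>a + b - t \<in> T\<close>.
\<close>

lemma narrow_pair_reflection:
  fixes T L :: "'a::real_inner set"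
  assumes "finite T" "T \<noteq> {}"
    and u: "\<And>s t. s \<in> T \<Longrightarrow> t \<in> T \<Longrightarrow> u \<bullet> s - u \<bullet> t < 1"
    and v: "\<And>s t. s \<in> T \<Longrightarrow> t \<in> T \<Longrightarrow> v \<bullet> s - v \<bullet> t < 1"
    and rep: "\<And>r s t. r \<in> T \<Longrightarrow> s \<in> T \<Longrightarrow> t \<in> T \<Longrightarrow> \<exists>l\<in>L. \<exists>t'\<in>T. r + s - t = l + t'"
    and int: "\<And>l. l \<in> L \<Longrightarrow> u \<bullet> l \<in> \<int>"
    and sep: "\<And>l. l \<in> L \<Longrightarrow> u \<bullet> l = 0 \<Longrightarrow> \<bar>v \<bullet> l\<bar> < 2 \<Longrightarrow> l = 0"
  shows "\<exists>c. \<forall>t\<in>T. c - t \<in> T"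
proof -
  obtain a b where a: "a \<in> T" "\<And>t. t \<in> T \<Longrightarrow> u \<bullet> a \<le> u \<bullet> t"
    and b: "b \<in> T" "\<And>t. t \<in> T \<Longrightarrow> u \<bullet> t \<le> u \<bullet> b"
    using inner_extremes[OF assms(1,2), of u] by blast
  have "a + b - t \<in> T" if t: "t \<in> T" for t
  proof -
    obtain l t' where l: "l \<in> L" and t': "t' \<in> T" and eq: "a + b - t = l + t'"
      using rep[OF a(1) b(1) t] by blast
    then have l_eq: "l = a + b - t - t'" by (simp add: algebra_simps)
    have "u \<bullet> l = u \<bullet> a + u \<bullet> b - u \<bullet> t - u \<bullet> t'" "v \<bullet> l = v \<bullet> a + v \<bullet> b - v \<bullet> t - v \<bullet> t'"
      unfolding l_eq by (simp_all add: inner_diff_right inner_add_right)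
    then have "u \<bullet> l < 1" "- 1 < u \<bullet> l" "\<bar>v \<bullet> l\<bar> < 2"
      using a(2)[OF t] b(2)[OF t] u[OF b(1) t'] u[OF t' a(1)]
        v[OF a(1) t] v[OF b(1) t'] v[OF t a(1)] v[OF t' b(1)] by linarith+
    then have "l = 0" using sep[OF l] Ints_eq_0_of_abs_less_1 int[OF l] by blast
    then show ?thesis using eq t' by simp
  qed
  then show ?thesis by blast
qed

text \<open>
For subgroups, the direct decomposition \<open>M = L + T\<close> says that \<open>T\<close> is a system of representatives of
the classes of \<open>M\<close> modulo \<open>L\<close>, and this is the form in which it is used.
\<close>

locale lattice_tile =
  fixes M L T :: "'a::euclidean_space set"
  assumes subgroup_M: "additive_subgroup M" and subgroup_L: "additive_subgroup L"
    and L_subset: "L \<subseteq> M" and T_subset: "T \<subseteq> M"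
    and finite_T: "finite T" and T_nonempty: "T \<noteq> {}"
    and tile: "m \<in> M \<Longrightarrow> \<exists>l\<in>L. \<exists>t\<in>T. m = l + t"
    and tile_unique: "s \<in> T \<Longrightarrow> t \<in> T \<Longrightarrow> s - t \<in> L \<Longrightarrow> s = t"
begin

lemmas M_closed = additive_subgroup_closed[OF subgroup_M]
lemmas L_closed = additive_subgroup_closed[OF subgroup_L]

definition narrow :: "'a \<Rightarrow> bool" where
  "narrow u \<longleftrightarrow> (\<forall>l\<in>L. u \<bullet> l \<in> \<int>) \<and> (\<forall>s\<in>T. \<forall>t\<in>T. u \<bullet> s - u \<bullet> t < 1)"

lemma narrowD:
  assumes "narrow u"
  shows "l \<in> L \<Longrightarrow> u \<bullet> l \<in> \<int>" "s \<in> T \<Longrightarrow> t \<in> T \<Longrightarrow> u \<bullet> s - u \<bullet> t < 1"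
  using assms by (auto simp: narrow_def)

lemma narrow_uminus: "narrow u \<Longrightarrow> narrow (- u)"
  unfolding narrow_def by (auto simp: inner_minus_left)

text \<open>
The functionals \<open>u, v\<close> are the coordinates with respect to a basis \<open>e, f\<close> of the space that lies in \<open>L\<close>.
For functionals that are integral on \<open>L\<close> this makes \<open>e, f\<close> a basis of \<open>L\<close>.
\<close>

definition dual_basis :: "'a \<Rightarrow> 'a \<Rightarrow> 'a \<Rightarrow> 'a \<Rightarrow> bool" where
  "dual_basis u v e f \<longleftrightarrow> e \<in> L \<and> f \<in> L \<and> u \<bullet> e = 1 \<and> u \<bullet> f = 0 \<and> v \<bullet> e = 0 \<and> v \<bullet> f = 1 \<and>
     (\<forall>x. x = (u \<bullet> x) *\<^sub>R e + (v \<bullet> x) *\<^sub>R f)"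

lemma dual_basis_eqI:
  assumes "dual_basis u v e f" "u \<bullet> x = u \<bullet> y" "v \<bullet> x = v \<bullet> y"
  shows "x = y"
  using assms unfolding dual_basis_def by metis

lemma dual_basis_in_L:
  assumes "dual_basis u v e f" "u \<bullet> x \<in> \<int>" "v \<bullet> x \<in> \<int>"
  shows "x \<in> L"
proof -
  have "x = (u \<bullet> x) *\<^sub>R e + (v \<bullet> x) *\<^sub>R f" "e \<in> L" "f \<in> L"
    using assms(1) unfolding dual_basis_def by auto
  then show ?thesis
    using additive_subgroup_scale_int[OF subgroup_L] assms(2,3) L_closed(4) by metis
qed

text \<open>
Since \<open>w = - u - v\<close>, any two of the three functionals are coordinates of \<open>L\<close>, which is why the
notion is invariant under permutations.
\<close>

definition narrow_triple :: "'a \<Rightarrow> 'a \<Rightarrow> 'a \<Rightarrow> bool" where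
  "narrow_triple u v w \<longleftrightarrow> narrow u \<and> narrow v \<and> narrow w \<and> u + v + w = 0 \<and> (\<exists>e f. dual_basis u v e f)"

lemma narrow_triple_rotate:
  assumes "narrow_triple u v w" shows "narrow_triple v w u"
proof -
  obtain e f where uv: "dual_basis u v e f" using assms unfolding narrow_triple_def by blast
  have w: "w = - u - v" using assms unfolding narrow_triple_def by (simp add: eq_neg_iff_add_eq_0 algebra_simps)
  have x: "x = (v \<bullet> x) *\<^sub>R (f - e) + (w \<bullet> x) *\<^sub>R (- e)" for x
  proof -
    have "x = (u \<bullet> x) *\<^sub>R e + (v \<bullet> x) *\<^sub>R f" using uv unfolding dual_basis_def by blast
    also have "\<dots> = (v \<bullet> x) *\<^sub>R (f - e) + (w \<bullet> x) *\<^sub>R (- e)"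
      unfolding w by (simp add: inner_diff_left algebra_simps)
    finally show ?thesis .
  qed
  have "dual_basis v w (f - e) (- e)"
    using uv x unfolding dual_basis_def w
    by (auto simp: L_closed inner_diff_left inner_diff_right)
  then show ?thesis using assms unfolding narrow_triple_def by (auto simp: algebra_simps)
qed

lemma narrow_triple_swap:
  assumes "narrow_triple u v w" shows "narrow_triple v u w"
proof -
  obtain e f where uv: "dual_basis u v e f" using assms unfolding narrow_triple_def by blast
  then have "dual_basis v u f e" unfolding dual_basis_def by (metis add.commute)
  then show ?thesis using assms unfolding narrow_triple_def by (auto simp: add.commute)
qed

text \<open>
The values of \<open>v\<close> on the elements of \<open>M\<close> in the kernel of \<open>u\<close> form a group \<open>(1/p)\<int>\<close>, and
\<open>h \<notin> L\<close> forces \<open>p \<ge> 2\<close>. With \<open>h0\<close> of value \<open>1/p\<close>, the tile is a stack of \<open>p\<close>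
translates by multiples of \<open>h0\<close> of its lowest layer \<open>T'\<close>. The stack fits into the strip of
\<open>w\<close>, so on \<open>T'\<close> both \<open>v\<close> and \<open>w\<close> spread over less than \<open>1/p\<close>. Scaled by \<open>p\<close> they are
narrow for the lattice generated by \<open>L\<close> and \<open>h0\<close>, of which \<open>T'\<close> is a tile, and the index of this
pair is \<open>p\<close>; so \<open>T'\<close> is symmetric and the stack is symmetric too.
\<close>

lemma coincidence_symmetric:
  assumes nu: "narrow u" and nv: "narrow v" and nw: "narrow w" and sum0: "u + v + w = 0"
    and dual: "dual_basis u v e f" and h: "h \<in> M" "u \<bullet> h \<in> \<int>" "h \<notin> L"
  shows "centrally_symmetric T"
proof -
  have f: "f \<in> L" "f \<in> M" "u \<bullet> f = 0" "v \<bullet> f = 1" and e: "e \<in> L" "u \<bullet> e = 1" "v \<bullet> e = 0"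
    using dual L_subset unfolding dual_basis_def by auto
  have w: "w \<bullet> x = - (u \<bullet> x) - v \<bullet> x" for x
  proof -
    have "u \<bullet> x + v \<bullet> x + w \<bullet> x = 0" using sum0 by (metis inner_add_left inner_zero_left)
    then show ?thesis by linarith
  qed
  define H where "H = {m \<in> M. u \<bullet> m = 0}"
  have H_closed: "x \<in> H \<Longrightarrow> y \<in> H \<Longrightarrow> x - y \<in> H" for x y
    using M_closed(2) by (auto simp: H_def inner_diff_right)
  then have "additive_subgroup H"
    using M_closed(1) by (auto simp: additive_subgroup_def H_def)
  note H_scale = additive_subgroup_scale_int[OF this]
  define P where "P = {v \<bullet> m | m. m \<in> H \<and> 0 < v \<bullet> m \<and> v \<bullet> m \<le> 1}"
  have "P \<subseteq> (\<lambda>t. v \<bullet> t - of_int \<lceil>v \<bullet> t\<rceil> + 1) ` T"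
  proof
    fix r assume "r \<in> P"
    then obtain m where m: "m \<in> M" "r = v \<bullet> m" "0 < v \<bullet> m" "v \<bullet> m \<le> 1" by (auto simp: P_def H_def)
    obtain l t where lt: "l \<in> L" "t \<in> T" "m = l + t" using tile[OF m(1)] by blast
    obtain k where k: "v \<bullet> l = of_int k" using narrowD(1)[OF nv lt(1)] by (auto elim: Ints_cases)
    have "v \<bullet> t = v \<bullet> m - of_int k" using lt k by (simp add: inner_add_right)
    then have "\<lceil>v \<bullet> t\<rceil> = 1 - k" using m by (intro ceiling_unique) auto
    then have "r = v \<bullet> t - of_int \<lceil>v \<bullet> t\<rceil> + 1" using m lt k by (simp add: inner_add_right)
    then show "r \<in> (\<lambda>t. v \<bullet> t - of_int \<lceil>v \<bullet> t\<rceil> + 1) ` T" using lt(2) by blast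
  qed
  then have finP: "finite P" using finite_T finite_surj by blast
  have "1 \<in> P" using f unfolding P_def H_def by force
  \<comment> \<open>The minimum exists because the values in \<open>P\<close> are determined by representatives in \<open>T\<close>;
  it generates all values, as the remainder of a division by it would be smaller.\<close>
  define \<beta> where "\<beta> = Min P"
  have "\<beta> \<in> P" and \<beta>_min: "\<And>r. r \<in> P \<Longrightarrow> \<beta> \<le> r"
    using finP \<open>1 \<in> P\<close> by (auto simp: \<beta>_def intro: Min_in)
  then obtain h0 where h0: "h0 \<in> H" "v \<bullet> h0 = \<beta>" and \<beta>_pos: "0 < \<beta>" and \<beta>_le: "\<beta> \<le> 1" by (auto simp: P_def)
  have multiple: "\<exists>k::int. v \<bullet> m = of_int k * \<beta>" if "m \<in> H" for m
  proof -
    define k where "k = \<lfloor>v \<bullet> m / \<beta>\<rfloor>"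
    have "of_int k \<le> v \<bullet> m / \<beta>" "v \<bullet> m / \<beta> < of_int k + 1" unfolding k_def by linarith+
    then have bounds: "of_int k * \<beta> \<le> v \<bullet> m" "v \<bullet> m < of_int k * \<beta> + \<beta>"
      using \<beta>_pos by (simp_all add: field_simps)
    have inH: "m - of_int k *\<^sub>R h0 \<in> H" using H_closed that H_scale[OF h0(1)] by simp
    have val: "v \<bullet> (m - of_int k *\<^sub>R h0) = v \<bullet> m - of_int k * \<beta>" using h0(2) by (simp add: inner_diff_right)
    have "v \<bullet> m = of_int k * \<beta>"
    proof (rule ccontr)
      assume "v \<bullet> m \<noteq> of_int k * \<beta>"
      then have "v \<bullet> m - of_int k * \<beta> \<in> P"
        unfolding P_def using bounds \<beta>_le inH val by (auto intro!: exI[of _ "m - of_int k *\<^sub>R h0"])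
      then show False using \<beta>_min bounds by fastforce
    qed
    then show ?thesis by blast
  qed
  obtain p :: int where p: "1 = of_int p * \<beta>" using multiple[of f] f by (auto simp: H_def)
  have "0 < of_int p * \<beta>" using p by linarith
  then have p_pos: "0 < p" using \<beta>_pos by (simp add: zero_less_mult_iff)
  have "p \<noteq> 1"
  proof
    assume "p = 1"
    then have "\<beta> = 1" using p by simp
    define h' where "h' = h - (u \<bullet> h) *\<^sub>R e"
    have "(u \<bullet> h) *\<^sub>R e \<in> L" using additive_subgroup_scale_int[OF subgroup_L e(1) h(2)] .
    then have "h' \<in> M" using h(1) M_closed(2) L_subset unfolding h'_def by blast
    moreover have "u \<bullet> h' = 0" unfolding h'_def using e by (simp add: inner_diff_right)
    moreover obtain k :: int where "v \<bullet> h' = of_int k * \<beta>" using multiple[of h'] calculation by (auto simp: H_def)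
    ultimately have "h' \<in> L" using dual_basis_in_L[OF dual, of h'] \<open>\<beta> = 1\<close> by simp
    then have "h' + (u \<bullet> h) *\<^sub>R e \<in> L" using L_closed(4) \<open>(u \<bullet> h) *\<^sub>R e \<in> L\<close> by blast
    then show False using h(3) by (simp add: h'_def)
  qed
  then have p2: "2 \<le> p" using p_pos by linarith
  have uh0: "u \<bullet> h0 = 0" and h0M: "h0 \<in> M" using h0 by (auto simp: H_def)
  define y0 where "y0 = Min ((\<lambda>t. v \<bullet> t) ` T)"
  have y0_le: "y0 \<le> v \<bullet> t" if "t \<in> T" for t using that finite_T by (simp add: y0_def)
  have "y0 \<in> (\<lambda>t. v \<bullet> t) ` T" unfolding y0_def using finite_T T_nonempty by (intro Min_in) auto
  then obtain a where a: "a \<in> T" "v \<bullet> a = y0" by auto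
  have y0_upper: "v \<bullet> t < y0 + 1" if "t \<in> T" for t using narrowD(2)[OF nv that a(1)] a(2) by linarith
  \<comment> \<open>Multiples of \<open>h0\<close> do not affect \<open>u\<close>, so a point remains in \<open>T\<close> while \<open>v\<close> stays in its window.\<close>
  have slide: "t + of_int j *\<^sub>R h0 \<in> T"
    if t: "t \<in> T" and j: "y0 \<le> v \<bullet> t + of_int j * \<beta>" "v \<bullet> t + of_int j * \<beta> < y0 + 1" for t j
  proof -
    have "t + of_int j *\<^sub>R h0 \<in> M"
      using t T_subset M_closed(4) additive_subgroup_scale_int[OF subgroup_M h0M] by auto
    then obtain l t' where l: "l \<in> L" "t' \<in> T" "t + of_int j *\<^sub>R h0 = l + t'" using tile by blast
    then have l_eq: "l = t + of_int j *\<^sub>R h0 - t'" by (simp add: algebra_simps)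
    have "u \<bullet> l = u \<bullet> t - u \<bullet> t'" "v \<bullet> l = v \<bullet> t + of_int j * \<beta> - v \<bullet> t'"
      unfolding l_eq by (simp_all add: inner_diff_right inner_add_right uh0 h0(2))
    then have "u \<bullet> l < 1" "- 1 < u \<bullet> l" "v \<bullet> l < 1" "- 1 < v \<bullet> l"
      using narrowD(2)[OF nu t l(2)] narrowD(2)[OF nu l(2) t] y0_le[OF l(2)] y0_upper[OF l(2)] j
      by linarith+
    then have "u \<bullet> l = 0" "v \<bullet> l = 0"
      using narrowD(1)[OF nu l(1)] narrowD(1)[OF nv l(1)] Ints_eq_0_of_abs_less_1 by blast+
    then have "l = 0" using dual_basis_eqI[OF dual, of l 0] by simp
    then show ?thesis using l by simp
  qed
  define T' where "T' = {t \<in> T. v \<bullet> t < y0 + \<beta>}"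
  have bottom: "\<exists>j::int. 0 \<le> j \<and> j \<le> p - 1 \<and> t - of_int j *\<^sub>R h0 \<in> T'" if t: "t \<in> T" for t
  proof -
    define j where "j = \<lfloor>(v \<bullet> t - y0) / \<beta>\<rfloor>"
    have "of_int j \<le> (v \<bullet> t - y0) / \<beta>" "(v \<bullet> t - y0) / \<beta> < of_int j + 1" unfolding j_def by linarith+
    then have j: "of_int j * \<beta> \<le> v \<bullet> t - y0" "v \<bullet> t - y0 < of_int j * \<beta> + \<beta>"
      using \<beta>_pos by (simp_all add: field_simps)
    have "of_int j * \<beta> < of_int p * \<beta>" "0 < (of_int j + 1) * \<beta>"
      using j y0_upper[OF t] y0_le[OF t] p \<beta>_pos by (simp_all add: algebra_simps)
    then have "j < p" "-1 < j" using \<beta>_pos by (simp_all add: zero_less_mult_iff)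
    moreover have "t + of_int (- j) *\<^sub>R h0 \<in> T" by (rule slide[OF t]) (use j \<beta>_le in auto)
    ultimately show ?thesis using j h0(2) unfolding T'_def
      by (intro exI[of _ j]) (auto simp: inner_diff_right)
  qed
  have stack: "t + of_int j *\<^sub>R h0 \<in> T" if t: "t \<in> T'" and j: "0 \<le> j" "j \<le> p - 1" for t and j :: int
  proof (rule slide)
    show "t \<in> T" using t by (simp add: T'_def)
    have "of_int j * \<beta> \<le> of_int (p - 1) * \<beta>" using j \<beta>_pos by (intro mult_right_mono) auto
    also have "\<dots> = 1 - \<beta>" using p by (simp add: algebra_simps)
    finally show "v \<bullet> t + of_int j * \<beta> < y0 + 1" using t by (simp add: T'_def)
    show "y0 \<le> v \<bullet> t + of_int j * \<beta>" using y0_le[OF \<open>t \<in> T\<close>] j \<beta>_pos by (simp add: add_increasing2)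
  qed
  have width: "of_int p * (r1 - r2) < 1" if "r1 - r2 < \<beta>" for r1 r2
    using mult_strict_left_mono[OF that, of "of_int p"] p p_pos by simp
  define L' where "L' = {l + of_int j *\<^sub>R h0 | l (j::int). l \<in> L}"
  have T'T: "t \<in> T' \<Longrightarrow> t \<in> T" for t by (simp add: T'_def)
  have "\<exists>c. \<forall>t\<in>T'. c - t \<in> T'"
  proof (rule narrow_pair_reflection[of T' "of_int p *\<^sub>R v" "of_int p *\<^sub>R w" L'])
    show "finite T'" using finite_T by (simp add: T'_def)
    show "T' \<noteq> {}" using a \<beta>_pos by (auto simp: T'_def)
    show "(of_int p *\<^sub>R v) \<bullet> s - (of_int p *\<^sub>R v) \<bullet> t < 1" if "s \<in> T'" "t \<in> T'" for s t
      using width[of "v \<bullet> s" "v \<bullet> t"] that y0_le[OF T'T[OF that(2)]]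
      by (simp add: T'_def inner_scaleR_left right_diff_distrib)
    show "(of_int p *\<^sub>R w) \<bullet> s - (of_int p *\<^sub>R w) \<bullet> t < 1" if "s \<in> T'" "t \<in> T'" for s t
    proof -
      have "w \<bullet> s - w \<bullet> (t + of_int (p - 1) *\<^sub>R h0) < 1"
        by (rule narrowD(2)[OF nw T'T[OF that(1)] stack[OF that(2)]]) (use p_pos in simp_all)
      moreover have "w \<bullet> (t + of_int (p - 1) *\<^sub>R h0) = w \<bullet> t - (1 - \<beta>)"
        using p uh0 h0(2) by (simp add: w inner_add_right algebra_simps)
      ultimately show ?thesis using width[of "w \<bullet> s" "w \<bullet> t"] by (simp add: right_diff_distrib)
    qed
    show "\<exists>l\<in>L'. \<exists>t'\<in>T'. r + s - t = l + t'" if "r \<in> T'" "s \<in> T'" "t \<in> T'" for r s t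
    proof -
      have "r + s - t \<in> M" using that T'T T_subset M_closed by (meson subsetD)
      then obtain l t' where l: "l \<in> L" "t' \<in> T" "r + s - t = l + t'" using tile by blast
      obtain j :: int where j: "t' - of_int j *\<^sub>R h0 \<in> T'" using bottom[OF l(2)] by blast
      have "l + of_int j *\<^sub>R h0 \<in> L'" using l(1) by (auto simp: L'_def)
      moreover have "r + s - t = (l + of_int j *\<^sub>R h0) + (t' - of_int j *\<^sub>R h0)" using l by simp
      ultimately show ?thesis using j by blast
    qed
    fix l assume "l \<in> L'"
    then obtain l0 and j :: int where l: "l = l0 + of_int j *\<^sub>R h0" "l0 \<in> L" by (auto simp: L'_def)
    have vl: "v \<bullet> l = v \<bullet> l0 + of_int j * \<beta>" and ul: "u \<bullet> l = u \<bullet> l0"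
      using l h0(2) uh0 by (simp_all add: inner_add_right)
    have "of_int p * (v \<bullet> l) = of_int p * (v \<bullet> l0) + of_int j * (of_int p * \<beta>)" unfolding vl by (simp add: algebra_simps)
    also have "\<dots> = of_int p * (v \<bullet> l0) + of_int j" using p by simp
    finally show "(of_int p *\<^sub>R v) \<bullet> l \<in> \<int>" using narrowD(1)[OF nv l(2)] by simp
    assume zero: "(of_int p *\<^sub>R v) \<bullet> l = 0" and small: "\<bar>(of_int p *\<^sub>R w) \<bullet> l\<bar> < 2"
    have v0: "v \<bullet> l = 0" using zero p_pos by simp
    have "of_int p * \<bar>u \<bullet> l\<bar> < 2" using small v0 p_pos by (simp add: w abs_mult)
    moreover have "2 * \<bar>u \<bullet> l\<bar> \<le> of_int p * \<bar>u \<bullet> l\<bar>" using p2 by (intro mult_right_mono) auto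
    ultimately have "\<bar>u \<bullet> l\<bar> < 1" by linarith
    then have "u \<bullet> l = 0"
      using narrowD(1)[OF nu l(2)] by (auto intro!: Ints_eq_0_of_abs_less_1 simp: ul)
    then show "l = 0" using v0 dual_basis_eqI[OF dual, of l 0] by simp
  qed
  then obtain c where c: "\<And>t. t \<in> T' \<Longrightarrow> c - t \<in> T'" by blast
  show ?thesis
  proof (rule centrally_symmetricI[of _ "c + of_int (p - 1) *\<^sub>R h0"])
    fix t assume "t \<in> T"
    then obtain j :: int where j: "0 \<le> j" "j \<le> p - 1" "t - of_int j *\<^sub>R h0 \<in> T'" using bottom by blast
    have "c - (t - of_int j *\<^sub>R h0) + of_int (p - 1 - j) *\<^sub>R h0 \<in> T"
      by (rule stack[OF c[OF j(3)]]) (use j in simp_all)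
    then show "c + of_int (p - 1) *\<^sub>R h0 - t \<in> T" by (simp add: algebra_simps)
  qed
qed

text \<open>
Adding \<open>m\<close> permutes the classes modulo \<open>L\<close>, so summing \<open>t + m\<close> over the representatives changes
their sum by an element of \<open>L\<close> only.
\<close>

lemma card_multiple_in_L:
  assumes m: "m \<in> M" shows "real (card T) *\<^sub>R m \<in> L"
proof -
  have "\<forall>t\<in>T. \<exists>s. s \<in> T \<and> t + m - s \<in> L"
  proof
    fix t assume "t \<in> T"
    then have "t + m \<in> M" using m T_subset M_closed(4) by blast
    then obtain l s where "l \<in> L" "s \<in> T" "t + m = l + s" using tile by blast
    then show "\<exists>s. s \<in> T \<and> t + m - s \<in> L" by (intro exI[of _ s]) simp
  qed
  then obtain \<pi> where \<pi>: "\<And>t. t \<in> T \<Longrightarrow> \<pi> t \<in> T \<and> t + m - \<pi> t \<in> L" by metis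
  have inj: "inj_on \<pi> T"
  proof (rule inj_onI)
    fix s t assume st: "s \<in> T" "t \<in> T" "\<pi> s = \<pi> t"
    have "(s + m - \<pi> s) - (t + m - \<pi> t) \<in> L" using L_closed(2) \<pi> st by blast
    then show "s = t" using tile_unique st by simp
  qed
  have "\<pi> ` T = T" using \<pi> inj finite_T by (intro card_subset_eq) (auto simp: card_image)
  then have "(\<Sum>t\<in>T. \<pi> t) = (\<Sum>t\<in>T. t)" using sum.reindex[OF inj, of "\<lambda>t. t"] by simp
  then have "(\<Sum>t\<in>T. t + m - \<pi> t) = real (card T) *\<^sub>R m"
    by (simp add: sum_subtractf sum.distrib sum_constant_scaleR)
  moreover have "(\<Sum>t\<in>T. t + m - \<pi> t) \<in> L" using \<pi> by (intro additive_subgroup_sum[OF subgroup_L]) auto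
  ultimately show ?thesis by simp
qed

definition level_coordinate :: "'a \<Rightarrow> ('a \<Rightarrow> int) \<Rightarrow> int \<Rightarrow> bool" where
  "level_coordinate u x x0 \<longleftrightarrow> (\<forall>t\<in>T. real (card T) * (u \<bullet> t) = of_int (x0 + x t))"

text \<open>
The multiples by \<open>N = |T|\<close> are integers in a window of length less than \<open>N\<close>, and they are
distinct because two points with the same value of \<open>u\<close> would differ by an element of \<open>L\<close>.
\<close>

lemma level_coordinate_exists:
  assumes nu: "narrow u" and free: "\<And>m. m \<in> M \<Longrightarrow> u \<bullet> m \<in> \<int> \<Longrightarrow> m \<in> L"
  obtains x x0 where "level_coordinate u x x0" "bij_betw x T {0..<int (card T)}"
proof -
  define N where "N = real (card T)"
  have Npos: "N > 0" using finite_T T_nonempty by (simp add: N_def card_gt_0_iff)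
  define x' where "x' t = \<lfloor>N * (u \<bullet> t)\<rfloor>" for t
  have x': "of_int (x' t) = N * (u \<bullet> t)" if "t \<in> T" for t
  proof -
    have "u \<bullet> (N *\<^sub>R t) \<in> \<int>"
      using narrowD(1)[OF nu card_multiple_in_L] that T_subset by (auto simp: N_def)
    then show ?thesis by (auto simp: x'_def elim!: Ints_cases)
  qed
  define x0 where "x0 = Min (x' ` T)"
  define x where "x t = x' t - x0" for t
  have "x0 \<in> x' ` T" unfolding x0_def using finite_T T_nonempty by (intro Min_in) auto
  then obtain a where a: "a \<in> T" "x0 = x' a" by auto
  have range: "x t \<in> {0..<int (card T)}" if "t \<in> T" for t
  proof -
    have "x0 \<le> x' t" using that finite_T by (simp add: x0_def)
    moreover have "of_int (x' t - x0) < N"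
      using mult_strict_left_mono[OF narrowD(2)[OF nu that a(1)] Npos] x'[OF that] x'[OF a(1)] a(2)
      by (simp add: algebra_simps)
    ultimately show ?thesis unfolding x_def N_def by simp linarith?
  qed
  have inj: "inj_on x T"
  proof (rule inj_onI)
    fix s t assume st: "s \<in> T" "t \<in> T" "x s = x t"
    then have "u \<bullet> s = u \<bullet> t" using x'[OF st(1)] x'[OF st(2)] Npos by (simp add: x_def)
    then have "s - t \<in> L" using free[of "s - t"] st T_subset M_closed(2) by (auto simp: inner_diff_right)
    then show "s = t" using tile_unique st by blast
  qed
  have "x ` T = {0..<int (card T)}"
    using range inj by (intro card_subset_eq) (auto simp: card_image)
  then have "bij_betw x T {0..<int (card T)}" using inj by (simp add: bij_betw_def)
  moreover have "level_coordinate u x x0"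
    unfolding level_coordinate_def using x' by (simp add: x_def N_def)
  ultimately show thesis by (rule that[rotated])
qed

end

section \<open>From a tile to a trapezoid\<close>

context lattice_tile
begin

lemma level_coordinate_diff:
  assumes "level_coordinate u x x0" "s \<in> T" "t \<in> T"
  shows "real (card T) * (u \<bullet> (t - s)) = of_int (x t - x s)"
  using assms by (simp add: level_coordinate_def inner_diff_right right_diff_distrib)

lemma level_coordinate_shift:
  assumes x: "level_coordinate u x x0" and u: "narrow u" and "r \<in> T" "s \<in> T" "t \<in> T" "t' \<in> T"
    and l: "r + t - s - t' \<in> L"
  shows "int (card T) dvd x t' - x r - (x t - x s)"
proof -
  obtain k where k: "u \<bullet> (r + t - s - t') = of_int k" using narrowD(1)[OF u l] by (auto elim: Ints_cases)
  have "t' - r - (t - s) = - (r + t - s - t')" by simp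
  then have "u \<bullet> (t' - r) - u \<bullet> (t - s) = - of_int k"
    using k by (metis inner_diff_right inner_minus_right)
  then have "real (card T) * (u \<bullet> (t' - r)) - real (card T) * (u \<bullet> (t - s)) = real (card T) * of_int (- k)"
    by (metis of_int_minus right_diff_distrib)
  then have "of_int (x t' - x r - (x t - x s)) = (of_int (int (card T) * (- k)) :: real)"
    using level_coordinate_diff[OF x] assms(3-6) by simp
  then have "x t' - x r - (x t - x s) = int (card T) * (- k)" by (simp only: of_int_eq_iff)
  then show ?thesis by (rule dvdI)
qed

lemma hexagon_of_narrow_triple:
  assumes triple: "narrow_triple u v w"
    and free: "\<And>m. m \<in> M \<Longrightarrow> u \<bullet> m \<in> \<int> \<Longrightarrow> m \<in> L" "\<And>m. m \<in> M \<Longrightarrow> v \<bullet> m \<in> \<int> \<Longrightarrow> m \<in> L"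
      "\<And>m. m \<in> M \<Longrightarrow> w \<bullet> m \<in> \<int> \<Longrightarrow> m \<in> L"
    and card: "card T \<ge> 2"
  obtains x y z x0 y0 z0 \<sigma> where "level_coordinate u x x0" "level_coordinate v y y0" "level_coordinate w z z0"
    "cyclic_hexagon (int (card T)) T x y z \<sigma>"
proof -
  have narrow: "narrow u" "narrow v" "narrow w" and sum0: "u + v + w = 0"
    using triple by (auto simp: narrow_triple_def)
  obtain x x0 where x: "level_coordinate u x x0" "bij_betw x T {0..<int (card T)}"
    using level_coordinate_exists[OF narrow(1) free(1)] by blast
  obtain y y0 where y: "level_coordinate v y y0" "bij_betw y T {0..<int (card T)}"
    using level_coordinate_exists[OF narrow(2) free(2)] by blast
  obtain z z0 where z: "level_coordinate w z z0" "bij_betw z T {0..<int (card T)}"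
    using level_coordinate_exists[OF narrow(3) free(3)] by blast
  have "cyclic_hexagon (int (card T)) T x y z (- (x0 + y0 + z0))"
  proof
    fix t assume t: "t \<in> T"
    have "u \<bullet> t + v \<bullet> t + w \<bullet> t = 0" using sum0 by (metis inner_add_left inner_zero_left)
    then have "real (card T) * (u \<bullet> t) + real (card T) * (v \<bullet> t) + real (card T) * (w \<bullet> t) = 0"
      by (metis distrib_left mult_zero_right)
    then have "of_int (x0 + x t + (y0 + y t) + (z0 + z t)) = (of_int 0 :: real)"
      using x(1) y(1) z(1) t by (simp add: level_coordinate_def)
    then have "x0 + x t + (y0 + y t) + (z0 + z t) = 0" by (simp only: of_int_eq_iff)
    then show "x t + y t + z t = - (x0 + y0 + z0)" by linarith
  next
    fix s t assume st: "s \<in> T" "t \<in> T"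
    show "residue_shift (int (card T)) T x y z (x t - x s) (y t - y s) (z t - z s)"
      unfolding residue_shift_def
    proof
      fix r assume r: "r \<in> T"
      then have "r + t - s \<in> M" using st T_subset M_closed by (meson subsetD)
      then obtain l t' where l: "l \<in> L" "t' \<in> T" "r + t - s = l + t'" using tile by blast
      then have "r + t - s - t' \<in> L" by simp
      then show "\<exists>t'\<in>T. int (card T) dvd x t' - x r - (x t - x s) \<and>
          int (card T) dvd y t' - y r - (y t - y s) \<and> int (card T) dvd z t' - z r - (z t - z s)"
        using level_coordinate_shift[OF x(1) narrow(1) r st l(2)] level_coordinate_shift[OF y(1) narrow(2) r st l(2)]
          level_coordinate_shift[OF z(1) narrow(3) r st l(2)] l(2) by blast
    qed
  qed (use card x y z in auto)
  then show thesis by (rule that[OF x(1) y(1) z(1)])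
qed

text \<open>
In the coordinates \<open>u, v\<close> the vector \<open>a\<close> is \<open>(1, 1) / (2 k + 1)\<close> and \<open>f\<close> is \<open>(0, 1)\<close>.
The two vectors generate \<open>M\<close>, and the tile consists of two rows in direction \<open>a\<close>.
\<close>

definition trapezoid_tile :: "'a \<Rightarrow> 'a \<Rightarrow> bool" where
  "trapezoid_tile u v \<longleftrightarrow> (\<exists>k e f a t0. (1::nat) \<le> k \<and> dual_basis u v e f \<and>
     real (2 * k + 1) * (u \<bullet> a) = 1 \<and> real (2 * k + 1) * (v \<bullet> a) = 1 \<and> a \<in> M \<and>
     (\<forall>m\<in>M. \<exists>i j. m = of_int i *\<^sub>R a + of_int j *\<^sub>R f) \<and> t0 \<in> T \<and>
     T + {- t0} = multiples (real ` {0..k}) a \<union> (multiples (real ` {0..k - 1}) a + {real (k + 1) *\<^sub>R a - f}))"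

text \<open>
Points of \<open>T\<close> are determined by their two coordinates. As long as the second coordinate has not wrapped
they are multiples of \<open>a\<close> away from \<open>t0\<close>; after the wrap \<open>f\<close> is subtracted.
\<close>

lemma trapezoid_tileI:
  assumes triple: "narrow_triple u v w"
    and free: "\<And>m. m \<in> M \<Longrightarrow> u \<bullet> m \<in> \<int> \<Longrightarrow> m \<in> L"
    and x: "level_coordinate u x x0" and y: "level_coordinate v y y0"
    and hexagon: "cyclic_hexagon (int (card T)) T x y z \<sigma>"
    and k: "card T = 2 * k + 1" "1 \<le> k"
    and shift: "residue_shift (int (card T)) T x y z 1 1 (-2)"
    and t0: "t0 \<in> T" "x t0 = 0" "y t0 = int k"
  shows "trapezoid_tile u v"
proof -
  define N where "N = real (card T)"
  have Npos: "N > 0" using k by (simp add: N_def)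
  have N_eq: "real (2 * k + 1) = N" using k by (simp add: N_def)
  have narrow: "narrow u" "narrow v" using triple by (auto simp: narrow_triple_def)
  obtain e f where dual: "dual_basis u v e f" using triple by (auto simp: narrow_triple_def)
  have e: "e \<in> L" "u \<bullet> e = 1" "v \<bullet> e = 0" and f: "f \<in> L" "u \<bullet> f = 0" "v \<bullet> f = 1"
    using dual by (auto simp: dual_basis_def)
  obtain t1 i j where t1: "t1 \<in> T" "x t1 - x t0 - 1 = int (card T) * i" "y t1 - y t0 - 1 = int (card T) * j"
    using shift t0(1) unfolding residue_shift_def dvd_def by blast
  \<comment> \<open>Reduction by an element of \<open>L\<close> turns the congruences into exact values \<open>1/N\<close>.\<close>
  define a where "a = t1 - t0 - (of_int i *\<^sub>R e + of_int j *\<^sub>R f)"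
  have corr: "of_int i *\<^sub>R e + of_int j *\<^sub>R f \<in> L"
    using additive_subgroup_scale_int[OF subgroup_L] e f L_closed(4) by simp
  have aM: "a \<in> M" unfolding a_def using corr t1 t0 T_subset L_subset M_closed(2) by blast
  have "N * (u \<bullet> (t1 - t0)) = of_int (1 + int (card T) * i)" "N * (v \<bullet> (t1 - t0)) = of_int (1 + int (card T) * j)"
    using level_coordinate_diff[OF x t0(1) t1(1)] level_coordinate_diff[OF y t0(1) t1(1)] t1(2,3)
    by (simp_all add: N_def algebra_simps)
  then have ua: "N * (u \<bullet> a) = 1" and va: "N * (v \<bullet> a) = 1"
    unfolding a_def using e f by (simp_all add: N_def inner_diff_right inner_add_right right_diff_distrib distrib_left)
  have basis: "\<exists>i j. m = of_int i *\<^sub>R a + of_int j *\<^sub>R f" if m: "m \<in> M" for m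
  proof -
    have "u \<bullet> (N *\<^sub>R m) \<in> \<int>" using narrowD(1)[OF narrow(1) card_multiple_in_L[OF m]] by (simp add: N_def)
    then obtain i where i: "N * (u \<bullet> m) = of_int i" by (auto elim: Ints_cases)
    define r where "r = m - of_int i *\<^sub>R a"
    have "N * (u \<bullet> r) = 0" unfolding r_def using i ua by (simp add: inner_diff_right right_diff_distrib)
    then have ur: "u \<bullet> r = 0" using Npos by simp
    have "r \<in> M" unfolding r_def using m additive_subgroup_scale_int[OF subgroup_M aM] M_closed(2) by simp
    then have "r \<in> L" using free ur by simp
    then obtain j where j: "v \<bullet> r = of_int j" using narrowD(1)[OF narrow(2)] by (blast elim: Ints_cases)
    have "r = of_int j *\<^sub>R f" using dual_basis_eqI[OF dual, of r "of_int j *\<^sub>R f"] f ur j by simp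
    then show ?thesis unfolding r_def by (metis add.commute diff_add_cancel)
  qed
  define row where "row i = (if i \<le> k then real i *\<^sub>R a else real i *\<^sub>R a - f)" for i
  have row: "t - t0 = row (nat (x t))" if t: "t \<in> T" for t
  proof (rule dual_basis_eqI[OF dual])
    have x_range: "0 \<le> x t" using cyclic_hexagon.coords_range[OF hexagon t] by blast
    have yt: "y t = (if x t \<le> int k then x t + int k else x t + int k - int (card T))"
      by (rule cyclic_hexagon.trapezoid_rows[OF hexagon shift _ t0 t]) (use k in simp)
    have Nu: "N * (u \<bullet> (t - t0)) = of_int (x t)"
      using level_coordinate_diff[OF x t0(1) t] t0 by (simp add: N_def)
    have Nv: "N * (v \<bullet> (t - t0)) = (if x t \<le> int k then of_int (x t) else of_int (x t) - N)"
      using level_coordinate_diff[OF y t0(1) t] t0 yt by (simp add: N_def)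
    have "N * (u \<bullet> row (nat (x t))) = of_int (x t)"
      using ua f x_range by (simp add: row_def inner_diff_right right_diff_distrib)
    then show "u \<bullet> (t - t0) = u \<bullet> row (nat (x t))" using Nu Npos by (metis mult_cancel_left less_irrefl)
    have "N * (v \<bullet> row (nat (x t))) = (if x t \<le> int k then of_int (x t) else of_int (x t) - N)"
      using va f x_range by (simp add: row_def inner_diff_right right_diff_distrib nat_le_iff)
    then show "v \<bullet> (t - t0) = v \<bullet> row (nat (x t))" using Nv Npos by (metis mult_cancel_left less_irrefl)
  qed
  have "(\<lambda>t. nat (x t)) ` T = nat ` {0..<int (card T)}"
    using cyclic_hexagon.bij_x[OF hexagon] by (simp add: bij_betw_def flip: image_image)
  also have "\<dots> = {0..2 * k}"
  proof -
    have "{0..<int (card T)} = int ` {0..2 * k}"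
      unfolding image_int_atLeastAtMost using k by auto
    then show ?thesis by (simp only: image_image nat_int image_ident)
  qed
  finally have indices: "(\<lambda>t. nat (x t)) ` T = {0..2 * k}" .
  have "T + {- t0} = (\<lambda>t. t - t0) ` T" by (auto simp: set_plus_def)
  also have "\<dots> = row ` (\<lambda>t. nat (x t)) ` T" using row by (simp add: image_image)
  also have "\<dots> = row ` {0..2 * k}" unfolding indices ..
  also have "{0..2 * k} = {0..k} \<union> (\<lambda>j. j + (k + 1)) ` {0..k - 1}"
    using k by (subst image_add_atLeastAtMost') auto
  also have "row ` ({0..k} \<union> (\<lambda>j. j + (k + 1)) ` {0..k - 1}) =
      (\<lambda>i. real i *\<^sub>R a) ` {0..k} \<union> (\<lambda>j. real j *\<^sub>R a + (real (k + 1) *\<^sub>R a - f)) ` {0..k - 1}"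
    unfolding image_Un image_image row_def
    by (intro arg_cong2[of _ _ _ _ "(\<union>)"] image_cong) (auto simp: algebra_simps)
  also have "\<dots> = multiples (real ` {0..k}) a \<union> (multiples (real ` {0..k - 1}) a + {real (k + 1) *\<^sub>R a - f})"
    by (force simp: multiples_def set_plus_def image_image)
  finally have T_eq: "T + {- t0} =
    multiples (real ` {0..k}) a \<union> (multiples (real ` {0..k - 1}) a + {real (k + 1) *\<^sub>R a - f})" .
  show ?thesis
    unfolding trapezoid_tile_def
  proof (intro exI conjI)
    show "real (2 * k + 1) * (u \<bullet> a) = 1" "real (2 * k + 1) * (v \<bullet> a) = 1"
      unfolding N_eq by (rule ua va)+
    show "\<forall>m\<in>M. \<exists>i j. m = of_int i *\<^sub>R a + of_int j *\<^sub>R f" using basis by blast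
  qed (rule k(2) dual aM t0(1) T_eq)+
qed

text \<open>
Asymmetry rules out a coincidence of values of any of the three functionals as well as a central point,
so the classification of steps applies, up to the order of the functionals.
\<close>

lemma narrow_triple_dichotomy:
  assumes triple: "narrow_triple u v w" and asym: "\<not> centrally_symmetric T"
  obtains u' v' w' where "narrow_triple u' v' w'" "trapezoid_tile u' v'"
proof -
  note conclude = that
  have free: "m \<in> L" if "narrow_triple p q r" "m \<in> M" "p \<bullet> m \<in> \<int>" for p q r m
    using that coincidence_symmetric[of p q r] asym unfolding narrow_triple_def by blast
  note vwu = narrow_triple_rotate[OF triple]
  note wuv = narrow_triple_rotate[OF vwu]
  have card: "card T \<ge> 2"
  proof (rule ccontr)
    assume "\<not> card T \<ge> 2"
    then have "card T = 1" using finite_T T_nonempty by (metis One_nat_def Suc_1 Suc_leI card_gt_0_iff le_neq_implies_less less_Suc_eq_le not_less)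
    then obtain t where "T = {t}" by (auto simp: card_1_singleton_iff)
    then show False using asym centrally_symmetricI[of T "2 *\<^sub>R t"] by (simp add: scaleR_2)
  qed
  obtain x y z x0 y0 z0 \<sigma> where xyz: "level_coordinate u x x0" "level_coordinate v y y0" "level_coordinate w z z0"
    and hexagon: "cyclic_hexagon (int (card T)) T x y z \<sigma>"
    by (rule hexagon_of_narrow_triple[OF triple free[OF triple] free[OF vwu] free[OF wuv] card])
  interpret hexagon: cyclic_hexagon "int (card T)" T x y z \<sigma> by (rule hexagon)
  obtain e f where dual: "dual_basis u v e f" using triple by (auto simp: narrow_triple_def)
  obtain m where m: "int (card T) = 2 * m + 1" using hexagon.odd_order by blast
  define k where "k = nat m"
  have k: "card T = 2 * k + 1" "1 \<le> k" using m card by (simp_all add: k_def)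
  have no_center: "\<not> hexagon.central_point c" for c
  proof
    assume c: "hexagon.central_point c"
    \<comment> \<open>The point \<open>g\<close> is twice the centre, given by its coordinates.\<close>
    obtain g where g: "real (card T) * (u \<bullet> g) = of_int (2 * x0 + int (card T) - 1)"
      "real (card T) * (v \<bullet> g) = of_int (2 * y0 + int (card T) - 1)"
    proof
      let ?g = "(of_int (2 * x0 + int (card T) - 1) / real (card T)) *\<^sub>R e +
                (of_int (2 * y0 + int (card T) - 1) / real (card T)) *\<^sub>R f"
      show "real (card T) * (u \<bullet> ?g) = of_int (2 * x0 + int (card T) - 1)"
        "real (card T) * (v \<bullet> ?g) = of_int (2 * y0 + int (card T) - 1)"
        using dual k by (simp_all add: dual_basis_def inner_add_right)
    qed
    have "g - t \<in> T" if t: "t \<in> T" for t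
    proof -
      obtain t' where t': "t' \<in> T" "x t' = int (card T) - 1 - x t" "y t' = int (card T) - 1 - y t"
        using hexagon.central_point_reflection[OF c t] by blast
      have "real (card T) * (u \<bullet> t') = real (card T) * (u \<bullet> (g - t))"
        "real (card T) * (v \<bullet> t') = real (card T) * (v \<bullet> (g - t))"
        using xyz(1,2) t t' g by (simp_all add: level_coordinate_def inner_diff_right right_diff_distrib)
      then have "t' = g - t" using dual_basis_eqI[OF dual, of t' "g - t"] k by simp
      then show ?thesis using t' by simp
    qed
    then show False using asym centrally_symmetricI by blast
  qed
  have finish: thesis
    if triple': "narrow_triple p q r" and c: "level_coordinate p x' x0'" "level_coordinate q y' y0'"
      and hexagon': "cyclic_hexagon (int (card T)) T x' y' z' \<sigma>"
      and shift: "residue_shift (int (card T)) T x' y' z' 1 1 (-2)" for p q r x' y' z' x0' y0'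
  proof -
    have "int (card T) = 2 * int k + 1" using k by simp
    then obtain t0 where t0: "t0 \<in> T" "x' t0 = 0 \<and> y' t0 = int k \<or> y' t0 = 0 \<and> x' t0 = int k"
      using cyclic_hexagon.trapezoid_normalised[OF hexagon' shift] by blast
    show thesis
    proof (cases "x' t0 = 0 \<and> y' t0 = int k")
      case True
      have "trapezoid_tile p q"
        by (rule trapezoid_tileI[OF triple' _ c hexagon' k shift t0(1)])
          (use True free[OF triple'] in blast)+
      then show thesis by (rule conclude[OF triple'])
    next
      case False
      note triple'' = narrow_triple_swap[OF triple']
      have hexagon'': "cyclic_hexagon (int (card T)) T y' x' z' \<sigma>"
        by (rule cyclic_hexagon.swap[OF cyclic_hexagon.rotate[OF hexagon']])
      have shift'': "residue_shift (int (card T)) T y' x' z' 1 1 (-2)"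
        using shift unfolding residue_shift_def by blast
      have "trapezoid_tile q p"
        by (rule trapezoid_tileI[OF triple'' _ c(2,1) hexagon'' k shift'' t0(1)])
          (use False t0(2) free[OF triple''] in blast)+
      then show thesis by (rule conclude[OF triple''])
    qed
  qed
  consider "hexagon.shift 1 1 (-2)" | "hexagon.shift 1 (-2) 1" | "hexagon.shift (-2) 1 1"
    using hexagon.step_classification no_center by blast
  then show thesis
  proof cases
    case 1
    then show thesis using finish[OF triple xyz(1,2) hexagon] by blast
  next
    case 2
    have "narrow_triple u w v" by (rule narrow_triple_swap[OF wuv])
    then show thesis using finish[OF _ xyz(1,3) hexagon.swap hexagon.shift_swap[OF 2]] by blast
  next
    case 3
    then show thesis using finish[OF vwu xyz(2,3) hexagon.rotate hexagon.shift_rotate[OF 3]] by blast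
  qed
qed

end

section \<open>Lattice polygons and the normals of their edges\<close>

definition det2 :: "real^2 \<Rightarrow> real^2 \<Rightarrow> real" where
  "det2 u v = u $ 1 * v $ 2 - u $ 2 * v $ 1"

lemma inner_real2: "(u::real^2) \<bullet> x = u $ 1 * x $ 1 + u $ 2 * x $ 2"
  by (simp add: inner_vec_def UNIV_2)

lemma det2_solve:
  assumes "det2 u v \<noteq> 0"
  obtains x where "u \<bullet> x = \<alpha>" "v \<bullet> x = \<beta>"
proof
  define x :: "real^2" where "x = vector [(\<alpha> * v $ 2 - \<beta> * u $ 2) / det2 u v, (\<beta> * u $ 1 - \<alpha> * v $ 1) / det2 u v]"
  have "u \<bullet> x = (u $ 1 * (\<alpha> * v $ 2 - \<beta> * u $ 2) + u $ 2 * (\<beta> * u $ 1 - \<alpha> * v $ 1)) / det2 u v"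
    "v \<bullet> x = (v $ 1 * (\<alpha> * v $ 2 - \<beta> * u $ 2) + v $ 2 * (\<beta> * u $ 1 - \<alpha> * v $ 1)) / det2 u v"
    by (simp_all add: inner_real2 x_def vector_2 add_divide_distrib)
  moreover have "u $ 1 * (\<alpha> * v $ 2 - \<beta> * u $ 2) + u $ 2 * (\<beta> * u $ 1 - \<alpha> * v $ 1) = \<alpha> * det2 u v"
    "v $ 1 * (\<alpha> * v $ 2 - \<beta> * u $ 2) + v $ 2 * (\<beta> * u $ 1 - \<alpha> * v $ 1) = \<beta> * det2 u v"
    by (simp_all add: det2_def algebra_simps)
  ultimately show "u \<bullet> x = \<alpha>" "v \<bullet> x = \<beta>" using assms by simp_all
qed

lemma det2_inj:
  assumes "det2 u v \<noteq> 0" "u \<bullet> x = 0" "v \<bullet> x = 0"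
  shows "x = 0"
proof -
  have "det2 u v * x $ 1 = v $ 2 * (u \<bullet> x) - u $ 2 * (v \<bullet> x)"
    "det2 u v * x $ 2 = u $ 1 * (v \<bullet> x) - v $ 1 * (u \<bullet> x)"
    by (simp_all add: inner_real2 det2_def algebra_simps)
  then have "x $ 1 = 0" "x $ 2 = 0" using assms by simp_all
  then show ?thesis by (simp add: vec_eq_iff forall_2)
qed

lemma det2_eq_0_imp_multiple:
  assumes "det2 u v = 0" "u \<noteq> 0"
  obtains c where "v = c *\<^sub>R u"
proof -
  have "u $ 1 \<noteq> 0 \<or> u $ 2 \<noteq> 0" using assms(2) by (auto simp: vec_eq_iff forall_2)
  then show thesis
  proof
    assume "u $ 1 \<noteq> 0"
    then have "v = (v $ 1 / u $ 1) *\<^sub>R u"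
      using assms(1) by (simp add: vec_eq_iff forall_2 det2_def field_simps)
    then show thesis by (rule that)
  next
    assume "u $ 2 \<noteq> 0"
    then have "v = (v $ 2 / u $ 2) *\<^sub>R u"
      using assms(1) by (simp add: vec_eq_iff forall_2 det2_def field_simps)
    then show thesis by (rule that)
  qed
qed

lemma multiple_of_common_normal:
  fixes a u p :: "real^2"
  assumes "a \<bullet> p = 0" "u \<bullet> p = 0" "p \<noteq> 0" "u \<noteq> 0"
  obtains c where "a = c *\<^sub>R u"
proof -
  have "det2 u a = 0" using det2_inj[of u a p] assms by blast
  then show thesis using det2_eq_0_imp_multiple assms(4) that by blast
qed

lemma multiple_of_common_direction:
  fixes x y u :: "real^2"
  assumes "u \<bullet> x = 0" "u \<bullet> y = 0" "u \<noteq> 0" "y \<noteq> 0"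
  obtains c where "x = c *\<^sub>R y"
  using multiple_of_common_normal[of x u y] assms by (metis inner_commute)

definition edge_normal :: "'a::real_inner \<Rightarrow> 'a set \<Rightarrow> bool" where
  "edge_normal u E \<longleftrightarrow> u \<noteq> 0 \<and> (\<forall>x\<in>E. \<forall>y\<in>E. u \<bullet> x = u \<bullet> y)"

lemma edge_two_points:
  assumes "aff_dim E = 1"
  obtains x y where "x \<in> E" "y \<in> E" "x \<noteq> y"
proof -
  have "E \<noteq> {}" using assms by auto
  then obtain x where x: "x \<in> E" by blast
  have "E \<noteq> {x}" using assms by auto
  then show thesis using x that by blast
qed

text \<open>
A point outside the polygon violates a halfspace that defines a facet, and the facets are the edges. Such
a halfspace bounds a value of some \<open>u \<in> \<Phi>\<close>, up to a factor of either sign.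
\<close>

lemma hull_membership_by_edge_normals:
  fixes S :: "(real^2) set"
  assumes "finite S" "aff_dim S = 2"
    and edges: "\<And>E. E edge_of (convex hull S) \<Longrightarrow> \<exists>u\<in>\<Phi>. edge_normal u E"
    and x: "\<And>u. u \<in> \<Phi> \<Longrightarrow> (\<exists>p\<in>S. u \<bullet> p \<le> u \<bullet> x) \<and> (\<exists>q\<in>S. u \<bullet> x \<le> u \<bullet> q)"
  shows "x \<in> convex hull S"
proof (rule ccontr)
  define P where "P = convex hull S"
  assume "x \<notin> convex hull S"
  then have xP: "x \<notin> P" by (simp add: P_def)
  have dimP: "aff_dim P = 2" using assms(2) by (simp add: P_def aff_dim_convex_hull)
  have affP: "affine hull P = UNIV" using dimP aff_dim_eq_full[of P] by simp
  have "polyhedron P" unfolding P_def using assms(1) by (rule polyhedron_convex_hull)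
  then obtain F where F: "finite F" "P = affine hull P \<inter> \<Inter>F"
    and half: "\<forall>h\<in>F. \<exists>a b. a \<noteq> 0 \<and> h = {x. a \<bullet> x \<le> b}"
    and minimal: "\<And>F'. F' \<subset> F \<Longrightarrow> P \<subset> affine hull P \<inter> \<Inter>F'"
    unfolding polyhedron_Int_affine_minimal by blast
  obtain a where "\<forall>h\<in>F. \<exists>b. a h \<noteq> 0 \<and> h = {x. a h \<bullet> x \<le> b}" using bchoice[OF half] by blast
  then obtain b where ab: "\<And>h. h \<in> F \<Longrightarrow> a h \<noteq> 0 \<and> h = {x. a h \<bullet> x \<le> b h}" using bchoice by metis
  obtain h where h: "h \<in> F" "x \<notin> h" using xP F(2) affP by blast
  define E where "E = P \<inter> {x. a h \<bullet> x = b h}"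
  have "E facet_of P" using facet_of_polyhedron_explicit[OF F ab minimal, of E] h(1) by (auto simp: E_def)
  then have "E face_of P" "aff_dim E = 1" using dimP by (simp_all add: facet_of_def)
  then have "E edge_of (convex hull S)" by (simp add: edge_of_def P_def)
  then obtain u where u: "u \<in> \<Phi>" "edge_normal u E" using edges by blast
  obtain p q where pq: "p \<in> E" "q \<in> E" "p \<noteq> q" using edge_two_points[OF \<open>aff_dim E = 1\<close>] by blast
  have u0: "u \<noteq> 0" and "u \<bullet> p = u \<bullet> q" using u(2) pq unfolding edge_normal_def by blast+
  then have uE: "u \<bullet> (p - q) = 0" by (simp add: inner_diff_right)
  have "a h \<bullet> (p - q) = 0" using pq by (simp add: E_def inner_diff_right)
  then obtain c where c: "a h = c *\<^sub>R u" using multiple_of_common_normal uE u0 pq(3) by (metis right_minus_eq)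
  have inside: "a h \<bullet> s \<le> b h" if "s \<in> S" for s
  proof -
    have "s \<in> P" using that by (simp add: P_def hull_inc)
    then have "s \<in> h" using F(2) h(1) by blast
    then show ?thesis using ab[OF h(1)] by blast
  qed
  have outside: "b h < a h \<bullet> x"
  proof (rule ccontr)
    assume "\<not> b h < a h \<bullet> x"
    then have "x \<in> {x. a h \<bullet> x \<le> b h}" by simp
    then show False using h(2) ab[OF h(1)] by metis
  qed
  obtain s t where st: "s \<in> S" "u \<bullet> s \<le> u \<bullet> x" "t \<in> S" "u \<bullet> x \<le> u \<bullet> t" using x[OF u(1)] by blast
  have "c * (u \<bullet> x) \<le> c * (u \<bullet> t) \<or> c * (u \<bullet> x) \<le> c * (u \<bullet> s)"
    using st mult_left_mono[of "u \<bullet> x" "u \<bullet> t" c] mult_left_mono_neg[of "u \<bullet> s" "u \<bullet> x" c] by linarith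
  then show False using inside[OF st(1)] inside[OF st(3)] outside by (auto simp: c)
qed

lemma lattice_convex_hull:
  assumes "lattice_convex L S" "x \<in> convex hull S" "x \<in> L"
  shows "x \<in> S"
proof -
  obtain C where C: "convex C" "S = C \<inter> L" using assms(1) by (auto simp: lattice_convex_def)
  then have "convex hull S \<subseteq> C" by (intro hull_minimal) auto
  then show ?thesis using C assms by blast
qed

text \<open>
Unless it is empty, such a set consists of the lattice points of a segment whose endpoints belong to the
lattice.
\<close>

lemma collinear_lattice_convex_symmetric:
  fixes S :: "'a::euclidean_space set"
  assumes L: "additive_subgroup L" and S: "S \<subseteq> L" "finite S" "lattice_convex L S" and dim: "aff_dim S \<le> 1"
  shows "centrally_symmetric S"
proof (cases "S = {}")
  case True
  then show ?thesis by (simp add: centrally_symmetric_def)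
next
  case False
  have "compact (convex hull S)" using S(2) by (simp add: finite_imp_compact_convex_hull)
  moreover have "collinear (convex hull S)" using dim by (simp add: collinear_aff_dim aff_dim_convex_hull)
  ultimately obtain a b where ab: "convex hull S = closed_segment a b"
    using compact_convex_collinear_segment False by (metis convex_convex_hull convex_hull_eq_empty)
  have "a extreme_point_of (convex hull S)" "b extreme_point_of (convex hull S)"
    unfolding ab by (simp_all add: extreme_point_of_segment)
  then have abS: "a \<in> S" "b \<in> S" by (simp_all add: extreme_point_of_convex_hull)
  show ?thesis
  proof (rule centrally_symmetricI[of _ "a + b"])
    fix t assume t: "t \<in> S"
    then have "t \<in> closed_segment a b" using ab hull_inc by metis
    then obtain r where "0 \<le> r" "r \<le> 1" "t = (1 - r) *\<^sub>R a + r *\<^sub>R b" by (auto simp: in_segment)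
    then have "a + b - t \<in> closed_segment a b"
      unfolding in_segment by (intro exI[of _ "1 - r"]) (auto simp: algebra_simps)
    moreover have "a + b - t \<in> L" using abS t S(1) additive_subgroup_closed[OF L] by (meson subsetD)
    ultimately show "a + b - t \<in> S" using lattice_convex_hull[OF S(3)] ab by simp
  qed
qed

text \<open>
The polygon is a parallelogram. Two opposite vertices belong to \<open>S\<close> and hence to the lattice, so the
reflection that exchanges them preserves both the polygon and the lattice.
\<close>

lemma parallelogram_symmetric:
  fixes S :: "(real^2) set"
  assumes L: "additive_subgroup L" and S: "S \<subseteq> L" "finite S" "lattice_convex L S" and dim: "aff_dim S = 2"
    and uv: "det2 u v \<noteq> 0"
    and edges: "\<And>E. E edge_of (convex hull S) \<Longrightarrow> edge_normal u E \<or> edge_normal v E"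
  shows "centrally_symmetric S"
proof -
  have "S \<noteq> {}" using dim by auto
  note extremes = inner_extremes[OF S(2) \<open>S \<noteq> {}\<close>]
  obtain pu qu where u: "pu \<in> S" "qu \<in> S" "\<And>s. s \<in> S \<Longrightarrow> u \<bullet> pu \<le> u \<bullet> s \<and> u \<bullet> s \<le> u \<bullet> qu" using extremes[of u] by blast
  obtain pv qv where v: "pv \<in> S" "qv \<in> S" "\<And>s. s \<in> S \<Longrightarrow> v \<bullet> pv \<le> v \<bullet> s \<and> v \<bullet> s \<le> v \<bullet> qv" using extremes[of v] by blast
  have hull: "x \<in> convex hull S" if "u \<bullet> pu \<le> u \<bullet> x" "u \<bullet> x \<le> u \<bullet> qu" "v \<bullet> pv \<le> v \<bullet> x" "v \<bullet> x \<le> v \<bullet> qv" for x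
    by (rule hull_membership_by_edge_normals[OF S(2) dim, of "{u, v}"]) (use edges that u v in blast)+
  have corner: "\<exists>x\<in>S. u \<bullet> x = u \<bullet> a \<and> v \<bullet> x = v \<bullet> b"
    if a: "a \<in> S" "(\<forall>s\<in>S. \<sigma> * (u \<bullet> a) \<le> \<sigma> * (u \<bullet> s))" and b: "b \<in> S" "(\<forall>s\<in>S. \<sigma> * (v \<bullet> b) \<le> \<sigma> * (v \<bullet> s))"
      and \<sigma>: "\<sigma> \<noteq> 0" for a b and \<sigma> :: real
  proof -
    obtain x where x: "u \<bullet> x = u \<bullet> a" "v \<bullet> x = v \<bullet> b" using det2_solve[OF uv] by blast
    have xP: "x \<in> convex hull S" by (rule hull) (use x a b u v in auto)
    have half: "w \<bullet> y = w \<bullet> x"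
      if w: "\<forall>s\<in>S. \<sigma> * (w \<bullet> x) \<le> \<sigma> * (w \<bullet> s)" and "y \<in> convex hull S" "z \<in> convex hull S"
        and seg: "x = (1 - r) *\<^sub>R y + r *\<^sub>R z" "0 < r" "r < 1" for w y z r
    proof -
      have "convex hull S \<subseteq> {s. (\<sigma> *\<^sub>R w) \<bullet> s \<ge> \<sigma> * (w \<bullet> x)}"
        by (intro hull_minimal convex_halfspace_ge) (use w in auto)
      then have yz: "\<sigma> * (w \<bullet> x) \<le> \<sigma> * (w \<bullet> y)" "\<sigma> * (w \<bullet> x) \<le> \<sigma> * (w \<bullet> z)" using that(2,3) by auto
      have "\<sigma> * (w \<bullet> x) = (1 - r) * (\<sigma> * (w \<bullet> y)) + r * (\<sigma> * (w \<bullet> z))"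
        by (subst seg(1)) (simp add: inner_add_right algebra_simps)
      then have "(1 - r) * (\<sigma> * (w \<bullet> y) - \<sigma> * (w \<bullet> x)) + r * (\<sigma> * (w \<bullet> z) - \<sigma> * (w \<bullet> x)) = 0"
        by (simp add: algebra_simps)
      moreover have "0 \<le> r * (\<sigma> * (w \<bullet> z) - \<sigma> * (w \<bullet> x))" "0 \<le> (1 - r) * (\<sigma> * (w \<bullet> y) - \<sigma> * (w \<bullet> x))"
        using yz seg by simp_all
      ultimately have "(1 - r) * (\<sigma> * (w \<bullet> y) - \<sigma> * (w \<bullet> x)) = 0" by linarith
      then show ?thesis using seg \<sigma> by simp
    qed
    have "x extreme_point_of (convex hull S)"
      unfolding extreme_point_of_def
    proof (intro conjI ballI notI xP)
      fix y z assume yz: "y \<in> convex hull S" "z \<in> convex hull S" "x \<in> open_segment y z"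
      then obtain r where r: "0 < r" "r < 1" "x = (1 - r) *\<^sub>R y + r *\<^sub>R z" "y \<noteq> z" by (auto simp: in_segment)
      have "u \<bullet> y = u \<bullet> x" "v \<bullet> y = v \<bullet> x"
        using half[OF _ yz(1,2) r(3,1,2)] a b x by simp_all
      then have "y - x = 0" using det2_inj[OF uv, of "y - x"] by (simp add: inner_diff_right)
      moreover have "r *\<^sub>R (z - y) = x - y" by (subst r(3)) (simp add: algebra_simps)
      ultimately show False using r(1,4) by auto
    qed
    then show ?thesis using x extreme_point_of_convex_hull by blast
  qed
  obtain p where p: "p \<in> S" "u \<bullet> p = u \<bullet> pu" "v \<bullet> p = v \<bullet> pv" using corner[of pu 1 pv] u v by auto
  obtain q where q: "q \<in> S" "u \<bullet> q = u \<bullet> qu" "v \<bullet> q = v \<bullet> qv" using corner[of qu "-1" qv] u v by auto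
  show ?thesis
  proof (rule centrally_symmetricI[of _ "p + q"])
    fix t assume t: "t \<in> S"
    have "p + q - t \<in> convex hull S"
      by (rule hull) (use p q u(3)[OF t] v(3)[OF t] in \<open>auto simp: inner_diff_right inner_add_right\<close>)
    moreover have "p + q - t \<in> L" using p q t S(1) additive_subgroup_closed[OF L] by (meson subsetD)
    ultimately show "p + q - t \<in> S" using lattice_convex_hull[OF S(3)] by blast
  qed
qed

lemma parallel_to_of_normal:
  fixes b u :: "real^2"
  assumes dim: "aff_dim E = 1" and normal: "edge_normal u E" and b: "u \<bullet> b = 0" "b \<noteq> 0"
  shows "parallel_to E b"
proof -
  obtain x where x: "x \<in> E" using edge_two_points[OF dim] by blast
  define K where "K = (+) x ` span {b}"
  have u0: "u \<noteq> 0" using normal by (simp add: edge_normal_def)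
  have "E \<subseteq> K"
  proof
    fix y assume y: "y \<in> E"
    then have "u \<bullet> y = u \<bullet> x" using normal x unfolding edge_normal_def by blast
    then have "u \<bullet> (y - x) = 0" by (simp add: inner_diff_right)
    then obtain c where "y - x = c *\<^sub>R b" using multiple_of_common_direction[OF _ b(1) u0 b(2)] by blast
    then have "y = x + c *\<^sub>R b" by (simp add: algebra_simps)
    then show "y \<in> K" unfolding K_def by (simp add: span_base span_mul)
  qed
  moreover have affK: "affine K"
    unfolding K_def using affine_translation subspace_imp_affine subspace_span by blast
  ultimately have sub: "affine hull E \<subseteq> K" by (rule hull_minimal)
  have "aff_dim K = aff_dim (span {b})" unfolding K_def by (rule aff_dim_translation_eq)
  also have "\<dots> = 1" using b(2) by (simp add: aff_dim_subspace)
  finally have "affine hull E = K"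
    using affine_dim_equal[OF _ affK _ sub] dim x by (auto simp: aff_dim_affine_hull)
  then show ?thesis
    unfolding parallel_to_def K_def using affine_parallel_commute[of "span {b}" "affine hull E"]
    by (auto simp: affine_parallel_def)
qed

lemma normal_of_parallel_to:
  fixes b u :: "'a::euclidean_space"
  assumes "parallel_to E b" "u \<bullet> b = 0" "u \<noteq> 0"
  shows "edge_normal u E"
proof -
  obtain a where a: "span {b} = (\<lambda>x. a + x) ` (affine hull E)"
    using assms(1) unfolding parallel_to_def affine_parallel_def by blast
  have "u \<bullet> x = - (u \<bullet> a)" if "x \<in> E" for x
  proof -
    have "a + x \<in> span {b}" unfolding a using that by (simp add: hull_inc)
    then obtain c where "a + x = c *\<^sub>R b" by (auto simp: span_singleton)
    then have "u \<bullet> (a + x) = 0" using assms(2) by simp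
    then show ?thesis by (simp add: inner_add_right)
  qed
  then show ?thesis using assms(3) unfolding edge_normal_def by simp
qed

lemma lattice_basis_pair_iff:
  fixes x y :: "real^2"
  shows "lattice_basis [x, y] G \<longleftrightarrow>
    det2 x y \<noteq> 0 \<and> G = {of_int i *\<^sub>R x + of_int j *\<^sub>R y | i j. True}"
proof -
  have "det2 x y \<noteq> 0 \<longleftrightarrow> distinct [x, y] \<and> independent (set [x, y])"
  proof
    assume det: "det2 x y \<noteq> 0"
    then have "x \<noteq> y" "y \<noteq> 0" by (auto simp: det2_def)
    moreover have "x \<notin> span {y}"
    proof
      assume "x \<in> span {y}"
      then obtain c where "x = c *\<^sub>R y" by (auto simp: span_singleton)
      then show False using det by (simp add: det2_def)
    qed
    ultimately show "distinct [x, y] \<and> independent (set [x, y])" by (simp add: independent_insert)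
  next
    assume ind: "distinct [x, y] \<and> independent (set [x, y])"
    then have "y \<notin> span {x}" "x \<noteq> 0"
      using independent_insert[of y "{x}"] by (auto simp: insert_commute dependent_zero)
    then show "det2 x y \<noteq> 0" using det2_eq_0_imp_multiple by (metis span_base span_mul singletonI)
  qed
  moreover have "{(\<Sum>i<length [x, y]. of_int (z i) *\<^sub>R [x, y] ! i) | z :: nat \<Rightarrow> int. True} =
      {of_int i *\<^sub>R x + of_int j *\<^sub>R y | i j. True}"
  proof -
    have "\<exists>z::nat \<Rightarrow> int. of_int i *\<^sub>R x + of_int j *\<^sub>R y = of_int (z 0) *\<^sub>R x + of_int (z 1) *\<^sub>R y" for i j
      by (intro exI[of _ "\<lambda>n. if n = 0 then i else j"]) simp
    then show ?thesis by (auto simp: lessThan_Suc add.commute)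
  qed
  ultimately show ?thesis unfolding lattice_basis_def by auto
qed

lemma direct_iff:
  fixes X Y :: "'a::plus set"
  shows "direct X Y \<longleftrightarrow> (\<forall>x\<in>X. \<forall>x'\<in>X. \<forall>y\<in>Y. \<forall>y'\<in>Y. x + y = x' + y' \<longrightarrow> x = x' \<and> y = y')"
proof
  assume d: "direct X Y"
  show "\<forall>x\<in>X. \<forall>x'\<in>X. \<forall>y\<in>Y. \<forall>y'\<in>Y. x + y = x' + y' \<longrightarrow> x = x' \<and> y = y'"
  proof (intro ballI impI)
    fix x x' y y' assume m: "x \<in> X" "x' \<in> X" "y \<in> Y" "y' \<in> Y" and eq: "x + y = x' + y'"
    have "\<exists>!p. p \<in> X \<times> Y \<and> x + y = fst p + snd p" using d m unfolding direct_def by (blast intro: set_plus_intro)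
    then have "(x, y) = (x', y')" using m eq by (elim ex1E) (metis SigmaI fst_conv snd_conv)
    then show "x = x' \<and> y = y'" by simp
  qed
next
  assume h: "\<forall>x\<in>X. \<forall>x'\<in>X. \<forall>y\<in>Y. \<forall>y'\<in>Y. x + y = x' + y' \<longrightarrow> x = x' \<and> y = y'"
  show "direct X Y"
    unfolding direct_def
  proof
    fix z assume "z \<in> X + Y"
    then obtain x y where xy: "x \<in> X" "y \<in> Y" "z = x + y" by (auto simp: set_plus_def)
    show "\<exists>!p. p \<in> X \<times> Y \<and> z = fst p + snd p"
    proof (rule ex1I[of _ "(x, y)"])
      fix p assume "p \<in> X \<times> Y \<and> z = fst p + snd p"
      then show "p = (x, y)" using h xy by (metis mem_Times_iff prod.collapse)
    qed (use xy in simp)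
  qed
qed

lemma lattice_span_subgroup:
  fixes x y :: "'a::real_vector"
  shows "additive_subgroup {of_int i *\<^sub>R x + of_int j *\<^sub>R y | i j. True}"
  unfolding additive_subgroup_def
proof (intro conjI ballI)
  show "0 \<in> {of_int i *\<^sub>R x + of_int j *\<^sub>R y | i j. True}"
    by (auto intro!: exI[of _ 0])
  fix p q assume "p \<in> {of_int i *\<^sub>R x + of_int j *\<^sub>R y | i j. True}" "q \<in> {of_int i *\<^sub>R x + of_int j *\<^sub>R y | i j. True}"
  then obtain i j i' j' where pq: "p = of_int i *\<^sub>R x + of_int j *\<^sub>R y" "q = of_int i' *\<^sub>R x + of_int j' *\<^sub>R y" by blast
  have "p - q = of_int (i - i') *\<^sub>R x + of_int (j - j') *\<^sub>R y" unfolding pq by (simp add: algebra_simps)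
  then show "p - q \<in> {of_int i *\<^sub>R x + of_int j *\<^sub>R y | i j. True}" by blast
qed

section \<open>Edges of the summand are narrow directions\<close>

locale planar_tile = lattice_tile M L T for M L T :: "(real^2) set" +
  fixes b1 b2 :: "real^2"
  assumes b_det: "det2 b1 b2 \<noteq> 0"
    and L_eq: "L = {of_int i *\<^sub>R b1 + of_int j *\<^sub>R b2 | i j. True}"
begin

definition primitive_narrow :: "real^2 \<Rightarrow> bool" where
  "primitive_narrow u \<longleftrightarrow> narrow u \<and> (\<exists>l\<in>L. u \<bullet> l = 1)"

lemma L_obtain:
  assumes "l \<in> L" obtains i j where "l = of_int i *\<^sub>R b1 + of_int j *\<^sub>R b2"
  using assms unfolding L_eq by blast

lemma L_comb: "of_int i *\<^sub>R b1 + of_int j *\<^sub>R b2 \<in> L"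
  unfolding L_eq by blast

text \<open>
A vector \<open>w \<in> L\<close> in the kernel of \<open>a\<close> makes the values of \<open>a\<close> at the basis vectors
commensurable, so the values on \<open>L\<close> form a group generated by one number \<open>\<kappa>\<close>.
\<close>

lemma primitive_normal_exists:
  assumes a: "a \<noteq> 0" and w: "w \<in> L" "w \<noteq> 0" "a \<bullet> w = 0"
  obtains c where "0 < c" "\<And>l. l \<in> L \<Longrightarrow> (c *\<^sub>R a) \<bullet> l \<in> \<int>" "\<exists>l\<in>L. (c *\<^sub>R a) \<bullet> l = 1"
proof -
  obtain w1 w2 where w_eq: "w = of_int w1 *\<^sub>R b1 + of_int w2 *\<^sub>R b2" using L_obtain[OF w(1)] by blast
  define d where "d = gcd w1 w2"
  have "w1 \<noteq> 0 \<or> w2 \<noteq> 0" using w(2) w_eq by auto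
  then have d: "d \<noteq> 0" by (simp add: d_def)
  obtain p q where pq: "w1 = d * p" "w2 = d * q" by (metis d_def dvdE gcd_dvd1 gcd_dvd2)
  obtain i j where "i * w1 + j * w2 = d" using bezout_int[of w1 w2] by (auto simp: d_def)
  then have "d * (i * p + j * q) = d * 1" unfolding pq by (simp add: algebra_simps)
  then have bezout: "i * p + j * q = 1" using d by (simp only: mult_cancel_left) simp
  define \<alpha> where "\<alpha> = a \<bullet> b1"
  define \<beta> where "\<beta> = a \<bullet> b2"
  have "of_int d * (of_int p * \<alpha> + of_int q * \<beta>) = 0"
    using w(3) unfolding w_eq pq by (simp add: inner_add_right \<alpha>_def \<beta>_def algebra_simps)
  then have rel: "of_int p * \<alpha> + of_int q * \<beta> = 0" using d by simp
  define \<kappa> where "\<kappa> = of_int j * \<alpha> - of_int i * \<beta>"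
  have bez: "of_int i * of_int p + of_int j * of_int q = (1::real)"
    using bezout by (metis of_int_1 of_int_add of_int_mult)
  have \<alpha>\<beta>: "\<alpha> = of_int q * \<kappa>" "\<beta> = - of_int p * \<kappa>"
    using bez rel unfolding \<kappa>_def by algebra+
  have "\<kappa> \<noteq> 0"
  proof
    assume "\<kappa> = 0"
    then have "a \<bullet> b1 = 0" "a \<bullet> b2 = 0" using \<alpha>\<beta> by (simp_all add: \<alpha>_def \<beta>_def)
    then show False using det2_inj[OF b_det, of a] a by (simp add: inner_commute)
  qed
  define c where "c = 1 / \<bar>\<kappa>\<bar>"
  have c_sgn: "c * \<kappa> = sgn \<kappa>" by (simp add: c_def sgn_if abs_if)
  have sgn_int: "sgn \<kappa> \<in> \<int>" by (simp add: sgn_if)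
  show thesis
  proof
    show "0 < c" using \<open>\<kappa> \<noteq> 0\<close> by (simp add: c_def)
    fix l assume "l \<in> L"
    then obtain m n where "l = of_int m *\<^sub>R b1 + of_int n *\<^sub>R b2" by (rule L_obtain)
    then have "(c *\<^sub>R a) \<bullet> l = of_int m * of_int q * (c * \<kappa>) - of_int n * of_int p * (c * \<kappa>)"
      using \<alpha>\<beta> by (simp add: inner_add_right \<alpha>_def \<beta>_def algebra_simps)
    then show "(c *\<^sub>R a) \<bullet> l \<in> \<int>" using sgn_int unfolding c_sgn by simp
  next
    define s :: int where "s = (if \<kappa> > 0 then 1 else -1)"
    have s: "of_int s * sgn \<kappa> = 1" using \<open>\<kappa> \<noteq> 0\<close> by (simp add: s_def)
    have "(c *\<^sub>R a) \<bullet> (of_int (s * j) *\<^sub>R b1 + of_int (- s * i) *\<^sub>R b2) = of_int s * (c * \<kappa>)"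
      by (simp add: inner_add_right \<kappa>_def \<alpha>_def \<beta>_def algebra_simps)
    then show "\<exists>l\<in>L. (c *\<^sub>R a) \<bullet> l = 1" using L_comb s c_sgn by metis
  qed
qed

lemma kernel_generator:
  assumes int: "\<And>l. l \<in> L \<Longrightarrow> u \<bullet> l \<in> \<int>" and e: "e \<in> L" "u \<bullet> e = 1"
  obtains g where "g \<in> L" "u \<bullet> g = 0" "\<And>l. l \<in> L \<Longrightarrow> u \<bullet> l = 0 \<Longrightarrow> \<exists>n::int. l = of_int n *\<^sub>R g"
proof -
  have "b1 \<in> L" "b2 \<in> L" using L_comb[of 1 0] L_comb[of 0 1] by simp_all
  then obtain \<alpha> \<beta> where \<alpha>\<beta>: "u \<bullet> b1 = of_int \<alpha>" "u \<bullet> b2 = of_int \<beta>" using int by (meson Ints_cases)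
  have val: "u \<bullet> (of_int m *\<^sub>R b1 + of_int n *\<^sub>R b2) = of_int (m * \<alpha> + n * \<beta>)" for m n
    using \<alpha>\<beta> by (simp add: inner_add_right)
  obtain i j where "e = of_int i *\<^sub>R b1 + of_int j *\<^sub>R b2" using L_obtain[OF e(1)] by blast
  then have "of_int (i * \<alpha> + j * \<beta>) = (of_int 1 :: real)" using e(2) val by simp
  then have bezout: "i * \<alpha> + j * \<beta> = 1" by (simp only: of_int_eq_iff)
  show thesis
  proof
    show "of_int (- \<beta>) *\<^sub>R b1 + of_int \<alpha> *\<^sub>R b2 \<in> L" by (rule L_comb)
    show "u \<bullet> (of_int (- \<beta>) *\<^sub>R b1 + of_int \<alpha> *\<^sub>R b2) = 0" unfolding val by simp
    fix l assume l: "l \<in> L" "u \<bullet> l = 0"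
    obtain m n where mn: "l = of_int m *\<^sub>R b1 + of_int n *\<^sub>R b2" using L_obtain[OF l(1)] by blast
    then have "of_int (m * \<alpha> + n * \<beta>) = (of_int 0 :: real)" using l(2) val by simp
    then have rel: "m * \<alpha> + n * \<beta> = 0" by (simp only: of_int_eq_iff)
    define k where "k = n * i - m * j"
    have mk: "m = k * (- \<beta>)" "n = k * \<alpha>" using bezout rel unfolding k_def by algebra+
    have "l = of_int k *\<^sub>R (of_int (- \<beta>) *\<^sub>R b1 + of_int \<alpha> *\<^sub>R b2)"
      unfolding mn mk by (simp add: scaleR_right_diff_distrib)
    then show "\<exists>n::int. l = of_int n *\<^sub>R (of_int (- \<beta>) *\<^sub>R b1 + of_int \<alpha> *\<^sub>R b2)" by blast
  qed
qed

text \<open>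
The kernel of \<open>u\<close> in \<open>L\<close> is generated by one vector \<open>g\<close>. If \<open>|v \<bullet> g| \<ge> 2\<close>, the kernel
contains no nonzero vector with value less than 2, and \<open>T\<close> would be symmetric.
\<close>

lemma dual_basis_of_narrow_pair:
  assumes u: "primitive_narrow u" and v: "narrow v" and uv: "det2 u v \<noteq> 0" and asym: "\<not> centrally_symmetric T"
  obtains e f where "dual_basis u v e f"
proof -
  have nu: "narrow u" using u by (simp add: primitive_narrow_def)
  obtain e0 where e0: "e0 \<in> L" "u \<bullet> e0 = 1" using u by (auto simp: primitive_narrow_def)
  obtain g where g: "g \<in> L" "u \<bullet> g = 0" and gen: "\<And>l. l \<in> L \<Longrightarrow> u \<bullet> l = 0 \<Longrightarrow> \<exists>n::int. l = of_int n *\<^sub>R g"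
    using kernel_generator[OF narrowD(1)[OF nu] e0] by blast
  obtain D where D: "v \<bullet> g = of_int D" using narrowD(1)[OF v g(1)] by (auto elim: Ints_cases)
  have "\<bar>D\<bar> < 2"
  proof (rule ccontr)
    assume "\<not> \<bar>D\<bar> < 2"
    have sep: "l = 0" if l: "l \<in> L" "u \<bullet> l = 0" "\<bar>v \<bullet> l\<bar> < 2" for l
    proof -
      obtain n :: int where n: "l = of_int n *\<^sub>R g" using gen l by blast
      then have "\<bar>real_of_int (n * D)\<bar> < 2" using l(3) D by simp
      then have "\<bar>n\<bar> * \<bar>D\<bar> < 2" by (simp add: abs_mult flip: of_int_abs of_int_mult)
      moreover have "\<bar>n\<bar> * 2 \<le> \<bar>n\<bar> * \<bar>D\<bar>" using \<open>\<not> \<bar>D\<bar> < 2\<close> by (intro mult_left_mono) auto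
      ultimately have "n = 0" by simp
      then show ?thesis using n by simp
    qed
    have "\<exists>c. \<forall>t\<in>T. c - t \<in> T"
    proof (rule narrow_pair_reflection[OF finite_T T_nonempty narrowD(2)[OF nu] narrowD(2)[OF v] _ narrowD(1)[OF nu] sep])
      fix r s t assume "r \<in> T" "s \<in> T" "t \<in> T"
      then have "r + s - t \<in> M" using T_subset M_closed by (meson subsetD)
      then show "\<exists>l\<in>L. \<exists>t'\<in>T. r + s - t = l + t'" by (rule tile)
    qed
    then show False using asym centrally_symmetricI by blast
  qed
  moreover have "D \<noteq> 0"
  proof
    assume "D = 0"
    then have "g = 0" using det2_inj[OF uv g(2)] D by simp
    then have kernel: "l = 0" if "l \<in> L" "u \<bullet> l = 0" for l using gen[OF that] by auto
    have "b1 \<in> L" "b2 \<in> L" using L_comb[of 1 0] L_comb[of 0 1] by simp_all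
    then obtain a1 a2 where a12: "u \<bullet> b1 = of_int a1" "u \<bullet> b2 = of_int a2"
      using narrowD(1)[OF nu] by (meson Ints_cases)
    have zero: "of_int (- a2) *\<^sub>R b1 + of_int a1 *\<^sub>R b2 = 0"
      by (rule kernel[OF L_comb]) (simp add: inner_add_right inner_diff_right a12)
    obtain p where p: "b1 \<bullet> p = 1" "b2 \<bullet> p = 0" using det2_solve[OF b_det] by blast
    obtain q where q: "b1 \<bullet> q = 0" "b2 \<bullet> q = 1" using det2_solve[OF b_det] by blast
    have "a2 = 0" using arg_cong[OF zero, of "\<lambda>x. x \<bullet> p"] p by (simp add: inner_add_left inner_diff_left)
    moreover have "a1 = 0" using arg_cong[OF zero, of "\<lambda>x. x \<bullet> q"] q by (simp add: inner_add_left inner_diff_left)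
    ultimately have "b1 \<bullet> u = 0" "b2 \<bullet> u = 0"
      using a12 by (simp_all add: inner_commute)
    then have "u = 0" using det2_inj[OF b_det] by blast
    then show False using e0 by simp
  qed
  ultimately have "D = 1 \<or> D = -1" by linarith
  define f where "f = of_int D *\<^sub>R g"
  have f: "f \<in> L" "u \<bullet> f = 0" "v \<bullet> f = 1"
    using additive_subgroup_scale_int[OF subgroup_L g(1)] g(2) D \<open>D = 1 \<or> D = -1\<close> by (auto simp: f_def)
  define e where "e = e0 - (v \<bullet> e0) *\<^sub>R f"
  have e: "e \<in> L" "u \<bullet> e = 1" "v \<bullet> e = 0"
    using additive_subgroup_scale_int[OF subgroup_L f(1) narrowD(1)[OF v e0(1)]] e0 f L_closed(2)
    by (auto simp: e_def inner_diff_right)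
  have "x = (u \<bullet> x) *\<^sub>R e + (v \<bullet> x) *\<^sub>R f" for x
  proof -
    have "x - ((u \<bullet> x) *\<^sub>R e + (v \<bullet> x) *\<^sub>R f) = 0"
      by (rule det2_inj[OF uv]) (simp_all add: inner_diff_right inner_add_right e f)
    then show ?thesis by simp
  qed
  then have "dual_basis u v e f" using e f by (simp add: dual_basis_def)
  then show thesis by (rule that)
qed

text \<open>
The kernel of \<open>u\<close> in \<open>L\<close> is generated by \<open>f\<close>. As \<open>u, w\<close> are coordinates of \<open>L\<close> as well,
\<open>w\<close> must take the value 1 on a multiple of \<open>f\<close>.
\<close>

lemma dual_basis_second_coefficient:
  assumes u: "primitive_narrow u" and v: "narrow v" and w: "narrow w" "det2 u w \<noteq> 0"
    and asym: "\<not> centrally_symmetric T" and dual: "dual_basis u v e f"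
  shows "\<bar>w \<bullet> f\<bar> = 1"
proof -
  obtain e' f' where "dual_basis u w e' f'" using dual_basis_of_narrow_pair[OF u w asym] by blast
  then have f': "f' \<in> L" "u \<bullet> f' = 0" "w \<bullet> f' = 1" by (auto simp: dual_basis_def)
  have f: "f \<in> L" using dual by (simp add: dual_basis_def)
  have "f' = (u \<bullet> f') *\<^sub>R e + (v \<bullet> f') *\<^sub>R f" using dual unfolding dual_basis_def by blast
  then have "f' = (v \<bullet> f') *\<^sub>R f" using f'(2) by simp
  then have prod: "(v \<bullet> f') * (w \<bullet> f) = 1" using f'(3) by (metis inner_scaleR_right)
  obtain m where m: "w \<bullet> f = of_int m" using narrowD(1)[OF w(1) f] by (auto elim: Ints_cases)
  obtain n where n: "v \<bullet> f' = of_int n" using narrowD(1)[OF v f'(1)] by (auto elim: Ints_cases)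
  have "of_int (n * m) = (of_int 1 :: real)" using prod m n by simp
  then have "n * m = 1" by (simp only: of_int_eq_iff)
  then have "m = 1 \<or> m = -1" using zmult_eq_1_iff[of n m] by auto
  then show ?thesis using m by auto
qed

lemma dual_basis_swap: "dual_basis u v e f \<Longrightarrow> dual_basis v u f e"
  unfolding dual_basis_def by (metis add.commute)

lemma primitive_narrow_nonzero: "primitive_narrow u \<Longrightarrow> u \<noteq> 0"
  unfolding primitive_narrow_def by (metis inner_zero_left zero_neq_one)

lemma narrow_triple_primitive:
  assumes "narrow_triple u v w" shows "primitive_narrow u"
  using assms unfolding narrow_triple_def dual_basis_def primitive_narrow_def by blast

lemma det2_commute_neq: "det2 u v \<noteq> 0 \<Longrightarrow> det2 v u \<noteq> 0"
  by (simp add: det2_def algebra_simps)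

text \<open>
In terms of the coordinates \<open>u, v\<close> of \<open>L\<close> the third functional has coefficients \<open>1\<close> or
\<open>-1\<close>, because it forms a pair of coordinates with each of them.
\<close>

lemma narrow_triple_exists:
  assumes u: "primitive_narrow u" and v: "primitive_narrow v" and w: "primitive_narrow w"
    and det: "det2 u v \<noteq> 0" "det2 u w \<noteq> 0" "det2 v w \<noteq> 0"
    and asym: "\<not> centrally_symmetric T"
  obtains u' v' w' where "narrow_triple u' v' w'"
proof -
  have nu: "narrow u" and nv: "narrow v" and nw: "narrow w" using u v w by (simp_all add: primitive_narrow_def)
  obtain e f where dual: "dual_basis u v e f" using dual_basis_of_narrow_pair[OF u nv det(1) asym] by blast
  define p where "p = w \<bullet> e"
  define q where "q = w \<bullet> f"
  have "\<bar>q\<bar> = 1" unfolding q_def by (rule dual_basis_second_coefficient[OF u nv nw det(2) asym dual])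
  moreover have "\<bar>p\<bar> = 1" unfolding p_def
    by (rule dual_basis_second_coefficient[OF v nu nw det(3) asym dual_basis_swap[OF dual]])
  ultimately have p: "p = 1 \<or> p = -1" and q: "q = 1 \<or> q = -1" by linarith+
  have w_eq: "w = p *\<^sub>R u + q *\<^sub>R v"
  proof -
    have "w \<bullet> x = (p *\<^sub>R u + q *\<^sub>R v) \<bullet> x" for x
    proof -
      have "x = (u \<bullet> x) *\<^sub>R e + (v \<bullet> x) *\<^sub>R f" using dual unfolding dual_basis_def by blast
      then have "w \<bullet> x = (u \<bullet> x) * (w \<bullet> e) + (v \<bullet> x) * (w \<bullet> f)"
        by (metis inner_add_right inner_scaleR_right)
      then show ?thesis by (simp add: p_def q_def inner_add_left algebra_simps)
    qed
    then have "\<forall>x. w \<bullet> x = (p *\<^sub>R u + q *\<^sub>R v) \<bullet> x" ..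
    then show ?thesis by (simp only: vector_eq_rdot)
  qed
  have scaled: "narrow (r *\<^sub>R x)" if "r = 1 \<or> r = -1" "narrow x" for r :: real and x
    using that narrow_uminus by auto
  have "x = ((p *\<^sub>R u) \<bullet> x) *\<^sub>R (p *\<^sub>R e) + ((q *\<^sub>R v) \<bullet> x) *\<^sub>R (q *\<^sub>R f)" for x
  proof -
    have "x = (u \<bullet> x) *\<^sub>R e + (v \<bullet> x) *\<^sub>R f" using dual unfolding dual_basis_def by blast
    then show ?thesis using p q by auto
  qed
  then have "dual_basis (p *\<^sub>R u) (q *\<^sub>R v) (p *\<^sub>R e) (q *\<^sub>R f)"
    using dual p q L_closed(3) unfolding dual_basis_def by auto
  then have "narrow_triple (p *\<^sub>R u) (q *\<^sub>R v) (- w)"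
    unfolding narrow_triple_def using scaled[OF p nu] scaled[OF q nv] narrow_uminus[OF nw] w_eq by auto
  then show thesis by (rule that)
qed

text \<open>
Otherwise \<open>g\<close> would form a pair of coordinates with each of \<open>u, v, w\<close>. Its values at \<open>e\<close>, \<open>f\<close> and
\<open>e - f\<close> would all be \<open>1\<close> or \<open>-1\<close>, which parity forbids.
\<close>

lemma narrow_parallel_to_triple:
  assumes triple: "narrow_triple u v w" and g: "primitive_narrow g" and asym: "\<not> centrally_symmetric T"
  shows "det2 g u = 0 \<or> det2 g v = 0 \<or> det2 g w = 0"
proof (rule ccontr)
  assume contra: "\<not> (det2 g u = 0 \<or> det2 g v = 0 \<or> det2 g w = 0)"
  then have det: "det2 u g \<noteq> 0" "det2 v g \<noteq> 0" "det2 w g \<noteq> 0" using det2_commute_neq by blast+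
  have ng: "narrow g" using g by (simp add: primitive_narrow_def)
  have nu: "narrow u" and nv: "narrow v" and sum0: "u + v + w = 0"
    using triple by (simp_all add: narrow_triple_def)
  obtain e f where dual: "dual_basis u v e f" using triple by (auto simp: narrow_triple_def)
  note vwu = narrow_triple_rotate[OF triple]
  note wuv = narrow_triple_rotate[OF vwu]
  have ef: "e \<in> L" "f \<in> L" "u \<bullet> e = 1" "u \<bullet> f = 0" "v \<bullet> e = 0" "v \<bullet> f = 1" using dual by (auto simp: dual_basis_def)
  have w_eq: "w = - u - v" using sum0 by (simp add: eq_neg_iff_add_eq_0 algebra_simps)
  have dual': "dual_basis w u (- f) (e - f)"
  proof -
    have "x = (w \<bullet> x) *\<^sub>R (- f) + (u \<bullet> x) *\<^sub>R (e - f)" for x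
    proof -
      have "x = (u \<bullet> x) *\<^sub>R e + (v \<bullet> x) *\<^sub>R f" using dual unfolding dual_basis_def by blast
      also have "\<dots> = (w \<bullet> x) *\<^sub>R (- f) + (u \<bullet> x) *\<^sub>R (e - f)"
        unfolding w_eq by (simp add: inner_diff_left algebra_simps)
      finally show ?thesis .
    qed
    then show ?thesis using ef L_closed unfolding dual_basis_def w_eq
      by (simp add: inner_diff_left inner_diff_right)
  qed
  have "\<bar>g \<bullet> f\<bar> = 1"
    by (rule dual_basis_second_coefficient[OF narrow_triple_primitive[OF triple] nv ng det(1) asym dual])
  moreover have "\<bar>g \<bullet> e\<bar> = 1"
    by (rule dual_basis_second_coefficient[OF narrow_triple_primitive[OF vwu] nu ng det(2) asym dual_basis_swap[OF dual]])
  moreover have "\<bar>g \<bullet> (e - f)\<bar> = 1"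
    by (rule dual_basis_second_coefficient[OF narrow_triple_primitive[OF wuv] nu ng det(3) asym dual'])
  ultimately show False by (auto simp: inner_diff_right abs_if split: if_splits)
qed

text \<open>
Suppose that \<open>T\<close> contains \<open>t1, t2\<close> with \<open>u \<bullet> t2 - u \<bullet> t1 \<ge> 1\<close>. The edge and the segment from \<open>t1\<close>
to \<open>t2\<close> span a parallelogram in \<open>conv (S + T)\<close>, so each chord parallel to the edge is a translate of
the segment from \<open>s0\<close> to \<open>s1\<close> and meets, on its line, every coset of the multiples of \<open>s1 - s0\<close>. Some chord thus contains
\<open>t1 + l\<close> for some \<open>l \<in> L\<close> that lies beyond the edge. By convexity \<open>t1 + l\<close> is in \<open>S + T\<close>, and by
uniqueness of representations \<open>l \<in> S\<close>, a contradiction.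
\<close>

lemma edge_normal_narrow:
  assumes S: "S \<subseteq> L" "finite S" "aff_dim S = 2" and convex: "lattice_convex M (S + T)"
    and E: "E edge_of (convex hull S)"
  obtains u where "primitive_narrow u" "edge_normal u E"
proof -
  define P where "P = convex hull S"
  have E_face: "E face_of P" and E_dim: "aff_dim E = 1" using E by (simp_all add: edge_of_def P_def)
  have "polyhedron P" unfolding P_def using S(2) by (rule polyhedron_convex_hull)
  then have "E exposed_face_of P" using E_face exposed_face_of_polyhedron by blast
  then obtain a b where ab: "P \<subseteq> {x. a \<bullet> x \<le> b}" "E = P \<inter> {x. a \<bullet> x = b}" unfolding exposed_face_of_def by blast
  obtain S' where S': "S' \<subseteq> S" "E = convex hull S'"
    using face_of_convex_hull_subset E_face S(2) unfolding P_def by (metis finite_imp_compact)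
  have "aff_dim S' = 1" using E_dim unfolding S'(2) aff_dim_convex_hull .
  then obtain s0 s1 where s01: "s0 \<in> S'" "s1 \<in> S'" "s0 \<noteq> s1" using edge_two_points by blast
  then have sS: "s0 \<in> S" "s1 \<in> S" and sE: "s0 \<in> E" "s1 \<in> E" using S' by (auto simp: hull_inc)
  have "a \<noteq> 0"
  proof
    assume "a = 0"
    then have "E = P" using ab(2) sE(1) by auto
    then show False using E_dim S(3) unfolding P_def by (simp add: aff_dim_convex_hull)
  qed
  define w where "w = s1 - s0"
  have w: "w \<in> L" "w \<noteq> 0" "a \<bullet> w = 0"
    using sS S(1) s01(3) sE L_closed(2) unfolding w_def ab(2) by (auto simp: inner_diff_right)
  obtain c where c: "0 < c" "\<And>l. l \<in> L \<Longrightarrow> (c *\<^sub>R a) \<bullet> l \<in> \<int>" "\<exists>l\<in>L. (c *\<^sub>R a) \<bullet> l = 1"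
    using primitive_normal_exists[OF \<open>a \<noteq> 0\<close> w] by blast
  define u where "u = c *\<^sub>R a"
  obtain l1 where l1: "l1 \<in> L" "u \<bullet> l1 = 1" using c(3) unfolding u_def by blast
  have u0: "u \<noteq> 0" using l1 by auto
  have uw: "u \<bullet> w = 0" using w(3) by (simp add: u_def)
  have top: "u \<bullet> s \<le> u \<bullet> s0" if "s \<in> S" for s
  proof -
    have "a \<bullet> s \<le> b" "a \<bullet> s0 = b" using that ab sE(1) unfolding P_def by (auto dest: hull_inc)
    then show ?thesis using c(1) by (simp add: u_def)
  qed
  have width: "u \<bullet> t2 - u \<bullet> t1 < 1" if t: "t2 \<in> T" "t1 \<in> T" for t1 t2
  proof (rule ccontr)
    assume wide: "\<not> u \<bullet> t2 - u \<bullet> t1 < 1"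
    define j where "j = \<lfloor>u \<bullet> t2 - u \<bullet> t1\<rfloor>"
    have j: "1 \<le> j" "of_int j \<le> u \<bullet> t2 - u \<bullet> t1" using wide by (simp_all add: j_def le_floor_iff)
    \<comment> \<open>The point \<open>tq\<close> divides the segment so that \<open>s0 + tq\<close> is on the level of \<open>m\<close>.\<close>
    define lam where "lam = of_int j / (u \<bullet> t2 - u \<bullet> t1)"
    have lam: "0 \<le> lam" "lam \<le> 1" "lam * (u \<bullet> t2 - u \<bullet> t1) = of_int j"
      using j wide by (simp_all add: lam_def)
    define m where "m = t1 + s0 + of_int j *\<^sub>R l1"
    define tq where "tq = (1 - lam) *\<^sub>R t1 + lam *\<^sub>R t2"
    have "u \<bullet> tq = u \<bullet> t1 + lam * (u \<bullet> t2 - u \<bullet> t1)" by (simp add: tq_def inner_add_right algebra_simps)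
    then have "u \<bullet> (m - (s0 + tq)) = 0" using lam(3) l1(2)
      by (simp add: m_def inner_diff_right inner_add_right)
    then obtain r where r: "m - (s0 + tq) = r *\<^sub>R w" using multiple_of_common_direction[OF _ uw u0 w(2)] by blast
    define n where "n = - \<lfloor>r\<rfloor>"
    have \<theta>: "0 \<le> r + of_int n" "r + of_int n \<le> 1" unfolding n_def by linarith+
    have m_eq: "m + of_int n *\<^sub>R w = (s0 + (r + of_int n) *\<^sub>R w) + tq"
      using r by (simp add: algebra_simps)
    have "s0 + (r + of_int n) *\<^sub>R w = (1 - (r + of_int n)) *\<^sub>R s0 + (r + of_int n) *\<^sub>R s1"
      by (simp add: w_def algebra_simps)
    also have "\<dots> \<in> convex hull S"
      by (rule convexD_alt) (use sS \<theta> in \<open>auto simp: hull_inc\<close>)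
    finally have "s0 + (r + of_int n) *\<^sub>R w \<in> convex hull S" .
    moreover have "tq \<in> convex hull T"
      unfolding tq_def by (rule convexD_alt) (use t lam in \<open>auto simp: hull_inc\<close>)
    ultimately have "m + of_int n *\<^sub>R w \<in> convex hull (S + T)"
      unfolding m_eq convex_hull_set_plus by (rule set_plus_intro)
    moreover have mL: "s0 + of_int j *\<^sub>R l1 + of_int n *\<^sub>R w \<in> L"
      using sS(1) S(1) L_closed(4) additive_subgroup_scale_int[OF subgroup_L] l1(1) w(1) by (simp add: subset_iff)
    then have "m + of_int n *\<^sub>R w \<in> M"
      using M_closed(4)[of t1 "s0 + of_int j *\<^sub>R l1 + of_int n *\<^sub>R w"] t(2) T_subset L_subset
      by (auto simp: m_def algebra_simps)
    ultimately have "m + of_int n *\<^sub>R w \<in> S + T" using lattice_convex_hull[OF convex] by blast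
    then obtain s t where st: "s \<in> S" "t \<in> T" "m + of_int n *\<^sub>R w = s + t" by (auto simp: set_plus_def)
    then have eq: "t - t1 = s0 + of_int j *\<^sub>R l1 + of_int n *\<^sub>R w - s" by (simp add: m_def algebra_simps)
    then have "t - t1 \<in> L" using L_closed(2)[OF mL] st(1) S(1) by auto
    then have "t = t1" using tile_unique st(2) t(2) by blast
    then have "s = s0 + of_int j *\<^sub>R l1 + of_int n *\<^sub>R w" using eq by simp
    then have "u \<bullet> s = u \<bullet> s0 + of_int j" using l1(2) uw by (simp add: inner_add_right)
    then show False using top[OF st(1)] j(1) by simp
  qed
  have "primitive_narrow u"
    unfolding primitive_narrow_def narrow_def using c(2) l1 width by (auto simp: u_def)
  moreover have "edge_normal u E"
    using u0 unfolding edge_normal_def ab(2) by (simp add: u_def)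
  ultimately show thesis by (rule that)
qed

end

context lattice_tile
begin

lemma direct_summand: "S \<subseteq> L \<Longrightarrow> direct S T"
  unfolding direct_iff
proof (intro ballI impI)
  fix x x' y y' assume S: "S \<subseteq> L" "x \<in> S" "x' \<in> S" and y: "y \<in> T" "y' \<in> T" and eq: "x + y = x' + y'"
  have "y - y' = x' - x" using eq by (simp add: algebra_simps)
  then have "y - y' \<in> L" using S L_closed(2) by auto
  then have "y = y'" using tile_unique y by blast
  then show "x = x' \<and> y = y'" using eq by simp
qed

lemma reflected_tile: "lattice_tile M L (uminus ` T)"
proof
  show "\<exists>l\<in>L. \<exists>t\<in>uminus ` T. m = l + t" if m: "m \<in> M" for m
  proof -
    obtain l t where lt: "l \<in> L" "t \<in> T" "- m = l + t" using tile[OF M_closed(3)[OF m]] by blast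
    then have "m = - l + - t" by (metis minus_add_distrib minus_minus)
    then show ?thesis using lt L_closed(3) by blast
  qed
  show "s = t" if st: "s \<in> uminus ` T" "t \<in> uminus ` T" "s - t \<in> L" for s t
  proof -
    obtain s' t' where s't': "s = - s'" "t = - t'" "s' \<in> T" "t' \<in> T" using st by blast
    then have "t' - s' \<in> L" using st(3) by simp
    then show ?thesis using tile_unique s't' by blast
  qed
qed (use subgroup_M subgroup_L L_subset T_subset finite_T T_nonempty M_closed(3) in auto)

lemma reflected_narrow: "narrow u \<Longrightarrow> lattice_tile.narrow L (uminus ` T) u"
  unfolding lattice_tile.narrow_def[OF reflected_tile] narrow_def by auto

text \<open>
If \<open>x \<in> L\<close> lies in \<open>conv S\<close>, then \<open>x + t\<close> lies in \<open>conv (S + T)\<close>, and the representation of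
\<open>x + t\<close> is unique.
\<close>

lemma summand_lattice_convex:
  assumes S: "S \<subseteq> L" and convex: "lattice_convex M (S + T)"
  shows "lattice_convex L S"
proof -
  have "convex hull S \<inter> L = S"
  proof (intro equalityI subsetI)
    fix x assume "x \<in> convex hull S \<inter> L"
    then have x: "x \<in> convex hull S" "x \<in> L" by blast+
    obtain t where t: "t \<in> T" using T_nonempty by blast
    have "x + t \<in> convex hull (S + T)"
      unfolding convex_hull_set_plus using x t by (intro set_plus_intro) (auto simp: hull_inc)
    moreover have "x + t \<in> M" using x t L_subset T_subset M_closed(4) by blast
    ultimately have "x + t \<in> S + T" using lattice_convex_hull[OF convex] by blast
    then obtain s t' where st: "s \<in> S" "t' \<in> T" "x + t = s + t'" by (auto simp: set_plus_def)
    then have "x - s = t' - t" by (simp add: algebra_simps)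
    then have "t' - t \<in> L" using x st(1) S L_closed(2) by (metis subsetD)
    then have "t' = t" using tile_unique st t by blast
    then show "x \<in> S" using st by simp
  qed (use S in \<open>auto simp: hull_inc\<close>)
  then show ?thesis unfolding lattice_convex_def by (intro exI[of _ "convex hull S"]) auto
qed

text \<open>
\<open>S + T\<close> consists of all points of \<open>M\<close> that lie in the strips of \<open>S\<close> widened by the extreme values on
\<open>T\<close>. Indeed if \<open>l + t\<close> lies in a widened strip, then \<open>u \<bullet> l\<close> exceeds the bounds of \<open>S\<close>, if at all, by
less than 1; both are integers, so \<open>l\<close> lies in the strip of \<open>S\<close>.
\<close>

lemma sum_lattice_convex:
  assumes S: "S \<subseteq> L" "finite S" "S \<noteq> {}" and \<Phi>: "\<And>u. u \<in> \<Phi> \<Longrightarrow> narrow u"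
    and S_strips: "\<And>x. x \<in> L \<Longrightarrow> (\<And>u. u \<in> \<Phi> \<Longrightarrow> (\<exists>p\<in>S. u \<bullet> p \<le> u \<bullet> x) \<and> (\<exists>q\<in>S. u \<bullet> x \<le> u \<bullet> q)) \<Longrightarrow> x \<in> S"
  shows "lattice_convex M (S + T)"
proof -
  define lo where "lo u = Min ((\<lambda>x. u \<bullet> x) ` (S + T))" for u
  define hi where "hi u = Max ((\<lambda>x. u \<bullet> x) ` (S + T))" for u
  have fin: "finite (S + T)" using S finite_T by (simp add: finite_set_plus)
  have ne: "S + T \<noteq> {}" using S(3) T_nonempty by (auto simp: set_plus_def)
  define C where "C = (\<Inter>u\<in>\<Phi>. {x. u \<bullet> x \<ge> lo u} \<inter> {x. u \<bullet> x \<le> hi u})"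
  have "convex C"
    unfolding C_def by (intro convex_INT convex_Int convex_halfspace_ge convex_halfspace_le)
  moreover have "S + T = C \<inter> M"
  proof (intro equalityI subsetI)
    fix x assume x: "x \<in> S + T"
    then have "lo u \<le> u \<bullet> x" "u \<bullet> x \<le> hi u" for u using fin by (simp_all add: lo_def hi_def)
    moreover have "x \<in> M"
    proof -
      obtain s t where "s \<in> S" "t \<in> T" "x = s + t" using x by (auto simp: set_plus_def)
      then show ?thesis using S(1) L_subset T_subset M_closed(4) by blast
    qed
    ultimately show "x \<in> C \<inter> M" by (simp add: C_def)
  next
    fix m assume m: "m \<in> C \<inter> M"
    then obtain l t where lt: "l \<in> L" "t \<in> T" "m = l + t" using tile by blast
    have "l \<in> S"
    proof (rule S_strips[OF lt(1)])
      fix u assume u: "u \<in> \<Phi>"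
      have bounds: "lo u \<le> u \<bullet> l + u \<bullet> t" "u \<bullet> l + u \<bullet> t \<le> hi u"
        using m u lt(3) by (auto simp: C_def inner_add_right)
      have "lo u \<in> (\<lambda>x. u \<bullet> x) ` (S + T)" unfolding lo_def using fin ne by (intro Min_in) auto
      then obtain s1 t1 where lo: "s1 \<in> S" "t1 \<in> T" "lo u = u \<bullet> s1 + u \<bullet> t1"
        by (auto simp: set_plus_def inner_add_right)
      have "hi u \<in> (\<lambda>x. u \<bullet> x) ` (S + T)" unfolding hi_def using fin ne by (intro Max_in) auto
      then obtain s2 t2 where hi: "s2 \<in> S" "t2 \<in> T" "hi u = u \<bullet> s2 + u \<bullet> t2"
        by (auto simp: set_plus_def inner_add_right)
      obtain n n1 n2 where n: "u \<bullet> l = of_int n" "u \<bullet> s1 = of_int n1" "u \<bullet> s2 = of_int n2"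
        using narrowD(1)[OF \<Phi>[OF u]] lt(1) lo(1) hi(1) S(1) by (metis Ints_cases subsetD)
      have "real_of_int n1 < real_of_int (n + 1)" "real_of_int n < real_of_int (n2 + 1)"
        using bounds lo hi n narrowD(2)[OF \<Phi>[OF u] lt(2) lo(2)] narrowD(2)[OF \<Phi>[OF u] hi(2) lt(2)] by simp_all
      then have "u \<bullet> s1 \<le> u \<bullet> l" "u \<bullet> l \<le> u \<bullet> s2" using n by simp_all
      then show "(\<exists>p\<in>S. u \<bullet> p \<le> u \<bullet> l) \<and> (\<exists>q\<in>S. u \<bullet> l \<le> u \<bullet> q)" using lo(1) hi(1) by blast
    qed
    then show "m \<in> S + T" using lt by blast
  qed
  ultimately show ?thesis unfolding lattice_convex_def by blast
qed

end

context planar_tile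
begin

text \<open>
If no three narrow normals were pairwise nonparallel, all edges would have one of two directions and the
polygon would be a parallelogram.
\<close>

lemma three_edge_normals:
  assumes S: "S \<subseteq> L" "finite S" "aff_dim S = 2" "lattice_convex L S" "\<not> centrally_symmetric S"
    and edges: "\<And>E. E edge_of (convex hull S) \<Longrightarrow> \<exists>u. primitive_narrow u \<and> edge_normal u E"
  obtains u v w where "primitive_narrow u" "primitive_narrow v" "primitive_narrow w"
    "det2 u v \<noteq> 0" "det2 u w \<noteq> 0" "det2 v w \<noteq> 0"
proof (rule ccontr)
  assume contra: "\<not> thesis"
  note conclude = that
  have none: False if "primitive_narrow u" "primitive_narrow v" "primitive_narrow w"
    "det2 u v \<noteq> 0" "det2 u w \<noteq> 0" "det2 v w \<noteq> 0" for u v w using contra conclude[OF that] by blast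
  have transfer: "edge_normal u E" if g: "edge_normal g E" and par: "det2 u g = 0" and u: "u \<noteq> 0" for u g E
  proof -
    have "det2 g u = 0" using par by (simp add: det2_def mult.commute)
    then obtain c where "u = c *\<^sub>R g" using det2_eq_0_imp_multiple g unfolding edge_normal_def by blast
    moreover have "\<forall>x\<in>E. \<forall>y\<in>E. g \<bullet> x = g \<bullet> y" using g unfolding edge_normal_def by blast
    ultimately show ?thesis using u unfolding edge_normal_def by (metis inner_scaleR_left)
  qed
  have "\<exists>u v. det2 u v \<noteq> 0 \<and> (\<forall>g. primitive_narrow g \<longrightarrow> det2 u g = 0 \<or> det2 v g = 0)"
  proof (cases "\<exists>u v. primitive_narrow u \<and> primitive_narrow v \<and> det2 u v \<noteq> 0")
    case True
    then show ?thesis using none by blast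
  next
    case False
    show ?thesis
    proof (cases "\<exists>u. primitive_narrow u")
      case True
      then obtain u where u: "primitive_narrow u" by blast
      \<comment> \<open>All narrow normals are parallel to \<open>u\<close>, and any other direction may serve as the second one.\<close>
      define v :: "real^2" where "v = vector [- u $ 2, u $ 1]"
      have "det2 u v = u \<bullet> u" by (simp add: v_def det2_def inner_real2 vector_2)
      then have "det2 u v \<noteq> 0" using primitive_narrow_nonzero[OF u] by simp
      then show ?thesis using False u by blast
    next
      case False
      have "det2 b1 b2 \<noteq> 0" by (rule b_det)
      then show ?thesis using False by blast
    qed
  qed
  then obtain u v where uv: "det2 u v \<noteq> 0" "\<And>g. primitive_narrow g \<Longrightarrow> det2 u g = 0 \<or> det2 v g = 0" by blast
  have "u \<noteq> 0" "v \<noteq> 0" using uv(1) by (auto simp: det2_def)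
  have "edge_normal u E \<or> edge_normal v E" if "E edge_of (convex hull S)" for E
    using edges[OF that] uv(2) transfer \<open>u \<noteq> 0\<close> \<open>v \<noteq> 0\<close> by blast
  then have "centrally_symmetric S"
    using parallelogram_symmetric[OF subgroup_L S(1,2,4,3) uv(1)] by blast
  then show False using S(5) by blast
qed

text \<open>
The basis vectors in the normal form are \<open>b1 = f\<close> and \<open>b2 = e\<close>, the basis of \<open>L\<close> dual to two of the
functionals, so that \<open>b1\<close>, \<open>b2\<close> and \<open>b2 - b1\<close> span the kernels of the three functionals.
\<close>

lemma normal_form_of_convex_sum:
  assumes S: "S \<subseteq> L" "finite S" "\<not> centrally_symmetric S" and T_asym: "\<not> centrally_symmetric T"
    and convex: "lattice_convex M (S + T)"
  shows "\<exists>k::nat. k \<ge> 1 \<and>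
       (\<exists>a1 a2 b1 b2. lattice_basis [a1, a2] M \<and> lattice_basis [b1, b2] L \<and>
          (b1 = real (k + 1) *\<^sub>R a1 - a2 \<and> b2 = real k *\<^sub>R a1 + a2) \<and>
          (\<exists>v\<in>M. T + {v} = multiples (real ` {0..k}) a1 \<union> (multiples (real ` {0..k - 1}) a1 + {a2})) \<and>
          (\<not> centrally_symmetric S \<and> finite S \<and> aff_dim S = 2 \<and> lattice_convex L S \<and>
           (\<forall>E. E edge_of (convex hull S) \<longrightarrow>
              parallel_to E b1 \<or> parallel_to E b2 \<or> parallel_to E (b2 - b1))))"
proof -
  have S_convex: "lattice_convex L S" by (rule summand_lattice_convex[OF S(1) convex])
  have "\<not> aff_dim S \<le> 1" using collinear_lattice_convex_symmetric[OF subgroup_L S(1,2) S_convex] S(3) by blast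
  moreover have "aff_dim S \<le> 2" using aff_dim_le_DIM[of S] by simp
  ultimately have dim: "aff_dim S = 2" by linarith
  have edges: "\<exists>u. primitive_narrow u \<and> edge_normal u E" if "E edge_of (convex hull S)" for E
    using edge_normal_narrow[OF S(1,2) dim convex that] by blast
  obtain g1 g2 g3 where g: "primitive_narrow g1" "primitive_narrow g2" "primitive_narrow g3"
    "det2 g1 g2 \<noteq> 0" "det2 g1 g3 \<noteq> 0" "det2 g2 g3 \<noteq> 0"
    by (rule three_edge_normals[OF S(1,2) dim S_convex S(3) edges])
  obtain h1 h2 h3 where "narrow_triple h1 h2 h3" by (rule narrow_triple_exists[OF g T_asym])
  then obtain u v w where triple: "narrow_triple u v w" and trapezoid: "trapezoid_tile u v"
    by (rule narrow_triple_dichotomy[OF _ T_asym])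
  obtain k e f a t0 where k: "1 \<le> k" and dual: "dual_basis u v e f"
    and a: "real (2 * k + 1) * (u \<bullet> a) = 1" "real (2 * k + 1) * (v \<bullet> a) = 1" "a \<in> M"
    and M_gen: "\<And>m. m \<in> M \<Longrightarrow> \<exists>i j. m = of_int i *\<^sub>R a + of_int j *\<^sub>R f" and t0: "t0 \<in> T"
    and T_eq: "T + {- t0} = multiples (real ` {0..k}) a \<union> (multiples (real ` {0..k - 1}) a + {real (k + 1) *\<^sub>R a - f})"
    using trapezoid unfolding trapezoid_tile_def by blast
  have e: "e \<in> L" "u \<bullet> e = 1" "v \<bullet> e = 0" and f: "f \<in> L" "u \<bullet> f = 0" "v \<bullet> f = 1"
    using dual by (auto simp: dual_basis_def)
  have narrow_uv: "narrow u" "narrow v" and sum0: "u + v + w = 0" using triple by (auto simp: narrow_triple_def)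
  define a2 where "a2 = real (k + 1) *\<^sub>R a - f"
  have ef: "e + f = real (2 * k + 1) *\<^sub>R a"
    by (rule dual_basis_eqI[OF dual]) (use a e f in \<open>simp_all add: inner_add_right\<close>)
  have b1: "f = real (k + 1) *\<^sub>R a - a2" by (simp add: a2_def)
  have "real (2 * k + 1) = real k + real (k + 1)" by simp
  then have "e + f = real k *\<^sub>R a + real (k + 1) *\<^sub>R a" using ef by (simp only: scaleR_left_distrib)
  then have b2: "e = real k *\<^sub>R a + a2" unfolding a2_def by (metis add_diff_cancel_right' add_diff_eq)
  have a_nz: "a \<noteq> 0" and f_nz: "f \<noteq> 0" and e_nz: "e \<noteq> 0" and ef_nz: "e - f \<noteq> 0" using a e f by auto
  have "det2 a a2 \<noteq> 0"
  proof
    assume "det2 a a2 = 0"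
    then obtain c where "a2 = c *\<^sub>R a" using det2_eq_0_imp_multiple a_nz by blast
    then have f_eq: "f = (real (k + 1) - c) *\<^sub>R a" unfolding b1 by (simp add: scaleR_left_diff_distrib)
    then have "(real (k + 1) - c) * (u \<bullet> a) = 0" using f(2) by (metis inner_scaleR_right)
    then have "real (k + 1) - c = 0" using a(1) by auto
    then show False using f_eq f_nz by simp
  qed
  moreover have "M = {of_int i *\<^sub>R a + of_int j *\<^sub>R a2 | i j. True}"
  proof (intro equalityI subsetI)
    fix m assume "m \<in> M"
    then obtain i j where "m = of_int i *\<^sub>R a + of_int j *\<^sub>R f" using M_gen by blast
    then have "m = of_int (i + j * (int k + 1)) *\<^sub>R a + of_int (- j) *\<^sub>R a2"
      by (simp add: a2_def algebra_simps)
    then show "m \<in> {of_int i *\<^sub>R a + of_int j *\<^sub>R a2 | i j. True}" by blast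
  next
    fix m assume "m \<in> {of_int i *\<^sub>R a + of_int j *\<^sub>R a2 | i j. True}"
    moreover have "a2 \<in> M"
      unfolding a2_def using additive_subgroup_scale_int[OF subgroup_M a(3)] f(1) L_subset M_closed(2) by auto
    ultimately show "m \<in> M" using additive_subgroup_scale_int[OF subgroup_M] a(3) M_closed(4) by auto
  qed
  ultimately have M_basis: "lattice_basis [a, a2] M" by (simp add: lattice_basis_pair_iff)
  have "det2 f e \<noteq> 0"
  proof
    assume "det2 f e = 0"
    then obtain c where "e = c *\<^sub>R f" using det2_eq_0_imp_multiple f_nz by blast
    then show False using e(2) f(2) by simp
  qed
  moreover have "L = {of_int i *\<^sub>R f + of_int j *\<^sub>R e | i j. True}"
  proof (intro equalityI subsetI)
    fix l assume l: "l \<in> L"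
    obtain i j where "u \<bullet> l = of_int i" "v \<bullet> l = of_int j"
      using narrowD(1)[OF narrow_uv(1) l] narrowD(1)[OF narrow_uv(2) l] by (meson Ints_cases)
    moreover have "l = (u \<bullet> l) *\<^sub>R e + (v \<bullet> l) *\<^sub>R f" using dual unfolding dual_basis_def by blast
    ultimately have "l = of_int j *\<^sub>R f + of_int i *\<^sub>R e" by (simp add: add.commute)
    then show "l \<in> {of_int i *\<^sub>R f + of_int j *\<^sub>R e | i j. True}" by blast
  next
    fix l assume "l \<in> {of_int i *\<^sub>R f + of_int j *\<^sub>R e | i j. True}"
    then show "l \<in> L" using additive_subgroup_scale_int[OF subgroup_L] e(1) f(1) L_closed(4) by auto
  qed
  ultimately have L_basis: "lattice_basis [f, e] L" by (simp add: lattice_basis_pair_iff)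
  have directions: "parallel_to E f \<or> parallel_to E e \<or> parallel_to E (e - f)"
    if E: "E edge_of (convex hull S)" for E
  proof -
    have E_dim: "aff_dim E = 1" using E by (simp add: edge_of_def)
    obtain g where g: "primitive_narrow g" "edge_normal g E" using edges[OF E] by blast
    have parallel: "parallel_to E b" if par: "det2 g h = 0" and h: "h \<noteq> 0" "h \<bullet> b = 0" and b: "b \<noteq> 0" for h b
    proof -
      have "det2 h g = 0" using par by (simp add: det2_def mult.commute)
      then obtain c where "g = c *\<^sub>R h" using det2_eq_0_imp_multiple h(1) by blast
      then have "g \<bullet> b = 0" using h(2) by simp
      then show ?thesis using parallel_to_of_normal[OF E_dim g(2)] b by blast
    qed
    have w_eq: "w = - u - v" using sum0 by (simp add: eq_neg_iff_add_eq_0 algebra_simps)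
    have "u \<noteq> 0" "v \<noteq> 0" using e(2) f(3) by auto
    moreover have "w \<noteq> 0" using e unfolding w_eq by (metis diff_zero inner_diff_left inner_minus_left inner_zero_left neg_equal_0_iff_equal zero_neq_one)
    moreover have "w \<bullet> (e - f) = 0" using e f by (simp add: w_eq inner_diff_left inner_diff_right)
    ultimately show ?thesis
      using narrow_parallel_to_triple[OF triple g(1) T_asym] parallel f(2) e(3) f_nz e_nz ef_nz by blast
  qed
  have "- t0 \<in> M" using t0 T_subset M_closed(3) by blast
  then have "\<exists>v\<in>M. T + {v} = multiples (real ` {0..k}) a \<union> (multiples (real ` {0..k - 1}) a + {a2})"
    using T_eq[folded a2_def] by blast
  then show ?thesis
    using k M_basis L_basis b1 b2 S(2,3) dim S_convex directions by blast
qed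

end

section \<open>Homometry of direct sums\<close>

text \<open>
A pair of points \<open>s + t\<close> and \<open>s' + t'\<close> with difference \<open>u\<close> corresponds to the pair \<open>s - t'\<close>
and \<open>s' - t\<close>, which has the same difference; directness of \<open>S + (- T)\<close> makes this injective.
\<close>

lemma covariogram_reflected_summand_le:
  fixes S T :: "'a::ab_group_add set"
  assumes d: "direct S (uminus ` T)" and fin: "finite S" "finite T"
  shows "covariogram (S + T) u \<le> covariogram (S + uminus ` T) u"
proof -
  define A where "A = (S + T) \<inter> (\<lambda>x. x + u) ` (S + T)"
  define A' where "A' = (S + uminus ` T) \<inter> (\<lambda>x. x + u) ` (S + uminus ` T)"
  have "\<forall>x\<in>A. \<exists>s t s' t'. s \<in> S \<and> t \<in> T \<and> s' \<in> S \<and> t' \<in> T \<and> x = s + t \<and> x = s' + t' + u"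
    unfolding A_def by (auto simp: set_plus_def)
  then obtain s t s' t' where f: "\<And>x. x \<in> A \<Longrightarrow> s x \<in> S \<and> t x \<in> T \<and> s' x \<in> S \<and> t' x \<in> T \<and> x = s x + t x \<and> x = s' x + t' x + u"
    by metis
  define \<phi> where "\<phi> x = s x + - t' x" for x
  have cancel: "x = x' \<and> y = y'" if "x \<in> S" "x' \<in> S" "y \<in> T" "y' \<in> T" "x + - y = x' + - y'" for x x' y y'
    using d that unfolding direct_iff by (metis image_eqI minus_minus)
  have partner: "s' x + - t x = s x + - t' x - u" if "x \<in> A" for x
  proof -
    have "s x + t x = s' x + t' x + u" using f[OF that] by metis
    then have "s x + t x - t x - t' x - u = s' x + t' x + u - t x - t' x - u" by simp
    then show ?thesis by (simp add: algebra_simps)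
  qed
  have "inj_on \<phi> A"
  proof (rule inj_onI)
    fix x y assume xy: "x \<in> A" "y \<in> A" "\<phi> x = \<phi> y"
    have st: "s x = s y" "t' x = t' y" using cancel[of "s x" "s y" "t' x" "t' y"] f[OF xy(1)] f[OF xy(2)] xy(3) by (auto simp: \<phi>_def)
    have "s' x + - t x = s' y + - t y" using partner[OF xy(1)] partner[OF xy(2)] st by simp
    then have "t x = t y" using cancel[of "s' x" "s' y" "t x" "t y"] f[OF xy(1)] f[OF xy(2)] by blast
    then show "x = y" using f[OF xy(1)] f[OF xy(2)] st by metis
  qed
  moreover have "\<phi> ` A \<subseteq> A'"
  proof
    fix z assume "z \<in> \<phi> ` A"
    then obtain x where x: "x \<in> A" "z = s x + - t' x" by (auto simp: \<phi>_def)
    have "z = (s' x + - t x) + u" unfolding x(2) partner[OF x(1)] by simp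
    moreover have "s' x + - t x \<in> S + uminus ` T" "s x + - t' x \<in> S + uminus ` T"
      using f[OF x(1)] by (blast intro: set_plus_intro)+
    ultimately show "z \<in> A'" unfolding A'_def using x(2) by (metis IntI image_eqI)
  qed
  moreover have "finite A'" unfolding A'_def using fin by (simp add: finite_set_plus)
  ultimately have "card A \<le> card A'" by (rule card_inj_on_le)
  then show ?thesis by (simp add: covariogram_def A_def A'_def)
qed

lemma homometric_reflected_summand:
  fixes S T :: "'a::ab_group_add set"
  assumes "direct S T" "direct S (uminus ` T)" "finite S" "finite T"
  shows "homometric (S + T) (S + uminus ` T)"
proof -
  have reflect2: "uminus ` uminus ` T = T" by (simp add: image_image)
  have "covariogram (S + uminus ` T) u \<le> covariogram (S + uminus ` uminus ` T) u" for u
    by (rule covariogram_reflected_summand_le) (use assms reflect2 in simp_all)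
  then have "covariogram (S + T) u = covariogram (S + uminus ` T) u" for u
    using covariogram_reflected_summand_le[OF assms(2-4), of u] reflect2 by (simp add: order_antisym)
  then show ?thesis using assms(3,4) unfolding homometric_def by (auto simp: finite_set_plus)
qed

section \<open>Convexity and nontriviality for the normal form\<close>

context planar_tile
begin

text \<open>
In the coordinates \<open>u, v\<close> with respect to \<open>b2, b1\<close> the vector \<open>a1\<close> is \<open>(\<alpha>, \<alpha>)\<close> with
\<open>\<alpha> = 1 / (2 k + 1)\<close>, and the functionals \<open>u\<close>, \<open>v\<close> and \<open>w = - u - v\<close> all spread over
\<open>2 k \<alpha> = 1 - \<alpha>\<close> on \<open>T\<close>.
\<close>

lemma convex_sums_of_normal_form:
  assumes k: "1 \<le> k" and a12: "a1 \<in> M" "a2 \<in> M"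
    and M_gen: "\<And>m. m \<in> M \<Longrightarrow> \<exists>i j. m = of_int i *\<^sub>R a1 + of_int j *\<^sub>R a2"
    and b1: "b1 = real (k + 1) *\<^sub>R a1 - a2" and b2: "b2 = real k *\<^sub>R a1 + a2"
    and v0: "v0 \<in> M" and T_eq: "T + {v0} = multiples (real ` {0..k}) a1 \<union> (multiples (real ` {0..k - 1}) a1 + {a2})"
    and S: "S \<subseteq> L" "finite S" "aff_dim S = 2" "lattice_convex L S" "\<not> centrally_symmetric S"
    and edges: "\<And>E. E edge_of (convex hull S) \<Longrightarrow> parallel_to E b1 \<or> parallel_to E b2 \<or> parallel_to E (b2 - b1)"
  shows "lattice_convex M (S + T)" "lattice_convex M (S + uminus ` T)"
    "\<not> trivially_homometric (S + T) (S + uminus ` T)"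
proof -
  obtain u where "b1 \<bullet> u = 0" "b2 \<bullet> u = 1" using det2_solve[OF b_det] by blast
  then have u: "u \<bullet> b1 = 0" "u \<bullet> b2 = 1" by (simp_all add: inner_commute)
  obtain v where "b1 \<bullet> v = 1" "b2 \<bullet> v = 0" using det2_solve[OF b_det] by blast
  then have v: "v \<bullet> b1 = 1" "v \<bullet> b2 = 0" by (simp_all add: inner_commute)
  define w where "w = - u - v"
  have w: "w \<bullet> x = - (u \<bullet> x) - v \<bullet> x" for x by (simp add: w_def inner_diff_left)
  define \<alpha> where "\<alpha> = u \<bullet> a1"
  have ua2: "u \<bullet> a2 = real (k + 1) * \<alpha>" using u(1) unfolding b1 by (simp add: inner_diff_right \<alpha>_def)
  have "real k * \<alpha> + real (k + 1) * \<alpha> = 1" using u(2) ua2 unfolding b2 by (simp add: inner_add_right \<alpha>_def)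
  then have \<alpha>: "real (2 * k + 1) * \<alpha> = 1" by (simp add: algebra_simps)
  then have "0 < \<alpha>" by (metis zero_less_mult_pos zero_less_one of_nat_0_less_iff less_add_same_cancel2 zero_less_Suc Suc_eq_plus1)
  have va2: "v \<bullet> a2 = - real k * (v \<bullet> a1)" using v(2) unfolding b2 by (simp add: inner_add_right)
  have "real (k + 1) * (v \<bullet> a1) + real k * (v \<bullet> a1) = 1" using v(1) va2 unfolding b1 by (simp add: inner_diff_right)
  then have "real (2 * k + 1) * (v \<bullet> a1) = real (2 * k + 1) * \<alpha>" using \<alpha> by (simp add: algebra_simps)
  then have va1: "v \<bullet> a1 = \<alpha>" by simp
  have val: "u \<bullet> (r *\<^sub>R a1 + s *\<^sub>R a2) = (r + s * real (k + 1)) * \<alpha>" "v \<bullet> (r *\<^sub>R a1 + s *\<^sub>R a2) = (r - s * real k) * \<alpha>" for r s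
    using ua2 va2 va1 by (simp_all add: inner_add_right \<alpha>_def algebra_simps)
  \<comment> \<open>Both rows are put into one form with coefficient 0 or 1 of \<open>a2\<close>.\<close>
  have T_elem: "\<exists>i. (i \<le> k \<and> t + v0 = real i *\<^sub>R a1 + 0 *\<^sub>R a2) \<or> (i + 1 \<le> k \<and> t + v0 = real i *\<^sub>R a1 + 1 *\<^sub>R a2)" if "t \<in> T" for t
  proof -
    have "t + v0 \<in> T + {v0}" using that by (intro set_plus_intro) auto
    then have "t + v0 \<in> multiples (real ` {0..k}) a1 \<union> (multiples (real ` {0..k - 1}) a1 + {a2})"
      by (simp only: T_eq)
    then consider i where "i \<le> k" "t + v0 = real i *\<^sub>R a1" | i where "i \<le> k - 1" "t + v0 = real i *\<^sub>R a1 + a2"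
      by (auto simp: multiples_def set_plus_def)
    then show ?thesis
    proof cases
      case 1 then show ?thesis by (intro exI[of _ i] disjI1) simp
    next
      case 2 then show ?thesis using k by (intro exI[of _ i] disjI2) simp
    qed
  qed
  have T_mem: "x - v0 \<in> T" if "x \<in> T + {v0}" for x using that by (auto simp: set_plus_def)
  have row1: "real i *\<^sub>R a1 - v0 \<in> T" if "i \<le> k" for i
    using that by (intro T_mem) (auto simp: T_eq multiples_def)
  have row2: "real i *\<^sub>R a1 + a2 - v0 \<in> T" if "i + 1 \<le> k" for i
    by (rule T_mem) (use that in \<open>unfold T_eq multiples_def, intro UnI2 set_plus_intro imageI, auto\<close>)
  define p where "p t = t + v0" for t
  have range: "0 \<le> u \<bullet> p t \<and> u \<bullet> p t \<le> real (2 * k) * \<alpha>"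
    "- real k * \<alpha> \<le> v \<bullet> p t \<and> v \<bullet> p t \<le> real k * \<alpha>"
    "- real (2 * k) * \<alpha> \<le> w \<bullet> p t \<and> w \<bullet> p t \<le> 0" if t: "t \<in> T" for t
  proof -
    obtain i where i: "(i \<le> k \<and> p t = real i *\<^sub>R a1 + 0 *\<^sub>R a2) \<or> (i + 1 \<le> k \<and> p t = real i *\<^sub>R a1 + 1 *\<^sub>R a2)"
      using T_elem[OF t] unfolding p_def by blast
    have pos: "a * \<alpha> \<le> b * \<alpha>" if "a \<le> b" for a b :: real using that \<open>0 < \<alpha>\<close> by simp
    have "\<exists>a b. u \<bullet> p t = a * \<alpha> \<and> v \<bullet> p t = b * \<alpha> \<and> 0 \<le> a \<and> a \<le> real (2 * k) \<and> - real k \<le> b \<and> b \<le> real k \<and> 0 \<le> a + b \<and> a + b \<le> real (2 * k)"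
      using i
    proof
      assume "i \<le> k \<and> p t = real i *\<^sub>R a1 + 0 *\<^sub>R a2"
      then show ?thesis using val[of "real i" 0] by (intro exI[of _ "real i"]) auto
    next
      assume "i + 1 \<le> k \<and> p t = real i *\<^sub>R a1 + 1 *\<^sub>R a2"
      then show ?thesis using val[of "real i" 1]
        by (intro exI[of _ "real i + real (k + 1)"] exI[of _ "real i - real k"]) auto
    qed
    then obtain a b where ab: "u \<bullet> p t = a * \<alpha>" "v \<bullet> p t = b * \<alpha>" "0 \<le> a" "a \<le> real (2 * k)" "- real k \<le> b" "b \<le> real k" "0 \<le> a + b" "a + b \<le> real (2 * k)"
      by blast
    have wab: "w \<bullet> p t = - ((a + b) * \<alpha>)" using ab by (simp add: w algebra_simps)
    show "0 \<le> u \<bullet> p t \<and> u \<bullet> p t \<le> real (2 * k) * \<alpha>" using pos[of 0 a] pos[OF ab(4)] ab(1,3) by simp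
    show "- real k * \<alpha> \<le> v \<bullet> p t \<and> v \<bullet> p t \<le> real k * \<alpha>" using pos[OF ab(5)] pos[OF ab(6)] ab(2) by simp
    show "- real (2 * k) * \<alpha> \<le> w \<bullet> p t \<and> w \<bullet> p t \<le> 0" using pos[OF ab(7)] pos[OF ab(8)] wab by simp
  qed
  have small: "real (2 * k) * \<alpha> < 1" using \<alpha> \<open>0 < \<alpha>\<close> by (simp add: algebra_simps)
  have diff: "h \<bullet> s - h \<bullet> t = h \<bullet> p s - h \<bullet> p t" for h s t by (simp add: p_def inner_add_right)
  have "real (2 * k) * \<alpha> = real k * \<alpha> + real k * \<alpha>" by (simp add: algebra_simps)
  then have width: "u \<bullet> s - u \<bullet> t < 1" "v \<bullet> s - v \<bullet> t < 1" "w \<bullet> s - w \<bullet> t < 1" if "s \<in> T" "t \<in> T" for s t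
    using diff[of u s t] diff[of v s t] diff[of w s t] range[OF that(1)] range[OF that(2)] small by linarith+
  have ints: "u \<bullet> l \<in> \<int>" "v \<bullet> l \<in> \<int>" if l: "l \<in> L" for l
  proof -
    obtain i j where "l = of_int i *\<^sub>R b1 + of_int j *\<^sub>R b2" using l by (rule L_obtain)
    then show "u \<bullet> l \<in> \<int>" "v \<bullet> l \<in> \<int>" using u v by (simp_all add: inner_add_right)
  qed
  have narrow: "narrow h" if "h \<in> {u, v, w}" for h
    using that width ints by (auto simp: narrow_def w)
  have nz: "u \<noteq> 0" "v \<noteq> 0" "w \<noteq> 0" using u v w[of b1] by auto
  have S_ne: "S \<noteq> {}" using S(3) by auto
  have strips: "x \<in> S" if x: "x \<in> L" "\<And>h. h \<in> {u, v, w} \<Longrightarrow> (\<exists>p\<in>S. h \<bullet> p \<le> h \<bullet> x) \<and> (\<exists>q\<in>S. h \<bullet> x \<le> h \<bullet> q)" for x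
  proof (rule lattice_convex_hull[OF S(4) _ x(1)])
    show "x \<in> convex hull S"
    proof (rule hull_membership_by_edge_normals[OF S(2,3) _ x(2)])
      fix E assume "E edge_of (convex hull S)"
      then consider "parallel_to E b1" | "parallel_to E b2" | "parallel_to E (b2 - b1)" using edges by blast
      then show "\<exists>h\<in>{u, v, w}. edge_normal h E"
      proof cases
        case 1 then show ?thesis using normal_of_parallel_to[OF 1 u(1) nz(1)] by blast
      next
        case 2 then show ?thesis using normal_of_parallel_to[OF 2 v(2) nz(2)] by blast
      next
        case 3
        have "w \<bullet> (b2 - b1) = 0" using u v by (simp add: w inner_diff_right)
        then show ?thesis using normal_of_parallel_to[OF 3 _ nz(3)] by blast
      qed
    qed
  qed
  show "lattice_convex M (S + T)"
    by (rule sum_lattice_convex[OF S(1,2) S_ne narrow]) (assumption, rule strips)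
  show convex_reflected: "lattice_convex M (S + uminus ` T)"
    by (rule lattice_tile.sum_lattice_convex[OF reflected_tile S(1,2) S_ne reflected_narrow[OF narrow]])
      (assumption, rule strips)
  have "det2 u v \<noteq> 0"
  proof
    assume "det2 u v = 0"
    then obtain c where "v = c *\<^sub>R u" using det2_eq_0_imp_multiple nz(1) by blast
    then show False using u(1) v(1) by simp
  qed
  note uv_inj = det2_inj[OF this]
  have "x = (u \<bullet> x) *\<^sub>R b2 + (v \<bullet> x) *\<^sub>R b1" for x
  proof -
    have "x - ((u \<bullet> x) *\<^sub>R b2 + (v \<bullet> x) *\<^sub>R b1) = 0"
      by (rule uv_inj) (simp_all add: inner_diff_right inner_add_right u v)
    then show ?thesis by simp
  qed
  moreover have "b1 \<in> L" "b2 \<in> L" using L_comb[of 1 0] L_comb[of 0 1] by simp_all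
  ultimately have dual: "dual_basis u v b2 b1" using u v by (simp add: dual_basis_def)
  note S_extremes = inner_extremes[OF S(2) S_ne]
  note T_extremes = inner_extremes[OF finite_T T_nonempty]
  show "\<not> trivially_homometric (S + T) (S + uminus ` T)"
  proof
    assume "trivially_homometric (S + T) (S + uminus ` T)"
    then consider (shift) d where "S + uminus ` T = (\<lambda>x. x + d) ` (S + T)"
      | (reflection) c where "S + uminus ` T = (\<lambda>x. 2 *\<^sub>R c - x) ` (S + T)"
      unfolding trivially_homometric_def by blast
    then show False
    proof cases
      case shift
      have into: "\<exists>s'\<in>S. \<exists>t'\<in>T. s + t + d = s' - t'" if "s \<in> S" "t \<in> T" for s t
      proof -
        have "s + t + d \<in> S + uminus ` T" unfolding shift using that by (intro imageI set_plus_intro)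
        then show ?thesis by (auto simp: set_plus_def)
      qed
      have onto: "\<exists>s'\<in>S. \<exists>t'\<in>T. s - t = s' + t' + d" if "s \<in> S" "t \<in> T" for s t
      proof -
        have "s + - t \<in> S + uminus ` T" using that by (intro set_plus_intro) auto
        then show ?thesis unfolding shift by (auto simp: set_plus_def)
      qed
      have levels: "h \<bullet> d = - (h \<bullet> tmin) - h \<bullet> tmax"
        if t: "tmin \<in> T" "tmax \<in> T" and opt: "\<And>t. t \<in> T \<Longrightarrow> h \<bullet> tmin \<le> h \<bullet> t \<and> h \<bullet> t \<le> h \<bullet> tmax" for h tmin tmax
      proof -
        obtain lo where lo: "lo \<in> S" "\<And>s. s \<in> S \<Longrightarrow> h \<bullet> lo \<le> h \<bullet> s" using S_extremes[of h] by blast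
        obtain s1 t1 where 1: "s1 \<in> S" "t1 \<in> T" "lo + tmin + d = s1 - t1" using into[OF lo(1) t(1)] by blast
        obtain s2 t2 where 2: "s2 \<in> S" "t2 \<in> T" "lo - tmax = s2 + t2 + d" using onto[OF lo(1) t(2)] by blast
        have "h \<bullet> lo + h \<bullet> tmin + h \<bullet> d = h \<bullet> s1 - h \<bullet> t1" "h \<bullet> lo - h \<bullet> tmax = h \<bullet> s2 + h \<bullet> t2 + h \<bullet> d"
          using arg_cong[OF 1(3), of "\<lambda>x. h \<bullet> x"] arg_cong[OF 2(3), of "\<lambda>x. h \<bullet> x"]
          by (simp_all add: inner_add_right inner_diff_right)
        then show ?thesis using lo(2)[OF 1(1)] lo(2)[OF 2(1)] opt[OF 1(2)] opt[OF 2(2)] by linarith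
      qed
      have base: "h \<bullet> (x - v0) \<le> h \<bullet> t \<longleftrightarrow> h \<bullet> x \<le> h \<bullet> p t" "h \<bullet> t \<le> h \<bullet> (x - v0) \<longleftrightarrow> h \<bullet> p t \<le> h \<bullet> x" for h x t
        by (auto simp: p_def inner_diff_right inner_add_right)
      have corners: "u \<bullet> (real 0 *\<^sub>R a1) = 0" "u \<bullet> (real (k - 1) *\<^sub>R a1 + a2) = real (2 * k) * \<alpha>"
        "v \<bullet> (real 0 *\<^sub>R a1 + a2) = - real k * \<alpha>" "v \<bullet> (real k *\<^sub>R a1) = real k * \<alpha>"
        using val[of "real (k - 1)" 1] val[of 0 1] val[of "real k" 0] k by (simp_all add: of_nat_diff algebra_simps)
      have ud: "u \<bullet> d = - (u \<bullet> (real 0 *\<^sub>R a1 - v0)) - u \<bullet> (real (k - 1) *\<^sub>R a1 + a2 - v0)"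
      proof (rule levels)
        show "real 0 *\<^sub>R a1 - v0 \<in> T" by (rule row1) simp
        show "real (k - 1) *\<^sub>R a1 + a2 - v0 \<in> T" by (rule row2) (use k in simp)
        show "u \<bullet> (real 0 *\<^sub>R a1 - v0) \<le> u \<bullet> t \<and> u \<bullet> t \<le> u \<bullet> (real (k - 1) *\<^sub>R a1 + a2 - v0)" if "t \<in> T" for t
          unfolding base corners by (rule range(1)[OF that])
      qed
      have vd: "v \<bullet> d = - (v \<bullet> (real 0 *\<^sub>R a1 + a2 - v0)) - v \<bullet> (real k *\<^sub>R a1 - v0)"
      proof (rule levels)
        show "real 0 *\<^sub>R a1 + a2 - v0 \<in> T" by (rule row2) (use k in simp)
        show "real k *\<^sub>R a1 - v0 \<in> T" by (rule row1) simp
        show "v \<bullet> (real 0 *\<^sub>R a1 + a2 - v0) \<le> v \<bullet> t \<and> v \<bullet> t \<le> v \<bullet> (real k *\<^sub>R a1 - v0)" if "t \<in> T" for t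
          unfolding base corners by (rule range(2)[OF that])
      qed
      \<comment> \<open>Twice \<open>v0\<close> accounts for the position of \<open>T\<close>; the remaining vector \<open>m\<close> would have the
      coordinates \<open>(- 2 k \<alpha>, 0)\<close>, which no element of \<open>M\<close> has.\<close>
      define m where "m = d - 2 *\<^sub>R v0"
      have "u \<bullet> m = - real (2 * k) * \<alpha>" "v \<bullet> m = 0"
        unfolding m_def inner_diff_right ud vd corners by (simp_all add: inner_scaleR_right)
      moreover have "m \<in> M"
      proof -
        obtain s t where st: "s \<in> S" "t \<in> T" using S_ne T_nonempty by blast
        then obtain s' t' where s't': "s' \<in> S" "t' \<in> T" "s + t + d = s' - t'" using into by blast
        then have "d = s' - t' - (s + t)" by (simp add: algebra_simps)
        then have "m = s' - t' - (s + t) - (v0 + v0)" by (simp only: m_def scaleR_2)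
        moreover have "s \<in> M" "t \<in> M" "s' \<in> M" "t' \<in> M" using st s't' S(1) L_subset T_subset by auto
        ultimately show ?thesis using v0 by (simp only: M_closed(2,4))
      qed
      then obtain i j where "m = of_int i *\<^sub>R a1 + of_int j *\<^sub>R a2" using M_gen by blast
      ultimately have "(of_int i + of_int j * real (k + 1)) * \<alpha> = - real (2 * k) * \<alpha>" "(of_int i - of_int j * real k) * \<alpha> = 0"
        using val[of "of_int i" "of_int j"] by simp_all
      then have ij: "real_of_int i + of_int j * real (k + 1) = - real (2 * k)" "real_of_int i - of_int j * real k = 0"
        using \<open>0 < \<alpha>\<close> by (metis mult_cancel_right less_irrefl mult_zero_left)+
      then have "real_of_int (j * (2 * int k + 1)) = real_of_int (- (2 * int k))" by (simp add: algebra_simps)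
      then have j: "j * (2 * int k + 1) = - (2 * int k)" by (simp only: of_int_eq_iff)
      have "2 * int k + 1 dvd 2 * int k" using j by (metis dvd_minus_iff dvd_triv_right)
      then show False using k zdvd_imp_le[of "2 * int k + 1" "2 * int k"] by simp
    next
      case reflection
      have into: "\<exists>s'\<in>S. \<exists>t'\<in>T. 2 *\<^sub>R c - (s + t) = s' - t'" if "s \<in> S" "t \<in> T" for s t
      proof -
        have "2 *\<^sub>R c - (s + t) \<in> S + uminus ` T" unfolding reflection using that by (intro imageI set_plus_intro)
        then show ?thesis by (auto simp: set_plus_def)
      qed
      have onto: "\<exists>s'\<in>S. \<exists>t'\<in>T. s - t = 2 *\<^sub>R c - (s' + t')" if "s \<in> S" "t \<in> T" for s t
      proof -
        have "s + - t \<in> S + uminus ` T" using that by (intro set_plus_intro) auto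
        then show ?thesis unfolding reflection by (auto simp: set_plus_def)
      qed
      have levels: "\<exists>lo\<in>S. \<exists>hi\<in>S. (\<forall>s\<in>S. h \<bullet> lo \<le> h \<bullet> s \<and> h \<bullet> s \<le> h \<bullet> hi) \<and> h \<bullet> (2 *\<^sub>R c) = h \<bullet> lo + h \<bullet> hi" for h
      proof -
        obtain lo hi where S': "lo \<in> S" "hi \<in> S" "\<And>s. s \<in> S \<Longrightarrow> h \<bullet> lo \<le> h \<bullet> s \<and> h \<bullet> s \<le> h \<bullet> hi"
          using S_extremes[of h] by blast
        obtain tmax where T': "tmax \<in> T" "\<And>t. t \<in> T \<Longrightarrow> h \<bullet> t \<le> h \<bullet> tmax" using T_extremes[of h] by blast
        obtain s1 t1 where 1: "s1 \<in> S" "t1 \<in> T" "2 *\<^sub>R c - (hi + tmax) = s1 - t1" using into[OF S'(2) T'(1)] by blast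
        obtain s2 t2 where 2: "s2 \<in> S" "t2 \<in> T" "lo - tmax = 2 *\<^sub>R c - (s2 + t2)" using onto[OF S'(1) T'(1)] by blast
        have "h \<bullet> (2 *\<^sub>R c) - (h \<bullet> hi + h \<bullet> tmax) = h \<bullet> s1 - h \<bullet> t1" "h \<bullet> lo - h \<bullet> tmax = h \<bullet> (2 *\<^sub>R c) - (h \<bullet> s2 + h \<bullet> t2)"
          using arg_cong[OF 1(3), of "\<lambda>x. h \<bullet> x"] arg_cong[OF 2(3), of "\<lambda>x. h \<bullet> x"]
          by (simp_all only: inner_add_right inner_diff_right)
        then have "h \<bullet> (2 *\<^sub>R c) = h \<bullet> lo + h \<bullet> hi"
          using S'(3)[OF 1(1)] S'(3)[OF 2(1)] T'(2)[OF 1(2)] T'(2)[OF 2(2)] by linarith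
        then show ?thesis using S' by blast
      qed
      have "u \<bullet> (2 *\<^sub>R c) \<in> \<int>" "v \<bullet> (2 *\<^sub>R c) \<in> \<int>"
        using levels[of u] levels[of v] ints S(1) by (metis Ints_add subsetD)+
      then have cL: "2 *\<^sub>R c \<in> L" by (rule dual_basis_in_L[OF dual])
      have "centrally_symmetric S"
      proof (rule centrally_symmetricI[of _ "2 *\<^sub>R c"])
        fix s assume s: "s \<in> S"
        show "2 *\<^sub>R c - s \<in> S"
        proof (rule strips)
          show "2 *\<^sub>R c - s \<in> L" using cL s S(1) L_closed(2) by blast
          fix h
          obtain lo hi where "lo \<in> S" "hi \<in> S" "h \<bullet> lo \<le> h \<bullet> s \<and> h \<bullet> s \<le> h \<bullet> hi" "h \<bullet> (2 *\<^sub>R c) = h \<bullet> lo + h \<bullet> hi"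
            using levels[of h] s by blast
          moreover have "h \<bullet> (2 *\<^sub>R c - s) = h \<bullet> (2 *\<^sub>R c) - h \<bullet> s" by (rule inner_diff_right)
          ultimately have "h \<bullet> lo \<le> h \<bullet> (2 *\<^sub>R c - s)" "h \<bullet> (2 *\<^sub>R c - s) \<le> h \<bullet> hi" by linarith+
          then show "(\<exists>p\<in>S. h \<bullet> p \<le> h \<bullet> (2 *\<^sub>R c - s)) \<and> (\<exists>q\<in>S. h \<bullet> (2 *\<^sub>R c - s) \<le> h \<bullet> q)"
            using \<open>lo \<in> S\<close> \<open>hi \<in> S\<close> by blast
        qed
      qed
      then show False using S(5) by blast
    qed
  qed
qed

end

section \<open>The equivalence\<close>

lemma lattice_of_rank_2:
  fixes G :: "(real^2) set"
  assumes "lattice_of_rank 2 G"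
  obtains x y where "lattice_basis [x, y] G"
  using assms unfolding lattice_of_rank_def by (auto simp: numeral_2_eq_2 length_Suc_conv)

lemma reflected_summand_trivial:
  assumes sym: "centrally_symmetric S \<or> centrally_symmetric T" and fin: "finite (S + T)" "finite (S + uminus ` T)"
  shows "trivially_homometric (S + T) (S + uminus ` T)"
  using sym
proof
  assume "centrally_symmetric S"
  then obtain c where c: "\<And>s. s \<in> S \<Longrightarrow> c - s \<in> S" using centrally_symmetricD by blast
  have "S + uminus ` T = (\<lambda>x. c - x) ` (S + T)"
  proof (intro equalityI subsetI)
    fix x assume "x \<in> S + uminus ` T"
    then obtain s t where st: "s \<in> S" "t \<in> T" "x = s - t" by (auto simp: set_plus_def)
    then have "(c - s) + t \<in> S + T" "x = c - ((c - s) + t)" using c by (auto intro: set_plus_intro)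
    then show "x \<in> (\<lambda>x. c - x) ` (S + T)" by blast
  next
    fix x assume "x \<in> (\<lambda>x. c - x) ` (S + T)"
    then obtain s t where st: "s \<in> S" "t \<in> T" "x = c - (s + t)" by (auto simp: set_plus_def)
    then have "x = (c - s) + - t" by simp
    then show "x \<in> S + uminus ` T" using c st by (blast intro: set_plus_intro)
  qed
  then show ?thesis using fin unfolding trivially_homometric_def
    by (intro conjI disjI2 exI[of _ "(1/2) *\<^sub>R c"]) simp_all
next
  assume "centrally_symmetric T"
  then obtain c where c: "\<And>t. t \<in> T \<Longrightarrow> c - t \<in> T" using centrally_symmetricD by blast
  have "S + uminus ` T = (\<lambda>x. x + - c) ` (S + T)"
  proof (intro equalityI subsetI)
    fix x assume "x \<in> S + uminus ` T"
    then obtain s t where st: "s \<in> S" "t \<in> T" "x = s - t" by (auto simp: set_plus_def)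
    then have "s + (c - t) \<in> S + T" "x = s + (c - t) + - c" using c by (auto intro: set_plus_intro)
    then show "x \<in> (\<lambda>x. x + - c) ` (S + T)" by blast
  next
    fix x assume "x \<in> (\<lambda>x. x + - c) ` (S + T)"
    then obtain s t where st: "s \<in> S" "t \<in> T" "x = s + t + - c" by (auto simp: set_plus_def)
    then have "x = s + - (c - t)" by simp
    then show "x \<in> S + uminus ` T" using c st by (blast intro: set_plus_intro)
  qed
  then show ?thesis using fin unfolding trivially_homometric_def by blast
qed

text \<open>
Membership of 0 in \<open>L\<close> puts \<open>T\<close> inside \<open>M\<close> and turns directness into the statement that distinct
points of \<open>T\<close> are incongruent modulo \<open>L\<close>.
\<close>

lemma planar_tile_of_tiling_triple:
  fixes M L T :: "(real^2) set"
  assumes triple: "(M, L, T) \<in> tiling_triples" and basis: "lattice_basis [b1, b2] L"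
  shows "planar_tile M L T b1 b2"
proof -
  have plane: "DIM(real^2) = 2" by simp
  have T: "T \<noteq> {}" "finite T" "L \<subseteq> M" and M_eq: "M = L + T" and direct: "direct L T"
    and rank: "lattice_of_rank 2 M"
    using triple unfolding tiling_triples_def plane by blast+
  obtain x y where M_basis: "lattice_basis [x, y] M" using lattice_of_rank_2[OF rank] .
  have M_group: "additive_subgroup M" using M_basis lattice_span_subgroup by (simp add: lattice_basis_pair_iff)
  have L_group: "additive_subgroup L" using basis lattice_span_subgroup by (simp add: lattice_basis_pair_iff)
  note L_zero = additive_subgroup_closed(1)[OF L_group]
  show ?thesis
  proof
    show "T \<subseteq> M"
    proof
      fix t assume "t \<in> T"
      then have "0 + t \<in> L + T" using L_zero by (rule set_plus_intro[rotated])
      then show "t \<in> M" using M_eq by simp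
    qed
    show "\<exists>l\<in>L. \<exists>t\<in>T. m = l + t" if "m \<in> M" for m using that unfolding M_eq by (auto simp: set_plus_def)
    show "s = t" if "s \<in> T" "t \<in> T" "s - t \<in> L" for s t
    proof -
      have "(s - t) + t = 0 + s" by simp
      from direct[unfolded direct_iff, rule_format, OF that(3) L_zero that(2,1) this] show ?thesis by (elim conjE) (rule sym)
    qed
    show "det2 b1 b2 \<noteq> 0" "L = {of_int i *\<^sub>R b1 + of_int j *\<^sub>R b2 | i j. True}"
      using basis by (simp_all add: lattice_basis_pair_iff)
  qed (use M_group L_group T in auto)
qed

theorem theorem2p4:
  fixes M L T S :: "(real^2) set"
  assumes "(M, L, T) \<in> tiling_triples"
    and "S \<subseteq> L"
  shows
    "(direct S T \<and> direct S (uminus ` T) \<and>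
      lattice_convex M (S + T) \<and> lattice_convex M (S + uminus ` T) \<and>
      nontrivially_homometric (S + T) (S + uminus ` T))
     \<longleftrightarrow>
     (\<exists>k::nat. k \<ge> 1 \<and>
       (\<exists>a1 a2 b1 b2. lattice_basis [a1, a2] M \<and> lattice_basis [b1, b2] L \<and>
          (b1 = real (k + 1) *\<^sub>R a1 - a2 \<and> b2 = real k *\<^sub>R a1 + a2) \<and>
          (\<exists>v\<in>M. T + {v} = multiples (real ` {0..k}) a1 \<union> (multiples (real ` {0..k - 1}) a1 + {a2})) \<and>
          (\<not> centrally_symmetric S \<and> finite S \<and> aff_dim S = 2 \<and> lattice_convex L S \<and>
           (\<forall>E. E edge_of (convex hull S) \<longrightarrow>
              parallel_to E b1 \<or> parallel_to E b2 \<or> parallel_to E (b2 - b1)))))"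
    (is "?lhs \<longleftrightarrow> ?rhs")
proof
  assume lhs: ?lhs
  have "lattice_of_rank 2 L" using assms(1) by (simp add: tiling_triples_def)
  then obtain c1 c2 where "lattice_basis [c1, c2] L" by (rule lattice_of_rank_2)
  then interpret planar_tile M L T c1 c2 by (rule planar_tile_of_tiling_triple[OF assms(1)])
  have fin: "finite (S + T)" "finite (S + uminus ` T)"
    and nontrivial: "\<not> trivially_homometric (S + T) (S + uminus ` T)"
    using lhs by (auto simp: nontrivially_homometric_def homometric_def)
  have asym: "\<not> centrally_symmetric S" "\<not> centrally_symmetric T"
    using reflected_summand_trivial[OF _ fin] nontrivial by blast+
  have "finite S"
  proof -
    obtain t where t: "t \<in> T" using T_nonempty by blast
    then have "(\<lambda>s. s + t) ` S \<subseteq> S + T" by (auto intro: set_plus_intro)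
    then have "finite ((\<lambda>s. s + t) ` S)" using fin(1) finite_subset by blast
    then show ?thesis by (rule finite_imageD) (simp add: inj_on_def)
  qed
  then show ?rhs using normal_form_of_convex_sum[OF assms(2) _ asym] lhs by blast
next
  assume ?rhs
  then obtain k a1 a2 b1 b2 v where k: "1 \<le> k" and M_basis: "lattice_basis [a1, a2] M" and L_basis: "lattice_basis [b1, b2] L"
    and b: "b1 = real (k + 1) *\<^sub>R a1 - a2" "b2 = real k *\<^sub>R a1 + a2"
    and v: "v \<in> M" "T + {v} = multiples (real ` {0..k}) a1 \<union> (multiples (real ` {0..k - 1}) a1 + {a2})"
    and S: "\<not> centrally_symmetric S" "finite S" "aff_dim S = 2" "lattice_convex L S"
    and edges: "\<And>E. E edge_of (convex hull S) \<Longrightarrow> parallel_to E b1 \<or> parallel_to E b2 \<or> parallel_to E (b2 - b1)"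
    by blast
  interpret planar_tile M L T b1 b2 by (rule planar_tile_of_tiling_triple[OF assms(1) L_basis])
  have M_eq: "M = {of_int i *\<^sub>R a1 + of_int j *\<^sub>R a2 | i j. True}" using M_basis by (simp add: lattice_basis_pair_iff)
  have "of_int 1 *\<^sub>R a1 + of_int 0 *\<^sub>R a2 \<in> M" "of_int 0 *\<^sub>R a1 + of_int 1 *\<^sub>R a2 \<in> M" unfolding M_eq by blast+
  then have a: "a1 \<in> M" "a2 \<in> M" by simp_all
  have M_gen: "\<exists>i j. m = of_int i *\<^sub>R a1 + of_int j *\<^sub>R a2" if "m \<in> M" for m using that unfolding M_eq by blast
  have direct: "direct S T" "direct S (uminus ` T)"
    using direct_summand[OF assms(2)] lattice_tile.direct_summand[OF reflected_tile assms(2)] by blast+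
  show ?lhs
    using direct convex_sums_of_normal_form[OF k a M_gen b v assms(2) S(2-4,1) edges]
      homometric_reflected_summand[OF direct S(2) finite_T]
    unfolding nontrivially_homometric_def by blast
qed

end
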